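(* Let $\pi\colon S^3\to S^2\cong\mathbb{CP}^1$ be a conformal fibration with circles as fibers, that is, a conformal submersion all of whose fibers are circles. Then the holomorphic curve $$\gamma\colon\mathbb{CP}^1\to\mathcal Q^3\subset PW,$$ which maps each $p\in\mathbb{CP}^1$ to the point of $\mathcal Q^3$ representing the fiber $\pi^{-1}(p)$ with its induced orientation, has degree $1$.
   Context: Regard $\mathbb H^2$ as a right $\mathbb H$-vector space and identify $\mathbb H^2\cong\mathbb C^4$ via right multiplication by $i$, i.e. $(z_1+jz_2,z_3+jz_4)\leftrightarrow(z_1,z_2,z_3,z_4)$. The twistor projection is $\mathbb{CP}^3\to\mathbb{HP}^1$, $e\mapsto e\mathbb H$. The unit sphere $S^3\subset\mathbb H=\mathbb R^4$, with its round conformal structure, is embedded in $\mathbb{HP}^1$ by $x\mapsto[x:1]$; its image is the set of isotropic lines of $\langle v,w\rangle=\bar v_1w_1-\bar v_2w_2$. $Q=\{[z]:|z_1|^2+|z_2|^2-|z_3|^2-|z_4|^2=0\}\subset\mathbb{CP}^3$ is the preimage of $S^3$. It is identified with the bundle of oriented tangent lines of $S^3$: the oriented line spanned by $x\mu\in T_xS^3$, $\mu\in\operatorname{Im}\mathbb H$, $|\mu|=1$, corresponds to $\{(x,1)\lambda:\lambda\in\mathbb H,\ \mu\lambda=\lambda i\}\in Q$. The complex $2$-form $\Omega$ on $\mathbb C^4$ is defined by $\langle z,w\rangle=(z,w)+j\,\Omega(z,w)$ with $(z,w),\Omega(z,w)\in\mathbb C$, i.e. $\Omega(z,w)=z_1w_2-z_2w_1-z_3w_4+z_4w_3$.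 Put $W=\{\omega\in\Lambda^2(\mathbb C^4):\Omega(\omega)=0\}$, a $5$-dimensional complex space on which $(\omega,\eta)\mapsto\frac12(\Omega\wedge\Omega)(\omega\wedge\eta)$ is a non-degenerate symmetric bilinear form, and let $$\mathcal Q^3=\{[\omega]\in PW:\tfrac12(\Omega\wedge\Omega)(\omega\wedge\omega)=0\}.$$ Every point of $\mathcal Q^3$ has the form $[v\wedge w]$ with $\Omega(v,w)=0$. An oriented circle $k\subset S^3$ (the intersection of $S^3\subset\mathbb R^4$ with an oriented affine $2$-plane, containing more than one point) is represented by the unique $[v\wedge w]\in\mathcal Q^3$ such that $Q\cap P\operatorname{Span}(v,w)$ is the set of positively oriented tangent lines of $k$. A submersion of Riemannian manifolds is conformal if its differential at each point, restricted to the orthogonal complement of its kernel, is a conformal linear map. Orientation: $S^3$ is oriented so that the frame $(xi,xj,xk)$ of $T_xS^3$ is negatively oriented (the orientation for which the identification of the bundle of oriented tangent lines of $S^3$ with $Q$, sending the oriented line spanned by $x\mu\in T_xS^3$ to $\{(x,1)\lambda:\lambda\in\mathbb H,\ \mu\lambda=\lambda i\}$, is a CR isomorphism); $\mathbb{CP}^1$ has its complex orientation and $\pi$ is conformal with respect to its complex structure. The induced orientation of a fiber: a tangent vector $T$ to the fiber is positive if $T\wedge A\wedge B>0$ for $A,B\perp T$ with $\pi_*A\wedge\pi_*B>0$. The map $\gamma$ is known to be holomorphic (a theorem of Baird). Its degree is its degree as a holomorphic curve in $PW\cong\mathbb{CP}^4$, i.e. the number of intersection points, counted with multiplicity, with a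 hyperplane not containing its image. *)

theory Defs
  imports "HOL-Complex_Analysis.Complex_Analysis"
begin

section \<open>Quaternions\<close>

text \<open>The pair \<open>(a, b)\<close> stands for \<open>a + j b\<close>; since \<open>a j = j cnj a\<close>, this gives the product
  below, and \<open>k = i j = (0, - \<i>)\<close>. The norm and inner product of the product type are those
  of \<open>\<real>\<^sup>4\<close>.\<close>

type_synonym quat = "complex \<times> complex"

definition qmul :: "quat \<Rightarrow> quat \<Rightarrow> quat" (infixl "\<cdot>\<^sub>q" 70) where
  "p \<cdot>\<^sub>q q = (fst p * fst q - cnj (snd p) * snd q, cnj (fst p) * snd q + snd p * fst q)"

definition qcnj :: "quat \<Rightarrow> quat" where
  "qcnj q = (cnj (fst q), - snd q)"

text \<open>The \<open>i, j, k\<close> coordinates.\<close>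

definition qim :: "quat \<Rightarrow> real^3" where
  "qim q = vector [Im (fst q), Re (snd q), - Im (snd q)]"

text \<open>\<open>\<complex>\<^sup>4\<close> as \<open>\<bbbH>\<^sup>2\<close>, with right multiplication by \<open>i\<close> as complex structure.\<close>

definition to_H2 :: "complex^4 \<Rightarrow> quat \<times> quat" where
  "to_H2 z = ((z$1, z$2), (z$3, z$4))"

definition herm :: "quat \<times> quat \<Rightarrow> quat \<times> quat \<Rightarrow> quat" where
  "herm v w = qcnj (fst v) \<cdot>\<^sub>q fst w - qcnj (snd v) \<cdot>\<^sub>q snd w"


section \<open>Projective spaces, the quadrics\<close>

text \<open>A point of a complex projective space is a complex line, as a set of vectors
  (\<open>vec.span\<close> is the complex span).\<close>

definition projectivization :: "(complex^'n) set \<Rightarrow> (complex^'n) set set" where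
  "projectivization V = {vec.span {v} |v. v \<in> V \<and> v \<noteq> 0}"

abbreviation CP1 :: "(complex^2) set set" where
  "CP1 \<equiv> projectivization UNIV"

text \<open>\<open>\<langle>z, w\<rangle> = (z, w) + j \<Omega>(z, w)\<close>\<close>

definition Omega :: "complex^4 \<Rightarrow> complex^4 \<Rightarrow> complex" where
  "Omega z w = snd (herm (to_H2 z) (to_H2 w))"

lemma Omega_eq: "Omega z w = z$1 * w$2 - z$2 * w$1 - z$3 * w$4 + z$4 * w$3"
  by (simp add: Omega_def herm_def to_H2_def qcnj_def qmul_def)

definition Q :: "(complex^4) set set" where
  "Q = {vec.span {z} |z. z \<noteq> 0 \<and>
          (cmod (z$1))\<^sup>2 + (cmod (z$2))\<^sup>2 - (cmod (z$3))\<^sup>2 - (cmod (z$4))\<^sup>2 = 0}"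

text \<open>Elements of \<open>\<Lambda>\<^sup>2(\<complex>\<^sup>4)\<close> are alternating arrays: \<open>\<omega>\<close> stands for
  \<open>\<Sum>a<b. \<omega>$(a,b) e\<^sub>a \<and> e\<^sub>b\<close>, which is \<open>1/2\<close> times the sum over all \<open>a, b\<close>.\<close>

type_synonym bivector = "complex^(4 \<times> 4)"

definition Lambda2 :: "bivector set" where
  "Lambda2 = {\<omega>. \<forall>a b. \<omega>$(a,b) = - \<omega>$(b,a)}"

definition bwedge :: "complex^4 \<Rightarrow> complex^4 \<Rightarrow> bivector" where
  "bwedge v w = (\<chi> p. v$(fst p) * w$(snd p) - v$(snd p) * w$(fst p))"

definition Omega_biv :: "bivector \<Rightarrow> complex" where
  "Omega_biv \<omega> = (1/2) * (\<Sum>a\<in>UNIV. \<Sum>b\<in>UNIV. \<omega>$(a,b) * Omega (axis a 1) (axis b 1))"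

definition W :: "bivector set" where
  "W = {\<omega> \<in> Lambda2. Omega_biv \<omega> = 0}"

text \<open>Wedge product of two 2-forms, as the signed sum over the (2,2)-shuffles.\<close>

definition form_wedge ::
  "('v \<Rightarrow> 'v \<Rightarrow> complex) \<Rightarrow> ('v \<Rightarrow> 'v \<Rightarrow> complex) \<Rightarrow> 'v \<Rightarrow> 'v \<Rightarrow> 'v \<Rightarrow> 'v \<Rightarrow> complex" where
  "form_wedge \<alpha> \<beta> a b c d =
     \<alpha> a b * \<beta> c d - \<alpha> a c * \<beta> b d + \<alpha> a d * \<beta> b c
     + \<alpha> b c * \<beta> a d - \<alpha> b d * \<beta> a c + \<alpha> c d * \<beta> a b"

text \<open>\<open>1/2 (\<Omega> \<and> \<Omega>)(\<omega> \<and> \<eta>)\<close>; the factor \<open>1/4\<close> comes from summing over all indices in both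
  arguments.\<close>

definition bform :: "bivector \<Rightarrow> bivector \<Rightarrow> complex" where
  "bform \<omega> \<eta> = (1/4) * (\<Sum>a\<in>UNIV. \<Sum>b\<in>UNIV. \<Sum>c\<in>UNIV. \<Sum>d\<in>UNIV. \<omega>$(a,b) * \<eta>$(c,d) *
     ((1/2) * form_wedge Omega Omega (axis a 1) (axis b 1) (axis c 1) (axis d 1)))"

definition Q3 :: "bivector set set" where
  "Q3 = {vec.span {\<omega>} |\<omega>. \<omega> \<in> W \<and> \<omega> \<noteq> 0 \<and> bform \<omega> \<omega> = 0}"


section \<open>Circles and their tangent lines\<close>

abbreviation S3 :: "quat set" where "S3 \<equiv> sphere 0 1"
abbreviation S2 :: "(real^3) set" where "S2 \<equiv> sphere 0 1"

definition tangent :: "'a::real_inner \<Rightarrow> 'a set" where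
  "tangent x = {t. x \<bullet> t = 0}"

definition is_circle :: "quat set \<Rightarrow> bool" where
  "is_circle k \<longleftrightarrow> (\<exists>E. affine E \<and> aff_dim E = 2 \<and> k = S3 \<inter> E) \<and> (\<exists>x\<in>k. \<exists>y\<in>k. x \<noteq> y)"

text \<open>The point of \<open>Q\<close> corresponding to the oriented tangent line at \<open>x\<close> spanned by the unit
  vector \<open>T = x \<mu>\<close>, where \<open>\<mu> = qcnj x \<cdot>\<^sub>q T\<close>.\<close>

definition tangent_line :: "quat \<Rightarrow> quat \<Rightarrow> (complex^4) set" where
  "tangent_line x T =
     {z. \<exists>\<mu> l. T = x \<cdot>\<^sub>q \<mu> \<and> \<mu> \<cdot>\<^sub>q l = l \<cdot>\<^sub>q (\<i>, 0) \<and> to_H2 z = (x \<cdot>\<^sub>q l, l)}"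

text \<open>An oriented circle is encoded by the set of its pairs \<open>(x, T)\<close>, where \<open>x\<close> is a point of
  the circle and \<open>T\<close> the positive unit tangent vector at \<open>x\<close>.\<close>

definition represents :: "bivector set \<Rightarrow> (quat \<times> quat) set \<Rightarrow> bool" where
  "represents P K \<longleftrightarrow> P \<in> Q3 \<and>
     (\<exists>v w. bwedge v w \<noteq> 0 \<and> Omega v w = 0 \<and> P = vec.span {bwedge v w} \<and>
            Q \<inter> projectivization (vec.span {v, w}) = {tangent_line x T |x T. (x, T) \<in> K})"


section \<open>Conformal fibrations by circles\<close>

primrec Ck_on :: "nat \<Rightarrow> ('a::real_normed_vector \<Rightarrow> 'b::real_normed_vector) \<Rightarrow> 'a set \<Rightarrow> bool" where
  "Ck_on 0 f U \<longleftrightarrow> continuous_on U f"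
| "Ck_on (Suc n) f U \<longleftrightarrow> (\<forall>x\<in>U. f differentiable (at x)) \<and>
     (\<forall>v. Ck_on n (\<lambda>x. frechet_derivative f (at x) v) U)"

text \<open>A map on \<open>S\<^sup>3\<close> is extended to \<open>\<real>\<^sup>4 - {0}\<close> by making it constant along rays. It is smooth on
  \<open>S\<^sup>3\<close> iff the extension is smooth, and the derivative of the extension at \<open>x\<close>, restricted to
  the tangent space, is the differential at \<open>x\<close>.\<close>

definition radial :: "(quat \<Rightarrow> real^3) \<Rightarrow> quat \<Rightarrow> real^3" where
  "radial f y = f (y /\<^sub>R norm y)"

definition smooth_S3 :: "(quat \<Rightarrow> real^3) \<Rightarrow> bool" where
  "smooth_S3 f \<longleftrightarrow> (\<forall>n. Ck_on n (radial f) (- {0}))"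

definition differential :: "(quat \<Rightarrow> real^3) \<Rightarrow> quat \<Rightarrow> quat \<Rightarrow> real^3" where
  "differential f x = frechet_derivative (radial f) (at x)"

definition vertical :: "(quat \<Rightarrow> real^3) \<Rightarrow> quat \<Rightarrow> quat set" where
  "vertical f x = {T \<in> tangent x. differential f x T = 0}"

definition horizontal :: "(quat \<Rightarrow> real^3) \<Rightarrow> quat \<Rightarrow> quat set" where
  "horizontal f x = {A \<in> tangent x. \<forall>T \<in> vertical f x. A \<bullet> T = 0}"

definition conformal_submersion :: "(quat \<Rightarrow> real^3) \<Rightarrow> bool" where
  "conformal_submersion f \<longleftrightarrow>
     f ` S3 \<subseteq> S2 \<and> smooth_S3 f \<and>
     (\<forall>x\<in>S3. differential f x ` tangent x = tangent (f x)) \<and>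
     (\<forall>x\<in>S3. \<exists>c>0. \<forall>A \<in> horizontal f x. \<forall>B \<in> horizontal f x.
        differential f x A \<bullet> differential f x B = c * (A \<bullet> B))"

definition fiber :: "(quat \<Rightarrow> real^3) \<Rightarrow> real^3 \<Rightarrow> quat set" where
  "fiber f y = {x \<in> S3. f x = y}"

definition conformal_circle_fibration :: "(quat \<Rightarrow> real^3) \<Rightarrow> bool" where
  "conformal_circle_fibration f \<longleftrightarrow>
     conformal_submersion f \<and> (\<forall>y\<in>S2. is_circle (fiber f y))"

text \<open>The identification of \<open>\<complex>P\<^sup>1\<close> with the round sphere (inverse stereographic projection).
  Along \<open>\<zeta> \<mapsto> [1 : \<zeta>]\<close> at \<open>\<zeta> = 0\<close>, the image point is \<open>e\<^sub>3\<close>, and the directions \<open>1\<close> and \<open>\<i>\<close> go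
  to \<open>2 e\<^sub>1\<close> and \<open>2 e\<^sub>2\<close>. So it is holomorphic for, and the complex orientation corresponds to,
  the orientation of \<open>S\<^sup>2\<close> given by the outer normal.\<close>

definition bloch :: "complex^2 \<Rightarrow> real^3" where
  "bloch z = vector [2 * Re (cnj (z$1) * z$2), 2 * Im (cnj (z$1) * z$2),
                     (cmod (z$1))\<^sup>2 - (cmod (z$2))\<^sup>2]
             /\<^sub>R ((cmod (z$1))\<^sup>2 + (cmod (z$2))\<^sup>2)"

definition CP1_to_S2 :: "(complex^2) set \<Rightarrow> real^3" where
  "CP1_to_S2 p = (THE y. \<exists>z\<in>p. z \<noteq> 0 \<and> y = bloch z)"

definition positive_S2 :: "real^3 \<Rightarrow> real^3 \<Rightarrow> real^3 \<Rightarrow> bool" where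
  "positive_S2 y A B \<longleftrightarrow> y \<bullet> cross3 A B > 0"

text \<open>The frame \<open>(x i, x j, x k)\<close> is negatively oriented.\<close>

definition positive_S3 :: "quat \<Rightarrow> quat \<Rightarrow> quat \<Rightarrow> quat \<Rightarrow> bool" where
  "positive_S3 x T A B \<longleftrightarrow>
     det (vector [qim (qcnj x \<cdot>\<^sub>q T), qim (qcnj x \<cdot>\<^sub>q A), qim (qcnj x \<cdot>\<^sub>q B)] :: real^3^3) < 0"

definition positive_vertical :: "(quat \<Rightarrow> real^3) \<Rightarrow> quat \<Rightarrow> quat \<Rightarrow> bool" where
  "positive_vertical f x T \<longleftrightarrow> T \<in> vertical f x \<and>
     (\<forall>A \<in> tangent x. \<forall>B \<in> tangent x. A \<bullet> T = 0 \<and> B \<bullet> T = 0 \<and>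
        positive_S2 (f x) (differential f x A) (differential f x B) \<longrightarrow> positive_S3 x T A B)"

definition oriented_fiber :: "(quat \<Rightarrow> real^3) \<Rightarrow> real^3 \<Rightarrow> (quat \<times> quat) set" where
  "oriented_fiber f y = {(x, T). x \<in> fiber f y \<and> norm T = 1 \<and> positive_vertical f x T}"

definition fiber_curve :: "(quat \<Rightarrow> real^3) \<Rightarrow> (complex^2) set \<Rightarrow> bivector set" where
  "fiber_curve f p = (THE P. represents P (oriented_fiber f (CP1_to_S2 p)))"


section \<open>Holomorphic curves and their degree\<close>

text \<open>For linearly independent \<open>a, b\<close>, the map \<open>\<zeta> \<mapsto> [a + \<zeta> b]\<close> is the inverse of an affine
  coordinate on \<open>\<complex>P\<^sup>1\<close> centered at \<open>[a]\<close>. \<open>F\<close> is a holomorphic lift of \<open>g\<close> near \<open>[a]\<close>, in this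
  coordinate.\<close>

definition local_lift ::
  "((complex^2) set \<Rightarrow> (complex^'n) set) \<Rightarrow> complex^2 \<Rightarrow> complex^2 \<Rightarrow> (complex \<Rightarrow> complex^'n) \<Rightarrow> bool"
where
  "local_lift g a b F \<longleftrightarrow> a$1 * b$2 - a$2 * b$1 \<noteq> 0 \<and>
     (\<exists>r>0. (\<forall>i. (\<lambda>\<zeta>. F \<zeta> $ i) holomorphic_on ball 0 r) \<and>
            (\<forall>\<zeta>\<in>ball 0 r. F \<zeta> \<noteq> 0 \<and> g (vec.span {a + \<zeta> *s b}) = vec.span {F \<zeta>}))"

definition holomorphic_curve ::
  "((complex^2) set \<Rightarrow> (complex^'n) set) \<Rightarrow> (complex^'n) set set \<Rightarrow> bool" where
  "holomorphic_curve g X \<longleftrightarrow> g ` CP1 \<subseteq> X \<and>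
     (\<forall>a b. a$1 * b$2 - a$2 * b$1 \<noteq> 0 \<longrightarrow> (\<exists>F. local_lift g a b F))"

text \<open>The hyperplane with coefficient vector \<open>c\<close> is the zero set of \<open>lin_form c\<close>.\<close>

definition lin_form :: "complex^'n \<Rightarrow> complex^'n \<Rightarrow> complex" where
  "lin_form c v = (\<Sum>i\<in>UNIV. c$i * v$i)"

definition hyperplane_points ::
  "((complex^2) set \<Rightarrow> (complex^'n) set) \<Rightarrow> complex^'n \<Rightarrow> (complex^2) set set" where
  "hyperplane_points g c = {p \<in> CP1. g p \<subseteq> {v. lin_form c v = 0}}"

definition intersection_mult ::
  "((complex^2) set \<Rightarrow> (complex^'n) set) \<Rightarrow> complex^'n \<Rightarrow> (complex^2) set \<Rightarrow> nat" where
  "intersection_mult g c p =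
     (THE m. \<exists>a b F. p = vec.span {a} \<and> local_lift g a b F \<and>
                     zorder (\<lambda>\<zeta>. lin_form c (F \<zeta>)) 0 = int m)"

text \<open>For a curve in \<open>PV\<close> with \<open>V\<close> a subspace of \<open>\<complex>\<^sup>n\<close>, the hyperplanes of \<open>PV\<close> not containing
  the image are the intersections with \<open>PV\<close> of the hyperplanes considered here, with the same
  multiplicities.\<close>

definition has_degree :: "((complex^2) set \<Rightarrow> (complex^'n) set) \<Rightarrow> nat \<Rightarrow> bool" where
  "has_degree g d \<longleftrightarrow>
     (\<forall>c. hyperplane_points g c \<noteq> CP1 \<longrightarrow>
        finite (hyperplane_points g c) \<and>
        (\<Sum>p\<in>hyperplane_points g c. intersection_mult g c p) = d)"

end

theory Submission
  imports Defs
begin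

text \<open>The oriented tangent lines of an oriented circle are the null lines of a Lagrangian plane of \<open>\<complex>\<^sup>4\<close>.
  The Lagrangian planes complementary to the twistor line \<open>(x\<^sub>0, 1)\<bbbH>\<close> are graphs: with
  \<open>q = x\<^sub>0* a + b\<close> and \<open>p = x\<^sub>0* a - b\<close> (a star for conjugation) they are given by \<open>q = M p\<close> for a trace-free
  complex \<open>2 \<times> 2\<close> matrix \<open>M\<close>, so the circles that avoid \<open>x\<^sub>0\<close> have such matrices as coordinates.
  If the tangent lines \<open>(x \<lambda>, \<lambda>)\<close> and \<open>(x' \<lambda>', \<lambda>')\<close> belong to circles with matrices \<open>M\<close> and \<open>M'\<close>, then
  \<open>det (p, (M' - M) p')\<close> is exactly twice the \<open>j\<close>-part of \<open>\<lambda>* (x* x' - 1) \<lambda>'\<close>. Let \<open>x'\<close> tend to \<open>x\<close> along a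
  horizontal slice of the fibration. Since the differential of \<open>\<pi>\<close> commutes with the rotation by a right
  angle, the right-hand side is complex linear in the coordinate \<open>\<zeta>\<close> of the fiber to first order. Three
  points \<open>x\<close> of one fiber determine \<open>M\<close>, so \<open>M\<close> is complex differentiable.

  The planes that meet the twistor line of \<open>x\<^sub>0\<close> form a hyperplane section. The curve of fibers meets it
  only in the fiber through \<open>x\<^sub>0\<close>, and transversally by the same limit. With this fiber at \<open>\<zeta> = \<infinity>\<close>, a lift
  of the curve is therefore entire of linear growth. By Liouville's theorem it is \<open>A + \<zeta> B\<close>, which is a line.\<close>

section \<open>Quaternion algebra\<close>

text \<open>In the coordinates (q, p) twice the form \<Omega> is det (q, p') + det (p, q'), which on
  the graph of M equals tr M det (p, p'); this is why Lagrangian graphs are those of trace-free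
  matrices. Applied to tangent lines of two different fibers, the same identity is the exact
  relation between M and M'. The obstacle is regularity: the matrices are chosen fiber by fiber, so
  not even continuity of M is available at first. The relation expresses difference quotients of M
  by points and tangent lines alone, and these are under control. Three points suffice because M
  corresponds to the binary quadratic form det (p, M p), determined by its values at three pairwise
  independent vectors. The points on neighbouring fibers come from an open mapping theorem, since a
  map differentiable at one point is enough for the limit. The orientation of S3 enters through the
  sign of the unit tangent and makes the derivative complex linear instead of antilinear. The
  bivector of the graph is of degree two in the entries of M; it is the simple zero of the
  hyperplane section that keeps its growth linear.\<close>

lemma qmul_assoc: "(p \<cdot>\<^sub>q q) \<cdot>\<^sub>q r = p \<cdot>\<^sub>q (q \<cdot>\<^sub>q r)"
  by (simp add: qmul_def algebra_simps)

lemma qmul_distrib: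
  "p \<cdot>\<^sub>q (q + r) = p \<cdot>\<^sub>q q + p \<cdot>\<^sub>q r" "(p + q) \<cdot>\<^sub>q r = p \<cdot>\<^sub>q r + q \<cdot>\<^sub>q r"
  "p \<cdot>\<^sub>q (q - r) = p \<cdot>\<^sub>q q - p \<cdot>\<^sub>q r" "(p - q) \<cdot>\<^sub>q r = p \<cdot>\<^sub>q r - q \<cdot>\<^sub>q r"
  "p \<cdot>\<^sub>q (- q) = - (p \<cdot>\<^sub>q q)" "(- p) \<cdot>\<^sub>q q = - (p \<cdot>\<^sub>q q)"
  by (simp_all add: qmul_def algebra_simps)

lemma qmul_scaleR: "p \<cdot>\<^sub>q (c *\<^sub>R q) = c *\<^sub>R (p \<cdot>\<^sub>q q)" "(c *\<^sub>R p) \<cdot>\<^sub>q q = c *\<^sub>R (p \<cdot>\<^sub>q q)"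
  by (simp_all add: qmul_def scaleR_conv_of_real algebra_simps)

lemma qmul_0 [simp]: "p \<cdot>\<^sub>q 0 = 0" "0 \<cdot>\<^sub>q p = 0"
  by (simp_all add: qmul_def prod_eq_iff)

lemma qmul_1 [simp]: "p \<cdot>\<^sub>q (1, 0) = p" "(1, 0) \<cdot>\<^sub>q p = p"
  by (simp_all add: qmul_def)

lemma qmul_complex: "p \<cdot>\<^sub>q (s, 0) = (fst p * s, snd p * s)"
  by (simp add: qmul_def)

lemma qmul_ii: "p \<cdot>\<^sub>q (\<i>, 0) \<cdot>\<^sub>q (\<i>, 0) = - p"
  by (simp add: qmul_complex prod_eq_iff mult.assoc)

lemma qcnj_qmul: "qcnj (p \<cdot>\<^sub>q q) = qcnj q \<cdot>\<^sub>q qcnj p"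
  by (simp add: qmul_def qcnj_def algebra_simps)

lemma qcnj_linear:
  "qcnj (p + q) = qcnj p + qcnj q" "qcnj (p - q) = qcnj p - qcnj q" "qcnj (- p) = - qcnj p"
  "qcnj (c *\<^sub>R p) = c *\<^sub>R qcnj p" "qcnj 0 = 0" "qcnj (qcnj p) = p"
  by (simp_all add: qcnj_def prod_eq_iff)

lemma inner_quat: "p \<bullet> q = Re (fst (qcnj p \<cdot>\<^sub>q q))"
  by (simp add: inner_prod_def inner_complex_def qcnj_def qmul_def algebra_simps)

lemma norm_quat: "(norm q)\<^sup>2 = (cmod (fst q))\<^sup>2 + (cmod (snd q))\<^sup>2"
  by (simp add: norm_prod_def)

lemma qcnj_mult_self: "qcnj q \<cdot>\<^sub>q q = (of_real ((norm q)\<^sup>2), 0)" "q \<cdot>\<^sub>q qcnj q = (of_real ((norm q)\<^sup>2), 0)"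
  unfolding norm_quat
  by (simp_all add: qcnj_def qmul_def complex_norm_square mult.commute del: of_real_power)

lemma qcnj_unit: "norm q = 1 \<Longrightarrow> qcnj q \<cdot>\<^sub>q q = (1, 0)" "norm q = 1 \<Longrightarrow> q \<cdot>\<^sub>q qcnj q = (1, 0)"
  by (simp_all add: qcnj_mult_self)

lemma qcnj_unit_cancel:
  "norm q = 1 \<Longrightarrow> qcnj q \<cdot>\<^sub>q (q \<cdot>\<^sub>q p) = p" "norm q = 1 \<Longrightarrow> q \<cdot>\<^sub>q (qcnj q \<cdot>\<^sub>q p) = p"
  by (simp_all add: qmul_assoc[symmetric] qcnj_unit)

lemma norm_qcnj [simp]: "norm (qcnj q) = norm q"
  by (simp add: qcnj_def norm_prod_def)

lemma norm_qmul: "norm (p \<cdot>\<^sub>q q) = norm p * norm q"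
proof -
  have "(of_real ((norm (p \<cdot>\<^sub>q q))\<^sup>2), 0) = qcnj q \<cdot>\<^sub>q ((qcnj p \<cdot>\<^sub>q p) \<cdot>\<^sub>q q)"
    by (metis qcnj_mult_self(1) qcnj_qmul qmul_assoc)
  also have "\<dots> = (norm p)\<^sup>2 *\<^sub>R (qcnj q \<cdot>\<^sub>q q)"
    unfolding qcnj_mult_self(1)[of p] by (simp add: qmul_def scaleR_conv_of_real algebra_simps)
  also have "\<dots> = (of_real ((norm p * norm q)\<^sup>2), 0)"
    by (simp add: qcnj_mult_self scaleR_conv_of_real power_mult_distrib)
  finally have "(norm (p \<cdot>\<^sub>q q))\<^sup>2 = (norm p * norm q)\<^sup>2"
    by (metis of_real_eq_iff prod.inject)
  then show ?thesis by (simp add: power2_eq_iff_nonneg)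
qed

lemma qmul_eq_0: "p \<cdot>\<^sub>q q = 0 \<longleftrightarrow> p = 0 \<or> q = 0"
  by (metis mult_eq_0_iff norm_eq_zero norm_qmul)

lemma bounded_bilinear_qmul: "bounded_bilinear (\<cdot>\<^sub>q)"
  by standard (auto simp: qmul_distrib qmul_scaleR norm_qmul intro: exI[of _ 1])

lemmas tendsto_qmul = bounded_bilinear.tendsto[OF bounded_bilinear_qmul]
lemmas continuous_on_qmul [continuous_intros] = bounded_bilinear.continuous_on[OF bounded_bilinear_qmul]

lemma bounded_linear_qcnj: "bounded_linear qcnj"
  by (rule bounded_linear_intro[of _ 1]) (simp_all add: qcnj_linear)

lemmas tendsto_qcnj = bounded_linear.tendsto[OF bounded_linear_qcnj]

section \<open>Imaginary quaternions as vectors of Euclidean three-space\<close>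

definition qvec :: "real^3 \<Rightarrow> quat" where
  "qvec t = (\<i> * t$1, Complex (t$2) (- t$3))"

lemma qim_qvec [simp]: "qim (qvec t) = t"
  by (simp add: qim_def qvec_def vec_eq_iff forall_3)

lemma qvec_qim: "Re (fst q) = 0 \<Longrightarrow> qvec (qim q) = q"
  by (cases q) (simp add: qim_def qvec_def complex_eq_iff)

lemma Re_fst_qvec [simp]: "Re (fst (qvec t)) = 0"
  by (simp add: qvec_def)

lemma qvec_linear: "qvec (s + t) = qvec s + qvec t" "qvec (c *\<^sub>R t) = c *\<^sub>R qvec t"
  "qvec (- t) = - qvec t" "qvec (s - t) = qvec s - qvec t" "qvec 0 = 0"
  by (simp_all add: qvec_def complex_eq_iff algebra_simps zero_prod_def)

lemma qcnj_qvec [simp]: "qcnj (qvec t) = - qvec t"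
  by (simp add: qvec_def qcnj_def complex_eq_iff)

lemma norm_qvec [simp]: "norm (qvec t) = norm t"
proof -
  have "(norm (qvec t))\<^sup>2 = (norm t)\<^sup>2"
    unfolding norm_quat power2_norm_eq_inner[of t]
    by (simp only: cmod_power2) (simp add: qvec_def norm_mult cmod_power2 power_mult_distrib inner_vec_def sum_3 power2_eq_square)
  then show ?thesis by (simp add: power2_eq_iff_nonneg)
qed

lemma bounded_linear_qvec: "bounded_linear qvec"
  by (rule bounded_linear_intro[of _ 1]) (simp_all add: qvec_linear)

lemma qmul_qvec: "qvec s \<cdot>\<^sub>q qvec t = qvec (cross3 s t) - (of_real (s \<bullet> t), 0)"
  by (simp add: qvec_def qmul_def cross3_def complex_eq_iff inner_vec_def sum_3 algebra_simps)

section \<open>Eigenvectors of left multiplication by an imaginary unit\<close>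

lemma unit_imaginary_square:
  assumes "Re (fst \<mu>) = 0" "norm \<mu> = 1"
  shows "\<mu> \<cdot>\<^sub>q \<mu> = - (1, 0)"
proof -
  have "qcnj \<mu> = - \<mu>" using assms(1) by (simp add: qcnj_def prod_eq_iff complex_eq_iff)
  then show ?thesis using qcnj_unit(1)[OF assms(2)] by (metis minus_minus qmul_distrib(6))
qed

text \<open>Left multiplication by \<mu> and right multiplication by i commute and both square to
  -1, so l - \<mu> l i always satisfies the equation (it is twice a projection of l). Only its
  vanishing has to be excluded.\<close>

lemma exists_eigenvector:
  assumes "Re (fst \<mu>) = 0" "norm \<mu> = 1"
  shows "\<exists>l. l \<noteq> 0 \<and> \<mu> \<cdot>\<^sub>q l = l \<cdot>\<^sub>q (\<i>, 0)"
proof -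
  have *: "\<mu> \<cdot>\<^sub>q (l - \<mu> \<cdot>\<^sub>q l \<cdot>\<^sub>q (\<i>, 0)) = (l - \<mu> \<cdot>\<^sub>q l \<cdot>\<^sub>q (\<i>, 0)) \<cdot>\<^sub>q (\<i>, 0)" for l
  proof -
    have 1: "\<mu> \<cdot>\<^sub>q (\<mu> \<cdot>\<^sub>q l) = - l"
      using unit_imaginary_square[OF assms] by (metis qmul_1(2) qmul_assoc qmul_distrib(6))
    have "\<mu> \<cdot>\<^sub>q (\<mu> \<cdot>\<^sub>q l \<cdot>\<^sub>q (\<i>, 0)) = - (l \<cdot>\<^sub>q (\<i>, 0))"
      by (metis 1 qmul_assoc qmul_distrib(6))
    then show ?thesis
      by (simp add: qmul_distrib qmul_ii)
  qed
  \<comment> \<open>If 1 and j were both mapped to 0, the first would give \<mu> = - i and the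
    second \<mu> = i.\<close>
  have "(1, 0) - \<mu> \<cdot>\<^sub>q (1, 0) \<cdot>\<^sub>q (\<i>, 0) \<noteq> 0 \<or> (0, 1) - \<mu> \<cdot>\<^sub>q (0, 1) \<cdot>\<^sub>q (\<i>, 0) \<noteq> 0"
    by (cases \<mu>) (auto simp: qmul_def prod_eq_iff complex_eq_iff)
  then show ?thesis using * by blast
qed

text \<open>The eigenvector equation of \<open>qcnj x \<cdot>\<^sub>q T\<close>, multiplied by x. In
  this form it serves as the equation of the tangent line at x.\<close>

lemma tangent_eigenvector:
  assumes "norm x = 1" "norm T = 1" "x \<bullet> T = 0"
  shows "\<exists>l. l \<noteq> 0 \<and> T \<cdot>\<^sub>q l = x \<cdot>\<^sub>q l \<cdot>\<^sub>q (\<i>, 0)"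
proof -
  have "Re (fst (qcnj x \<cdot>\<^sub>q T)) = 0" "norm (qcnj x \<cdot>\<^sub>q T) = 1"
    using assms by (simp_all add: inner_quat norm_qmul)
  then obtain l where l: "l \<noteq> 0" "(qcnj x \<cdot>\<^sub>q T) \<cdot>\<^sub>q l = l \<cdot>\<^sub>q (\<i>, 0)" using exists_eigenvector by blast
  then have "x \<cdot>\<^sub>q ((qcnj x \<cdot>\<^sub>q T) \<cdot>\<^sub>q l) = x \<cdot>\<^sub>q l \<cdot>\<^sub>q (\<i>, 0)" by (simp add: qmul_assoc)
  then have "T \<cdot>\<^sub>q l = x \<cdot>\<^sub>q l \<cdot>\<^sub>q (\<i>, 0)" using assms(1) by (simp add: qmul_assoc qcnj_unit_cancel)
  then show ?thesis using l(1) by blast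
qed

section \<open>The Lagrangian plane of an oriented circle\<close>

text \<open>A value of \<Omega> is a j-part; this turns its vanishing into a quaternionic identity
  that can be checked without coordinates.\<close>

lemma snd_eq_0_iff: "snd p = 0 \<longleftrightarrow> p \<cdot>\<^sub>q (\<i>, 0) = (\<i>, 0) \<cdot>\<^sub>q p"
  by (auto simp: qmul_def)

lemma qcnj_i: "qcnj (\<i>, 0) \<cdot>\<^sub>q p = - ((\<i>, 0) \<cdot>\<^sub>q p)"
  by (simp add: qcnj_def qmul_def)

lemma orthogonal_qcnj:
  assumes "p \<bullet> q = 0"
  shows "qcnj p \<cdot>\<^sub>q q = - (qcnj q \<cdot>\<^sub>q p)" "p \<cdot>\<^sub>q qcnj q = - (q \<cdot>\<^sub>q qcnj p)"
  using assms
  by (auto simp: inner_prod_def inner_complex_def qcnj_def qmul_def prod_eq_iff complex_eq_iff algebra_simps)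

lemma imaginary_iff: "Re (fst p) = 0 \<longleftrightarrow> qcnj p = - p"
  by (auto simp: qcnj_def prod_eq_iff complex_eq_iff)

text \<open>Since \<mu> is minus its conjugate, the product \<open>qcnj b \<cdot>\<^sub>q c\<close>
  commutes with i and is therefore complex. So the eigenvectors form a single complex line.\<close>

lemma eigenvector_multiple:
  assumes "Re (fst \<mu>) = 0" "\<mu> \<cdot>\<^sub>q b = b \<cdot>\<^sub>q (\<i>, 0)" "\<mu> \<cdot>\<^sub>q c = c \<cdot>\<^sub>q (\<i>, 0)" "b \<noteq> 0"
  shows "\<exists>s. c = b \<cdot>\<^sub>q (s, 0)"
proof -
  have \<mu>: "qcnj \<mu> = - \<mu>" using assms(1) by (simp add: imaginary_iff)
  have "qcnj (\<mu> \<cdot>\<^sub>q b) = qcnj (b \<cdot>\<^sub>q (\<i>, 0))" using assms by simp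
  then have *: "qcnj b \<cdot>\<^sub>q \<mu> = (\<i>, 0) \<cdot>\<^sub>q qcnj b"
    unfolding qcnj_qmul qcnj_i \<mu> qmul_distrib by (simp only: neg_equal_iff_equal)
  have "qcnj b \<cdot>\<^sub>q c \<cdot>\<^sub>q (\<i>, 0) = qcnj b \<cdot>\<^sub>q \<mu> \<cdot>\<^sub>q c"
    by (simp add: qmul_assoc assms)
  also have "\<dots> = (\<i>, 0) \<cdot>\<^sub>q (qcnj b \<cdot>\<^sub>q c)"
    unfolding * by (simp add: qmul_assoc)
  finally obtain s where s: "qcnj b \<cdot>\<^sub>q c = (s, 0)"
    using snd_eq_0_iff by (metis prod.collapse)
  have "b \<cdot>\<^sub>q (s, 0) = (norm b)\<^sup>2 *\<^sub>R c"
    unfolding s[symmetric] qmul_assoc[symmetric] qcnj_mult_self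
    by (simp add: qmul_def prod_eq_iff scaleR_conv_of_real)
  moreover have "b \<cdot>\<^sub>q (s /\<^sub>R (norm b)\<^sup>2, 0) = (b \<cdot>\<^sub>q (s, 0)) /\<^sub>R (norm b)\<^sup>2"
    by (simp add: qmul_complex prod_eq_iff)
  ultimately have "c = b \<cdot>\<^sub>q (s /\<^sub>R (norm b)\<^sup>2, 0)" using assms(4) by simp
  then show ?thesis by blast
qed

lemma eigenvalue_imaginary:
  assumes "b \<noteq> 0" "\<mu> \<cdot>\<^sub>q b = b \<cdot>\<^sub>q (\<i>, 0)"
  shows "Re (fst \<mu>) = 0" "norm \<mu> = 1"
proof -
  have "norm \<mu> * norm b = norm b" using arg_cong[OF assms(2), of norm]
    unfolding norm_qmul by (simp add: norm_Pair)
  then show "norm \<mu> = 1" using assms(1) by simp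
  have "(norm b)\<^sup>2 *\<^sub>R \<mu> = b \<cdot>\<^sub>q (\<i>, 0) \<cdot>\<^sub>q qcnj b"
    unfolding assms(2)[symmetric] by (simp add: qmul_assoc qcnj_mult_self)
      (simp add: qmul_def prod_eq_iff scaleR_conv_of_real)
  moreover have "Re (fst (b \<cdot>\<^sub>q (\<i>, 0) \<cdot>\<^sub>q qcnj b)) = 0"
    by (simp add: qmul_def qcnj_def algebra_simps)
  ultimately have "(norm b)\<^sup>2 * Re (fst \<mu>) = 0" by (metis fst_scaleR scaleR_complex.simps(1))
  then show "Re (fst \<mu>) = 0" using assms(1) by simp
qed

text \<open>Commuting with w leaves the real part of s free and forces the cross product of the
  imaginary parts to vanish, so these are parallel.\<close>

lemma commutes_imaginary_unit:
  assumes "Re (fst w) = 0" "norm w = 1" "w \<cdot>\<^sub>q s = s \<cdot>\<^sub>q w"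
  shows "\<exists>\<alpha> \<beta>. s = \<alpha> *\<^sub>R (1, 0) + \<beta> *\<^sub>R w"
proof -
  define t where "t = qim w"
  have t: "w = qvec t" using assms(1) by (simp add: t_def qvec_qim)
  have nt: "t \<bullet> t = 1" using assms(2) unfolding t by (simp add: norm_eq_1)
  define \<sigma> where "\<sigma> = qim s"
  have s: "s = Re (fst s) *\<^sub>R (1, 0) + qvec \<sigma>"
    by (cases s) (simp add: \<sigma>_def qim_def qvec_def complex_eq_iff)
  have "qvec \<sigma> = s - Re (fst s) *\<^sub>R (1, 0)" using s by (metis add_diff_cancel_left')
  then have "qvec t \<cdot>\<^sub>q qvec \<sigma> = qvec \<sigma> \<cdot>\<^sub>q qvec t"
    using assms(3) unfolding t by (simp only: qmul_distrib qmul_scaleR qmul_1)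
  then have "qvec (cross3 t \<sigma>) = qvec (cross3 \<sigma> t)"
    by (simp add: qmul_qvec inner_commute)
  then have "cross3 t \<sigma> = cross3 \<sigma> t" by (metis qim_qvec)
  then have c: "cross3 t \<sigma> = 0" by (metis cross_skew neg_eq_iff_add_eq_0 scaleR_2 scaleR_eq_0_iff zero_neq_numeral)
  have "cross3 (cross3 t \<sigma>) t = (t \<bullet> t) *\<^sub>R \<sigma> - (t \<bullet> \<sigma>) *\<^sub>R t"
    by (simp add: cross3_def inner_vec_def sum_3 vec_eq_iff forall_3 algebra_simps)
  then have "\<sigma> = (t \<bullet> \<sigma>) *\<^sub>R t" unfolding c nt by simp
  then show ?thesis using s t qvec_linear(2) by metis
qed

text \<open>m is the foot of the perpendicular from the origin to the plane of the circle; hence the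
  orthogonality and Pythagoras for the radius. The order of e1 and e2 is the orientation, so - e2 in
  place of e2 gives the reversed circle.\<close>

locale circle_data =
  fixes m e1 e2 :: quat and r :: real
  assumes ortho: "e1 \<bullet> e2 = 0" "m \<bullet> e1 = 0" "m \<bullet> e2 = 0"
    and unit: "norm e1 = 1" "norm e2 = 1" and rpos: "r > 0" and radius: "r\<^sup>2 + (norm m)\<^sup>2 = 1"
begin

definition dir :: "real \<Rightarrow> quat" where "dir t = cos t *\<^sub>R e1 + sin t *\<^sub>R e2"
text \<open>Left multiplication by \<open>u\<close> and right multiplication by \<open>w\<close>
  both turn e1 into e2 and e2 into - e1; on m, which is orthogonal to both, they differ by a sign.
  The equation u n = n w singles out the directions of the plane.\<close>

definition u :: quat where "u = e2 \<cdot>\<^sub>q qcnj e1"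
definition w :: quat where "w = qcnj e1 \<cdot>\<^sub>q e2"
definition ocircle :: "(quat \<times> quat) set" where
  "ocircle = {(m + r *\<^sub>R dir t, u \<cdot>\<^sub>q dir t) | t. True}"
text \<open>For \<open>x = m + r n\<close> and \<open>T = u n = n w\<close>, the first equation is \<open>r T b = r x b i\<close> rewritten for \<open>a = x b\<close>,
  and the second one its counterpart for \<open>x*\<close> and \<open>T*\<close>, since \<open>T* a = - b i\<close>. A single equation would not
  suffice: for \<open>m = 0\<close> the first one does not involve \<open>b\<close>.\<close>

definition plane :: "(quat \<times> quat) set" where
  "plane = {(a, b). u \<cdot>\<^sub>q a - u \<cdot>\<^sub>q m \<cdot>\<^sub>q b = r *\<^sub>R (a \<cdot>\<^sub>q (\<i>, 0)) \<and>
                   w \<cdot>\<^sub>q b - w \<cdot>\<^sub>q qcnj m \<cdot>\<^sub>q a = r *\<^sub>R (b \<cdot>\<^sub>q (\<i>, 0))}"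

lemma u_e1: "u \<cdot>\<^sub>q e1 = e2" and u_e2: "u \<cdot>\<^sub>q e2 = - e1"
  and e1_w: "e1 \<cdot>\<^sub>q w = e2" and e2_w: "e2 \<cdot>\<^sub>q w = - e1"
proof -
  show "u \<cdot>\<^sub>q e1 = e2" by (simp add: u_def qmul_assoc qcnj_unit unit)
  show "u \<cdot>\<^sub>q e2 = - e1"
    using orthogonal_qcnj(1)[OF ortho(1)]
    by (simp add: u_def qmul_assoc qcnj_unit unit qmul_distrib) (simp add: qmul_assoc[symmetric] qcnj_unit unit)
  show "e1 \<cdot>\<^sub>q w = e2" by (simp add: w_def qmul_assoc[symmetric] qcnj_unit unit)
  have "e2 \<cdot>\<^sub>q w = (e2 \<cdot>\<^sub>q qcnj e1) \<cdot>\<^sub>q e2" by (simp add: w_def qmul_assoc)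
  also have "e2 \<cdot>\<^sub>q qcnj e1 = - (e1 \<cdot>\<^sub>q qcnj e2)"
    using orthogonal_qcnj(2)[OF ortho(1)] by simp
  finally show "e2 \<cdot>\<^sub>q w = - e1" by (simp add: qmul_assoc qcnj_unit unit qmul_distrib)
qed

lemma imag_u: "qcnj u = - u" and imag_w: "qcnj w = - w" and norm_w: "norm w = 1" and norm_u: "norm u = 1"
  using orthogonal_qcnj[OF ortho(1)]
  by (simp_all add: u_def w_def qcnj_qmul qcnj_linear norm_qmul unit)

lemma u_dir: "u \<cdot>\<^sub>q dir t = dir t \<cdot>\<^sub>q w" "u \<cdot>\<^sub>q dir t = cos t *\<^sub>R e2 - sin t *\<^sub>R e1"
  by (simp_all add: dir_def qmul_distrib qmul_scaleR u_e1 u_e2 e1_w e2_w)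

text \<open>The conjugate of one factor times another changes sign when two orthogonal quaternions
  are exchanged; three such exchanges move m to the left.\<close>

lemma u_m: "u \<cdot>\<^sub>q m = - (m \<cdot>\<^sub>q w)"
proof -
  have "u \<cdot>\<^sub>q m = e2 \<cdot>\<^sub>q (qcnj e1 \<cdot>\<^sub>q m)" by (simp add: u_def qmul_assoc)
  also have "qcnj e1 \<cdot>\<^sub>q m = - (qcnj m \<cdot>\<^sub>q e1)" using orthogonal_qcnj(1)[OF ortho(2)] by simp
  also have "e2 \<cdot>\<^sub>q - (qcnj m \<cdot>\<^sub>q e1) = - (e2 \<cdot>\<^sub>q qcnj m) \<cdot>\<^sub>q e1" by (simp add: qmul_assoc qmul_distrib)
  also have "- (e2 \<cdot>\<^sub>q qcnj m) = m \<cdot>\<^sub>q qcnj e2" using orthogonal_qcnj(2)[OF ortho(3)] by simp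
  also have "m \<cdot>\<^sub>q qcnj e2 \<cdot>\<^sub>q e1 = - (m \<cdot>\<^sub>q w)"
    using orthogonal_qcnj(1)[OF ortho(1)] by (simp add: w_def qmul_assoc qmul_distrib)
  finally show ?thesis .
qed

lemma m_u: "qcnj m \<cdot>\<^sub>q u = - (w \<cdot>\<^sub>q qcnj m)"
  using arg_cong[OF u_m, of qcnj] by (simp add: qcnj_qmul qcnj_linear imag_u imag_w qmul_distrib) (metis minus_minus)

lemma norm_dir: "norm (dir t) = 1"
proof -
  have "(norm (dir t))\<^sup>2 = (cos t)\<^sup>2 + (sin t)\<^sup>2"
    using ortho unit
    unfolding power2_norm_eq_inner
    by (simp add: dir_def inner_add_left inner_add_right inner_commute
        norm_eq_1 power2_eq_square)
  then show ?thesis by (simp add: power2_eq_1_iff)  (smt (verit) norm_ge_zero)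
qed

lemma inner_m_dir: "m \<bullet> dir t = 0" by (simp add: dir_def inner_add_right ortho)

lemma norm_point: "norm (m + r *\<^sub>R dir t) = 1"
proof -
  have "(norm (m + r *\<^sub>R dir t))\<^sup>2 = 1"
    using radius norm_dir[of t] inner_m_dir[of t]
    unfolding power2_norm_eq_inner
    by (simp add: inner_add_left inner_add_right inner_commute norm_eq_1 power2_eq_square)
  then show ?thesis by (simp add: power2_eq_1_iff)  (smt (verit) norm_ge_zero)
qed

lemma inner_point_tangent: "(m + r *\<^sub>R dir t) \<bullet> (u \<cdot>\<^sub>q dir t) = 0"
  unfolding u_dir(2) using ortho unit
  by (simp add: dir_def inner_add_left inner_add_right inner_diff_right inner_commute norm_eq_1)

lemma ocircle_unit:
  assumes "(x, T) \<in> ocircle"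
  shows "norm x = 1" "norm T = 1" "x \<bullet> T = 0"
  using assms by (auto simp: ocircle_def norm_point inner_point_tangent norm_qmul norm_dir norm_u)

lemma plane_scale: "(a, b) \<in> plane \<Longrightarrow> (a \<cdot>\<^sub>q (s, 0), b \<cdot>\<^sub>q (s, 0)) \<in> plane"
proof -
  have c: "(\<i>, 0) \<cdot>\<^sub>q (s, 0) = (s, 0) \<cdot>\<^sub>q (\<i>, 0)" by (simp add: qmul_def)
  assume "(a, b) \<in> plane"
  then have "(u \<cdot>\<^sub>q a - u \<cdot>\<^sub>q m \<cdot>\<^sub>q b) \<cdot>\<^sub>q (s, 0) = r *\<^sub>R (a \<cdot>\<^sub>q (\<i>, 0)) \<cdot>\<^sub>q (s, 0)"
    "(w \<cdot>\<^sub>q b - w \<cdot>\<^sub>q qcnj m \<cdot>\<^sub>q a) \<cdot>\<^sub>q (s, 0) = r *\<^sub>R (b \<cdot>\<^sub>q (\<i>, 0)) \<cdot>\<^sub>q (s, 0)"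
    by (auto simp: plane_def)
  then show ?thesis
    by (simp add: plane_def qmul_distrib qmul_assoc qmul_scaleR c)
qed

lemma plane_add: "(a, b) \<in> plane \<Longrightarrow> (a', b') \<in> plane \<Longrightarrow> (a + a', b + b') \<in> plane"
  by (auto simp: plane_def qmul_distrib scaleR_add_right algebra_simps)

lemma plane_diff: "(a, b) \<in> plane \<Longrightarrow> (a', b') \<in> plane \<Longrightarrow> (a - a', b - b') \<in> plane"
  by (auto simp: plane_def qmul_distrib scaleR_diff_right algebra_simps)

text \<open>The quaternion whose j-part is \<Omega> has to commute with i. The plane equations
  express right multiplication by i through u and w, their conjugates do so for left multiplication,
  and the mixed terms agree because of \<open>u_m\<close> and \<open>m_u\<close>.\<close>

lemma plane_lagrangian:
  assumes "(a, b) \<in> plane" "(a', b') \<in> plane"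
  shows "snd (qcnj a \<cdot>\<^sub>q a' - qcnj b \<cdot>\<^sub>q b') = 0"
proof -
  let ?X = "qcnj a \<cdot>\<^sub>q a' - qcnj b \<cdot>\<^sub>q b'"
  have 1: "r *\<^sub>R (a' \<cdot>\<^sub>q (\<i>, 0)) = u \<cdot>\<^sub>q a' - u \<cdot>\<^sub>q m \<cdot>\<^sub>q b'"
    "r *\<^sub>R (b' \<cdot>\<^sub>q (\<i>, 0)) = w \<cdot>\<^sub>q b' - w \<cdot>\<^sub>q qcnj m \<cdot>\<^sub>q a'"
    using assms(2) by (auto simp: plane_def)
  have "qcnj (r *\<^sub>R (a \<cdot>\<^sub>q (\<i>, 0))) = qcnj (u \<cdot>\<^sub>q a - u \<cdot>\<^sub>q m \<cdot>\<^sub>q b)"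
    "qcnj (r *\<^sub>R (b \<cdot>\<^sub>q (\<i>, 0))) = qcnj (w \<cdot>\<^sub>q b - w \<cdot>\<^sub>q qcnj m \<cdot>\<^sub>q a)"
    using assms(1) by (auto simp: plane_def)
  then have "- (r *\<^sub>R ((\<i>, 0) \<cdot>\<^sub>q qcnj a)) = - (qcnj a \<cdot>\<^sub>q u - qcnj b \<cdot>\<^sub>q qcnj m \<cdot>\<^sub>q u)"
    "- (r *\<^sub>R ((\<i>, 0) \<cdot>\<^sub>q qcnj b)) = - (qcnj b \<cdot>\<^sub>q w - qcnj a \<cdot>\<^sub>q m \<cdot>\<^sub>q w)"
    by (simp_all only: qcnj_i qcnj_qmul qcnj_linear imag_u imag_w qmul_distrib qmul_assoc scaleR_minus_right
        minus_diff_minus)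
  then have 2: "r *\<^sub>R ((\<i>, 0) \<cdot>\<^sub>q qcnj a) = qcnj a \<cdot>\<^sub>q u - qcnj b \<cdot>\<^sub>q qcnj m \<cdot>\<^sub>q u"
    "r *\<^sub>R ((\<i>, 0) \<cdot>\<^sub>q qcnj b) = qcnj b \<cdot>\<^sub>q w - qcnj a \<cdot>\<^sub>q m \<cdot>\<^sub>q w"
    by (simp_all only: neg_equal_iff_equal)
  have "r *\<^sub>R (?X \<cdot>\<^sub>q (\<i>, 0)) = qcnj a \<cdot>\<^sub>q (r *\<^sub>R (a' \<cdot>\<^sub>q (\<i>, 0))) - qcnj b \<cdot>\<^sub>q (r *\<^sub>R (b' \<cdot>\<^sub>q (\<i>, 0)))"
    by (simp add: qmul_distrib qmul_assoc qmul_scaleR scaleR_diff_right)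
  also have "\<dots> = (r *\<^sub>R ((\<i>, 0) \<cdot>\<^sub>q qcnj a)) \<cdot>\<^sub>q a' - (r *\<^sub>R ((\<i>, 0) \<cdot>\<^sub>q qcnj b)) \<cdot>\<^sub>q b'"
    unfolding 1 2 by (simp add: qmul_distrib qmul_assoc u_m m_u)
  also have "\<dots> = r *\<^sub>R ((\<i>, 0) \<cdot>\<^sub>q ?X)"
    by (simp add: qmul_distrib qmul_assoc qmul_scaleR scaleR_diff_right)
  finally have "?X \<cdot>\<^sub>q (\<i>, 0) = (\<i>, 0) \<cdot>\<^sub>q ?X" using rpos by simp
  then show ?thesis by (simp only: snd_eq_0_iff)
qed

lemma plane_of_ocircle:
  assumes "(x, T) \<in> ocircle" "T \<cdot>\<^sub>q b = x \<cdot>\<^sub>q b \<cdot>\<^sub>q (\<i>, 0)"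
  shows "(x \<cdot>\<^sub>q b, b) \<in> plane"
proof -
  obtain t where t: "x = m + r *\<^sub>R dir t" "T = u \<cdot>\<^sub>q dir t" using assms(1) by (auto simp: ocircle_def)
  have xx: "qcnj x \<cdot>\<^sub>q x = (1, 0)" using ocircle_unit(1)[OF assms(1)] qcnj_unit(1) by blast
  have "u \<cdot>\<^sub>q x - u \<cdot>\<^sub>q m = r *\<^sub>R T" by (simp add: t qmul_distrib qmul_scaleR)
  then have "(u \<cdot>\<^sub>q x - u \<cdot>\<^sub>q m) \<cdot>\<^sub>q b = r *\<^sub>R (x \<cdot>\<^sub>q b \<cdot>\<^sub>q (\<i>, 0))"
    using assms(2) by (simp add: qmul_scaleR)
  moreover have "w \<cdot>\<^sub>q b - w \<cdot>\<^sub>q qcnj m \<cdot>\<^sub>q (x \<cdot>\<^sub>q b) = r *\<^sub>R (b \<cdot>\<^sub>q (\<i>, 0))"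
  proof -
    \<comment> \<open>Here 1 is written as the conjugate of x times x, and x - m is r times
      \<open>dir t\<close>.\<close>
    have "(1, 0) - qcnj m \<cdot>\<^sub>q x = r *\<^sub>R (qcnj (dir t) \<cdot>\<^sub>q x)"
      unfolding xx[symmetric] by (simp add: qcnj_linear qmul_distrib qmul_scaleR t scaleR_add_right)
    then have "w \<cdot>\<^sub>q ((1, 0) - qcnj m \<cdot>\<^sub>q x) = r *\<^sub>R (w \<cdot>\<^sub>q qcnj (dir t) \<cdot>\<^sub>q x)"
      by (simp add: qmul_scaleR qmul_assoc)
    also have "w \<cdot>\<^sub>q qcnj (dir t) = - qcnj T"
      unfolding t u_dir(1) by (simp add: qcnj_qmul imag_w qmul_distrib)
    also have "- qcnj T \<cdot>\<^sub>q x = qcnj x \<cdot>\<^sub>q T"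
      using orthogonal_qcnj(1)[OF ocircle_unit(3)[OF assms(1)]] by (simp add: qmul_distrib)
    finally have "w \<cdot>\<^sub>q ((1, 0) - qcnj m \<cdot>\<^sub>q x) \<cdot>\<^sub>q b = r *\<^sub>R (qcnj x \<cdot>\<^sub>q (T \<cdot>\<^sub>q b))"
      by (simp add: qmul_scaleR qmul_assoc)
    also have "qcnj x \<cdot>\<^sub>q (T \<cdot>\<^sub>q b) = b \<cdot>\<^sub>q (\<i>, 0)"
      unfolding assms(2) by (simp add: qmul_assoc[symmetric] xx)
    finally show ?thesis by (simp add: qmul_distrib qmul_assoc)
  qed
  ultimately show ?thesis by (simp add: plane_def qmul_distrib qmul_assoc)
qed

text \<open>A null vector determines x = a b^(-1), and then n by x = m + r n. The first plane
  equation makes T = u n a unit tangent vector, the second gives u n = n w. Then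
  \<open>qcnj e1 \<cdot>\<^sub>q n\<close> commutes with w, which forces n to be a combination of e1
  and e2.\<close>

lemma ocircle_of_plane:
  assumes "(a, b) \<in> plane" "norm a = norm b" "b \<noteq> 0"
  shows "\<exists>x T. (x, T) \<in> ocircle \<and> a = x \<cdot>\<^sub>q b \<and> T \<cdot>\<^sub>q b = a \<cdot>\<^sub>q (\<i>, 0)"
proof -
  define x where "x = (1 / (norm b)\<^sup>2) *\<^sub>R (a \<cdot>\<^sub>q qcnj b)"
  have a: "a = x \<cdot>\<^sub>q b"
    using assms(3) unfolding x_def
    by (simp add: qmul_scaleR qmul_assoc qcnj_mult_self)
      (simp add: qmul_def prod_eq_iff complex_eq_iff del: of_real_power)
  have nx: "norm x = 1" using assms(2,3) a by (auto simp: norm_qmul)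
  define n where "n = (1/r) *\<^sub>R (x - m)"
  have x: "x = m + r *\<^sub>R n" using rpos by (simp add: n_def)
  define T where "T = u \<cdot>\<^sub>q n"
  have xx: "qcnj x \<cdot>\<^sub>q x = (1, 0)" using nx by (simp add: qcnj_unit)
  have "r *\<^sub>R (T \<cdot>\<^sub>q b) = u \<cdot>\<^sub>q a - u \<cdot>\<^sub>q m \<cdot>\<^sub>q b"
    using rpos by (simp add: T_def a n_def qmul_distrib qmul_scaleR qmul_assoc)
  also have "\<dots> = r *\<^sub>R (a \<cdot>\<^sub>q (\<i>, 0))" using assms(1) by (simp add: plane_def)
  finally have Tb: "T \<cdot>\<^sub>q b = a \<cdot>\<^sub>q (\<i>, 0)" using rpos by simp
  have \<mu>: "(qcnj x \<cdot>\<^sub>q T) \<cdot>\<^sub>q b = b \<cdot>\<^sub>q (\<i>, 0)"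
    by (simp add: qmul_assoc Tb a) (simp add: qmul_assoc[symmetric] xx)
  note im = eigenvalue_imaginary[OF assms(3) \<mu>]
  have "norm T = 1" using im(2) nx by (simp add: norm_qmul)
  then have nn: "norm n = 1" by (simp add: T_def norm_qmul norm_u)
  have "qcnj (qcnj x \<cdot>\<^sub>q T) = - (qcnj x \<cdot>\<^sub>q T)" using im(1) imaginary_iff by blast
  then have TX: "qcnj T \<cdot>\<^sub>q x = - (qcnj x \<cdot>\<^sub>q T)" by (simp add: qcnj_qmul qcnj_linear)
  have "(1, 0) - qcnj m \<cdot>\<^sub>q x = r *\<^sub>R (qcnj n \<cdot>\<^sub>q x)"
    using rpos by (simp add: xx[symmetric] n_def qcnj_linear qmul_distrib qmul_scaleR)
  then have "r *\<^sub>R (w \<cdot>\<^sub>q qcnj n \<cdot>\<^sub>q x \<cdot>\<^sub>q b) = w \<cdot>\<^sub>q ((1, 0) - qcnj m \<cdot>\<^sub>q x) \<cdot>\<^sub>q b"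
    by (simp add: qmul_scaleR qmul_assoc)
  also have "\<dots> = w \<cdot>\<^sub>q b - w \<cdot>\<^sub>q qcnj m \<cdot>\<^sub>q a"
    by (simp add: a qmul_distrib qmul_assoc)
  also have "\<dots> = r *\<^sub>R ((qcnj x \<cdot>\<^sub>q T) \<cdot>\<^sub>q b)"
    using assms(1) by (simp add: plane_def \<mu>)
  finally have "(w \<cdot>\<^sub>q qcnj n \<cdot>\<^sub>q x - qcnj x \<cdot>\<^sub>q T) \<cdot>\<^sub>q b = 0" using rpos by (simp add: qmul_distrib)
  then have "w \<cdot>\<^sub>q qcnj n \<cdot>\<^sub>q x - qcnj x \<cdot>\<^sub>q T = 0"
    using assms(3) by (simp only: qmul_eq_0) simp
  then have "w \<cdot>\<^sub>q qcnj n \<cdot>\<^sub>q x = - qcnj T \<cdot>\<^sub>q x"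
    using TX by (simp add: qmul_distrib)
  then have "(w \<cdot>\<^sub>q qcnj n + qcnj T) \<cdot>\<^sub>q x = 0" by (simp add: qmul_distrib)
  moreover have "x \<noteq> 0" using nx by auto
  ultimately have "w \<cdot>\<^sub>q qcnj n = - qcnj T" by (simp only: qmul_eq_0 add_eq_0_iff2) simp
  then have "qcnj (w \<cdot>\<^sub>q qcnj n) = qcnj (- qcnj T)" by simp
  then have un: "u \<cdot>\<^sub>q n = n \<cdot>\<^sub>q w" by (simp add: qcnj_qmul qcnj_linear imag_w qmul_distrib T_def)
  define s where "s = qcnj e1 \<cdot>\<^sub>q n"
  have n: "n = e1 \<cdot>\<^sub>q s" by (simp add: s_def qmul_assoc[symmetric] qcnj_unit unit)
  have "w \<cdot>\<^sub>q s = qcnj e1 \<cdot>\<^sub>q (u \<cdot>\<^sub>q n)" by (simp add: w_def u_def s_def qmul_assoc)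
  then have "w \<cdot>\<^sub>q s = s \<cdot>\<^sub>q w" by (simp add: un s_def qmul_assoc)
  then obtain \<alpha> \<beta> where s: "s = \<alpha> *\<^sub>R (1, 0) + \<beta> *\<^sub>R w"
    using commutes_imaginary_unit imag_w norm_w imaginary_iff by blast
  have n': "n = \<alpha> *\<^sub>R e1 + \<beta> *\<^sub>R e2" unfolding n s by (simp only: qmul_distrib qmul_scaleR e1_w qmul_1)
  have "n \<bullet> n = 1" using nn by (simp add: norm_eq_1)
  then have "\<alpha>\<^sup>2 + \<beta>\<^sup>2 = 1"
    using ortho unit by (simp add: n' inner_add_left inner_add_right inner_commute norm_eq_1 power2_eq_square)
  then obtain t where "\<alpha> = cos t" "\<beta> = sin t" using sincos_total_2pi by metis
  then have "n = dir t" by (simp add: n' dir_def)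
  then have "(x, T) \<in> ocircle" using x T_def by (auto simp: ocircle_def)
  then show ?thesis using a Tb by blast
qed

end

section \<open>Lagrangian planes as trace-free matrices\<close>

definition qdet :: "quat \<Rightarrow> quat \<Rightarrow> complex" where
  "qdet p q = fst p * snd q - snd p * fst q"

definition tfree :: "complex \<Rightarrow> complex \<Rightarrow> complex \<Rightarrow> quat \<Rightarrow> quat" where
  "tfree \<alpha> \<beta> \<gamma> p = (\<alpha> * fst p + \<beta> * snd p, \<gamma> * fst p - \<alpha> * snd p)"

definition chart_plane :: "quat \<Rightarrow> complex \<Rightarrow> complex \<Rightarrow> complex \<Rightarrow> (quat \<times> quat) set" where
  "chart_plane x0 \<alpha> \<beta> \<gamma> = {(a, b). qcnj x0 \<cdot>\<^sub>q a + b = tfree \<alpha> \<beta> \<gamma> (qcnj x0 \<cdot>\<^sub>q a - b)}"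

lemma qdet_qmul: "qdet p q = snd (qcnj p \<cdot>\<^sub>q q)"
  by (simp add: qdet_def qcnj_def qmul_def)

lemma qdet_eq_0:
  assumes "qdet p q = 0" "p \<noteq> 0"
  shows "\<exists>s. q = p \<cdot>\<^sub>q (s, 0)"
proof (cases "fst p = 0")
  case True
  then have "snd p \<noteq> 0" using assms(2) by (auto simp: prod_eq_iff)
  then show ?thesis using assms(1) True
    by (intro exI[of _ "snd q / snd p"]) (auto simp: qdet_def qmul_complex prod_eq_iff)
next
  case False
  then show ?thesis using assms(1)
    by (intro exI[of _ "fst q / fst p"]) (auto simp: qdet_def qmul_complex prod_eq_iff field_simps)
qed

lemma qdet_decompose:
  assumes "qdet p1 p2 \<noteq> 0"
  shows "\<exists>s1 s2. p = p1 \<cdot>\<^sub>q (s1, 0) + p2 \<cdot>\<^sub>q (s2, 0)"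
proof (intro exI)
  show "p = p1 \<cdot>\<^sub>q (qdet p p2 / qdet p1 p2, 0) + p2 \<cdot>\<^sub>q (qdet p1 p / qdet p1 p2, 0)"
    using assms by (simp add: qmul_complex prod_eq_iff field_simps) (simp add: qdet_def algebra_simps)
qed

lemma tfree_linear:
  "tfree \<alpha> \<beta> \<gamma> (p + q) = tfree \<alpha> \<beta> \<gamma> p + tfree \<alpha> \<beta> \<gamma> q"
  "tfree \<alpha> \<beta> \<gamma> (p \<cdot>\<^sub>q (s, 0)) = tfree \<alpha> \<beta> \<gamma> p \<cdot>\<^sub>q (s, 0)"
  by (simp_all add: tfree_def qmul_complex prod_eq_iff algebra_simps)

text \<open>The linear map taking p1 to q1 and p2 to q2 has trace
  \<open>qdet q1 p2 + qdet p1 q2\<close> divided by \<open>qdet p1 p2\<close>, so the second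
  assumption says that it is trace-free. Its entries come from Cramer's rule.\<close>

lemma tfree_exists:
  assumes "qdet p1 p2 \<noteq> 0" "qdet q1 p2 + qdet p1 q2 = 0"
  shows "\<exists>\<alpha> \<beta> \<gamma>. q1 = tfree \<alpha> \<beta> \<gamma> p1 \<and> q2 = tfree \<alpha> \<beta> \<gamma> p2"
proof -
  define D where "D = qdet p1 p2"
  have D: "D \<noteq> 0" using assms by (simp add: D_def)
  define \<alpha> where "\<alpha> = (fst q1 * snd p2 - fst q2 * snd p1) / D"
  define \<beta> where "\<beta> = (fst p1 * fst q2 - fst p2 * fst q1) / D"
  define \<gamma> where "\<gamma> = (snd q1 * snd p2 - snd q2 * snd p1) / D"
  have "\<alpha> * D = fst q1 * snd p2 - fst q2 * snd p1" "\<beta> * D = fst p1 * fst q2 - fst p2 * fst q1"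
    "\<gamma> * D = snd q1 * snd p2 - snd q2 * snd p1" using D by (simp_all add: \<alpha>_def \<beta>_def \<gamma>_def)
  note * = this
  \<comment> \<open>The trace condition: the right-hand side is D times the lower right entry given
    by Cramer's rule.\<close>
  have "- \<alpha> * D = fst p1 * snd q2 - fst p2 * snd q1"
    using *(1) assms(2) unfolding qdet_def by algebra
  note * = * this
  have "D * fst (tfree \<alpha> \<beta> \<gamma> p1) = (\<alpha> * D) * fst p1 + (\<beta> * D) * snd p1"
    "D * snd (tfree \<alpha> \<beta> \<gamma> p1) = (\<gamma> * D) * fst p1 + (- \<alpha> * D) * snd p1"
    "D * fst (tfree \<alpha> \<beta> \<gamma> p2) = (\<alpha> * D) * fst p2 + (\<beta> * D) * snd p2"
    "D * snd (tfree \<alpha> \<beta> \<gamma> p2) = (\<gamma> * D) * fst p2 + (- \<alpha> * D) * snd p2"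
    by (simp_all add: tfree_def algebra_simps)
  then have "D * fst (tfree \<alpha> \<beta> \<gamma> p1) = D * fst q1" "D * snd (tfree \<alpha> \<beta> \<gamma> p1) = D * snd q1"
    "D * fst (tfree \<alpha> \<beta> \<gamma> p2) = D * fst q2" "D * snd (tfree \<alpha> \<beta> \<gamma> p2) = D * snd q2"
    unfolding * by (simp_all add: D_def qdet_def algebra_simps)
  then have "q1 = tfree \<alpha> \<beta> \<gamma> p1 \<and> q2 = tfree \<alpha> \<beta> \<gamma> p2" using D by (simp add: prod_eq_iff)
  then show ?thesis by blast
qed

text \<open>As x0 is a unit, \<open>qcnj x0 \<cdot>\<^sub>q a\<close> may replace a in \<Omega>;
  then the terms mixing it with b cancel. On a Lagrangian plane the right-hand side is 0, which is
  the trace condition of \<open>tfree_exists\<close>.\<close>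

lemma qdet_cayley:
  assumes "norm x0 = 1"
  shows "qdet (qcnj x0 \<cdot>\<^sub>q a + b) (qcnj x0 \<cdot>\<^sub>q a' - b') + qdet (qcnj x0 \<cdot>\<^sub>q a - b) (qcnj x0 \<cdot>\<^sub>q a' + b')
    = 2 * snd (qcnj a \<cdot>\<^sub>q a' - qcnj b \<cdot>\<^sub>q b')"
proof -
  define A A' where "A = qcnj x0 \<cdot>\<^sub>q a" and "A' = qcnj x0 \<cdot>\<^sub>q a'"
  have "qcnj A \<cdot>\<^sub>q A' = qcnj a \<cdot>\<^sub>q a'"
    using assms by (simp add: A_def A'_def qcnj_qmul qcnj_linear qmul_assoc qcnj_unit_cancel)
  moreover have "qdet (A + b) (A' - b') + qdet (A - b) (A' + b') = 2 * snd (qcnj A \<cdot>\<^sub>q A' - qcnj b \<cdot>\<^sub>q b')"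
    by (simp add: qdet_def qmul_def qcnj_def algebra_simps)
  ultimately show ?thesis by (simp add: A_def A'_def)
qed

text \<open>A nonzero vector of the plane with p = 0 would be null and span a tangent line at x0,
  which the circle avoids. So p is a coordinate on the plane, and two tangent lines determine
  M.\<close>

lemma (in circle_data) exists_chart:
  assumes "norm x0 = 1" and x0: "\<And>T. (x0, T) \<notin> ocircle"
  shows "\<exists>\<alpha> \<beta> \<gamma>. chart_plane x0 \<alpha> \<beta> \<gamma> = plane"
proof -
  let ?q = "\<lambda>a b. qcnj x0 \<cdot>\<^sub>q a + b" and ?p = "\<lambda>a b. qcnj x0 \<cdot>\<^sub>q a - b"
  have ker: "a = 0 \<and> b = 0" if ab: "(a, b) \<in> plane" "?p a b = 0" for a b
  proof -
    have a: "a = x0 \<cdot>\<^sub>q b" using ab(2) qcnj_unit_cancel(2)[OF assms(1)] by (metis eq_iff_diff_eq_0)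
    have "b = 0"
    proof (rule ccontr)
      assume "b \<noteq> 0"
      moreover have "norm a = norm b" using assms(1) by (simp add: a norm_qmul)
      ultimately obtain x T where *: "(x, T) \<in> ocircle" "a = x \<cdot>\<^sub>q b" using ocircle_of_plane[OF ab(1)] by blast
      then have "(x - x0) \<cdot>\<^sub>q b = 0" by (simp add: a qmul_distrib)
      then have "x = x0" using \<open>b \<noteq> 0\<close> by (simp only: qmul_eq_0) simp
      then show False using * x0 by simp
    qed
    then show ?thesis by (simp add: a)
  qed
  have ex: "\<exists>l. l \<noteq> 0 \<and> T \<cdot>\<^sub>q l = x \<cdot>\<^sub>q l \<cdot>\<^sub>q (\<i>, 0)" if "(x, T) \<in> ocircle" for x T
    using tangent_eigenvector ocircle_unit[OF that] by blast
  \<comment> \<open>Antipodal points of the circle, to have two different ones.\<close>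
  define x1 x2 where "x1 = m + r *\<^sub>R dir 0" and "x2 = m + r *\<^sub>R dir pi"
  have K: "(x1, u \<cdot>\<^sub>q dir 0) \<in> ocircle" "(x2, u \<cdot>\<^sub>q dir pi) \<in> ocircle"
    by (auto simp: ocircle_def x1_def x2_def)
  have "x1 - x2 = (2 * r) *\<^sub>R e1" by (simp add: x1_def x2_def dir_def scaleR_2 flip: scaleR_scaleR)
  then have x12: "x1 \<noteq> x2" using rpos unit by auto
  obtain l1 l2 where l: "l1 \<noteq> 0" "l2 \<noteq> 0" "(x1 \<cdot>\<^sub>q l1, l1) \<in> plane" "(x2 \<cdot>\<^sub>q l2, l2) \<in> plane"
    using ex[OF K(1)] ex[OF K(2)] plane_of_ocircle[OF K(1)] plane_of_ocircle[OF K(2)] by blast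
  define p1 p2 where "p1 = ?p (x1 \<cdot>\<^sub>q l1) l1" and "p2 = ?p (x2 \<cdot>\<^sub>q l2) l2"
  define q1 q2 where "q1 = ?q (x1 \<cdot>\<^sub>q l1) l1" and "q2 = ?q (x2 \<cdot>\<^sub>q l2) l2"
  have D: "qdet p1 p2 \<noteq> 0"
  proof
    assume "qdet p1 p2 = 0"
    moreover have "p1 \<noteq> 0" using ker[OF l(3)] l(1) unfolding p1_def by blast
    ultimately obtain s where s: "p2 = p1 \<cdot>\<^sub>q (s, 0)" using qdet_eq_0 by blast
    let ?a = "x2 \<cdot>\<^sub>q l2 - x1 \<cdot>\<^sub>q l1 \<cdot>\<^sub>q (s, 0)" and ?b = "l2 - l1 \<cdot>\<^sub>q (s, 0)"
    have "?p ?a ?b = p2 - p1 \<cdot>\<^sub>q (s, 0)"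
      by (simp add: p1_def p2_def qmul_distrib qmul_assoc algebra_simps)
    then have "?a = 0 \<and> ?b = 0" using s by (intro ker plane_diff plane_scale l) simp_all
    then have "x2 \<cdot>\<^sub>q l2 = x1 \<cdot>\<^sub>q (l1 \<cdot>\<^sub>q (s, 0))" "l1 \<cdot>\<^sub>q (s, 0) = l2"
      by (metis eq_iff_diff_eq_0 qmul_assoc)+
    then have "(x2 - x1) \<cdot>\<^sub>q l2 = 0" by (simp add: qmul_distrib)
    then show False using l(2) x12 by (simp only: qmul_eq_0) simp
  qed
  moreover have "qdet q1 p2 + qdet p1 q2 = 0"
    unfolding q1_def p2_def p1_def q2_def qdet_cayley[OF assms(1)]
    using plane_lagrangian[OF l(3,4)] by simp
  ultimately obtain \<alpha> \<beta> \<gamma> where M: "q1 = tfree \<alpha> \<beta> \<gamma> p1" "q2 = tfree \<alpha> \<beta> \<gamma> p2"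
    using tfree_exists by blast
  have "(a, b) \<in> plane \<longleftrightarrow> (a, b) \<in> chart_plane x0 \<alpha> \<beta> \<gamma>" for a b
  proof -
    obtain s1 s2 where s: "?p a b = p1 \<cdot>\<^sub>q (s1, 0) + p2 \<cdot>\<^sub>q (s2, 0)" using qdet_decompose[OF D] by blast
    \<comment> \<open>The combination of the two tangent vectors with the same p as (a, b).
      Membership of (a, b) in either plane amounts to being equal to it.\<close>
    define a' b' where "a' = x1 \<cdot>\<^sub>q l1 \<cdot>\<^sub>q (s1, 0) + x2 \<cdot>\<^sub>q l2 \<cdot>\<^sub>q (s2, 0)"
      and "b' = l1 \<cdot>\<^sub>q (s1, 0) + l2 \<cdot>\<^sub>q (s2, 0)"
    have ab': "(a', b') \<in> plane" unfolding a'_def b'_def by (intro plane_add plane_scale l)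
    have pq: "?p a' b' = p1 \<cdot>\<^sub>q (s1, 0) + p2 \<cdot>\<^sub>q (s2, 0)" "?q a' b' = q1 \<cdot>\<^sub>q (s1, 0) + q2 \<cdot>\<^sub>q (s2, 0)"
      by (simp_all add: a'_def b'_def p1_def p2_def q1_def q2_def qmul_distrib qmul_assoc algebra_simps)
    have M': "tfree \<alpha> \<beta> \<gamma> (?p a b) = ?q a' b'" unfolding s pq by (simp add: tfree_linear M)
    have eq: "(a, b) = (a', b') \<longleftrightarrow> ?q a b = ?q a' b'"
    proof
      assume q: "?q a b = ?q a' b'"
      have p: "?p a b = ?p a' b'" using s pq by simp
      have "2 *\<^sub>R b = ?q a b - ?p a b" "2 *\<^sub>R b' = ?q a' b' - ?p a' b'" by (simp_all add: scaleR_2)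
      then have "2 *\<^sub>R b = 2 *\<^sub>R b'" using p q by simp
      then have b: "b = b'" by simp
      then have "qcnj x0 \<cdot>\<^sub>q a = qcnj x0 \<cdot>\<^sub>q a'" using p by simp
      then show "(a, b) = (a', b')" using b qcnj_unit_cancel(2)[OF assms(1)] by metis
    qed auto
    have "(a, b) \<in> chart_plane x0 \<alpha> \<beta> \<gamma> \<longleftrightarrow> (a, b) = (a', b')"
      unfolding eq by (simp add: chart_plane_def M')
    moreover have "(a, b) = (a', b')" if "(a, b) \<in> plane"
    proof -
      have "?p (a - a') (b - b') = 0" using s pq by (simp add: qmul_distrib algebra_simps)
      then show ?thesis using ker[OF plane_diff[OF that ab']] by simp
    qed
    ultimately show ?thesis using ab' by auto
  qed
  then show ?thesis by (intro exI[of _ \<alpha>] exI[of _ \<beta>] exI[of _ \<gamma>]) auto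
qed

text \<open>From q = M p follows 2 l = M p - p, so proportional p and p' would force l' = l s and
  then x' l' = x l'. This independence makes the later linear systems solvable.\<close>

lemma chart_plane_independent:
  assumes "(x \<cdot>\<^sub>q l, l) \<in> chart_plane x0 \<alpha> \<beta> \<gamma>" "(x' \<cdot>\<^sub>q l', l') \<in> chart_plane x0 \<alpha> \<beta> \<gamma>"
    "l \<noteq> 0" "l' \<noteq> 0" "x \<noteq> x'"
    and p: "p = qcnj x0 \<cdot>\<^sub>q (x \<cdot>\<^sub>q l) - l" "p' = qcnj x0 \<cdot>\<^sub>q (x' \<cdot>\<^sub>q l') - l'" and "norm x0 = 1"
  shows "qdet p p' \<noteq> 0"
proof
  assume 0: "qdet p p' = 0"
  have q: "qcnj x0 \<cdot>\<^sub>q (x \<cdot>\<^sub>q l) + l = tfree \<alpha> \<beta> \<gamma> p" "qcnj x0 \<cdot>\<^sub>q (x' \<cdot>\<^sub>q l') + l' = tfree \<alpha> \<beta> \<gamma> p'"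
    using assms(1,2) by (simp_all add: chart_plane_def p)
  have l: "2 *\<^sub>R l = tfree \<alpha> \<beta> \<gamma> p - p" "2 *\<^sub>R l' = tfree \<alpha> \<beta> \<gamma> p' - p'"
    unfolding q[symmetric] unfolding p by (simp_all add: scaleR_2)
  have "p \<noteq> 0"
  proof
    assume "p = 0"
    then have "2 *\<^sub>R l = 0" unfolding l by (simp add: tfree_def prod_eq_iff)
    then show False using assms(3) by simp
  qed
  then obtain s where s: "p' = p \<cdot>\<^sub>q (s, 0)" using qdet_eq_0 0 by blast
  have "2 *\<^sub>R l' = (2 *\<^sub>R l) \<cdot>\<^sub>q (s, 0)" unfolding l s by (simp add: tfree_linear qmul_distrib)
  then have l': "l' = l \<cdot>\<^sub>q (s, 0)" by (simp add: qmul_scaleR)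
  then have "qcnj x0 \<cdot>\<^sub>q (x' \<cdot>\<^sub>q l') = qcnj x0 \<cdot>\<^sub>q (x \<cdot>\<^sub>q l')"
    using s unfolding p by (simp add: qmul_distrib qmul_assoc)
  then have "x' \<cdot>\<^sub>q l' = x \<cdot>\<^sub>q l'" using qcnj_unit_cancel(2)[OF assms(8)] by metis
  then have "(x' - x) \<cdot>\<^sub>q l' = 0" by (simp add: qmul_distrib)
  then show False using assms(4,5) by (simp only: qmul_eq_0) simp
qed

text \<open>The left-hand side is \<open>det (p, (M' - M) p')\<close>.\<close>

lemma chart_plane_difference:
  assumes "(x \<cdot>\<^sub>q l, l) \<in> chart_plane x0 \<alpha> \<beta> \<gamma>" "(x' \<cdot>\<^sub>q l', l') \<in> chart_plane x0 \<alpha>' \<beta>' \<gamma>'"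
    and p: "p = qcnj x0 \<cdot>\<^sub>q (x \<cdot>\<^sub>q l) - l" "p' = qcnj x0 \<cdot>\<^sub>q (x' \<cdot>\<^sub>q l') - l'" and "norm x0 = 1"
  shows "(\<gamma>' - \<gamma>) * (fst p * fst p') - (\<alpha>' - \<alpha>) * (fst p * snd p' + snd p * fst p') - (\<beta>' - \<beta>) * (snd p * snd p')
    = 2 * snd (qcnj l \<cdot>\<^sub>q (qcnj x \<cdot>\<^sub>q x' - (1, 0)) \<cdot>\<^sub>q l')"
proof -
  have q: "qcnj x0 \<cdot>\<^sub>q (x \<cdot>\<^sub>q l) + l = tfree \<alpha> \<beta> \<gamma> p" "qcnj x0 \<cdot>\<^sub>q (x' \<cdot>\<^sub>q l') + l' = tfree \<alpha>' \<beta>' \<gamma>' p'"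
    using assms(1,2) by (simp_all add: chart_plane_def p)
  have "qdet (tfree \<alpha> \<beta> \<gamma> p) p' + qdet p (tfree \<alpha>' \<beta>' \<gamma>' p')
    = 2 * snd (qcnj (x \<cdot>\<^sub>q l) \<cdot>\<^sub>q (x' \<cdot>\<^sub>q l') - qcnj l \<cdot>\<^sub>q l')"
    using qdet_cayley[OF assms(5), of "x \<cdot>\<^sub>q l" l "x' \<cdot>\<^sub>q l'" l'] unfolding q p(1)[symmetric] p(2)[symmetric] .
  also have "qcnj (x \<cdot>\<^sub>q l) \<cdot>\<^sub>q (x' \<cdot>\<^sub>q l') - qcnj l \<cdot>\<^sub>q l' = qcnj l \<cdot>\<^sub>q (qcnj x \<cdot>\<^sub>q x' - (1, 0)) \<cdot>\<^sub>q l'"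
    by (simp only: qcnj_qmul qmul_distrib qmul_assoc qmul_1)
  \<comment> \<open>M is trace-free, so det (M p, p') = - det (p, M p'), and the two terms combine
    to a difference of matrices.\<close>
  finally show ?thesis by (simp add: qdet_def tfree_def algebra_simps)
qed

section \<open>Points of the quadric\<close>

definition of_H2 :: "quat \<Rightarrow> quat \<Rightarrow> complex^4" where
  "of_H2 a b = vector [fst a, snd a, fst b, snd b]"

text \<open>Solving for a and b gives x0 (q + p) / 2 and (q - p) / 2; this is twice that vector, so
  its own coordinates are 2 q and 2 p. The powers of 2 in later identities stem from here.\<close>

definition chart_vec :: "quat \<Rightarrow> complex \<Rightarrow> complex \<Rightarrow> complex \<Rightarrow> quat \<Rightarrow> complex^4" where
  "chart_vec x0 \<alpha> \<beta> \<gamma> p = of_H2 (x0 \<cdot>\<^sub>q (tfree \<alpha> \<beta> \<gamma> p + p)) (tfree \<alpha> \<beta> \<gamma> p - p)"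

text \<open>The Pluecker vector of the graph. Its entries are polynomials in \<alpha>, \<beta>,
  \<gamma>, so it is a holomorphic lift as soon as the matrix is holomorphic.\<close>

definition chart_biv :: "quat \<Rightarrow> complex \<Rightarrow> complex \<Rightarrow> complex \<Rightarrow> bivector" where
  "chart_biv x0 \<alpha> \<beta> \<gamma> = bwedge (chart_vec x0 \<alpha> \<beta> \<gamma> (1, 0)) (chart_vec x0 \<alpha> \<beta> \<gamma> (0, 1))"

lemma vector_4_nth:
  "(vector [w, x, y, z] :: 'a::zero^4) $ 1 = w" "(vector [w, x, y, z] :: 'a::zero^4) $ 2 = x"
  "(vector [w, x, y, z] :: 'a::zero^4) $ 3 = y" "(vector [w, x, y, z] :: 'a::zero^4) $ 4 = z"
  by (simp_all add: vector_def)

lemma of_H2_nth [simp]: "of_H2 a b $ 1 = fst a" "of_H2 a b $ 2 = snd a" "of_H2 a b $ 3 = fst b" "of_H2 a b $ 4 = snd b"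
  by (simp_all add: of_H2_def vector_4_nth)

lemma to_H2_of_H2 [simp]: "to_H2 (of_H2 a b) = (a, b)"
  by (simp add: to_H2_def)

lemma of_H2_to_H2: "to_H2 z = (a, b) \<longleftrightarrow> z = of_H2 a b"
  by (auto simp: to_H2_def vec_eq_iff forall_4)

lemma of_H2_linear: "of_H2 (a + a') (b + b') = of_H2 a b + of_H2 a' b'"
  "of_H2 (a \<cdot>\<^sub>q (s, 0)) (b \<cdot>\<^sub>q (s, 0)) = s *s of_H2 a b"
  by (simp_all add: vec_eq_iff forall_4 qmul_complex mult.commute)

lemma of_H2_eq_0: "of_H2 a b = 0 \<longleftrightarrow> a = 0 \<and> b = 0"
  by (auto simp: vec_eq_iff forall_4 prod_eq_iff)

lemma chart_vec_linear: "chart_vec x0 \<alpha> \<beta> \<gamma> p = fst p *s chart_vec x0 \<alpha> \<beta> \<gamma> (1, 0) + snd p *s chart_vec x0 \<alpha> \<beta> \<gamma> (0, 1)"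
  by (simp add: chart_vec_def vec_eq_iff forall_4 qmul_def tfree_def algebra_simps)

lemma chart_vec_of_plane:
  assumes "norm x0 = 1" "(a, b) \<in> chart_plane x0 \<alpha> \<beta> \<gamma>"
  shows "2 *s of_H2 a b = chart_vec x0 \<alpha> \<beta> \<gamma> (qcnj x0 \<cdot>\<^sub>q a - b)"
proof -
  have q: "tfree \<alpha> \<beta> \<gamma> (qcnj x0 \<cdot>\<^sub>q a - b) = qcnj x0 \<cdot>\<^sub>q a + b" using assms(2) by (simp add: chart_plane_def)
  have "x0 \<cdot>\<^sub>q (qcnj x0 \<cdot>\<^sub>q a + b + (qcnj x0 \<cdot>\<^sub>q a - b)) = a + a"
    using assms(1) by (simp add: qmul_distrib qcnj_unit_cancel)
  then show ?thesis unfolding chart_vec_def q by (simp add: vec_eq_iff forall_4)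
qed

lemma chart_vec_in_plane:
  assumes "norm x0 = 1" "to_H2 (chart_vec x0 \<alpha> \<beta> \<gamma> p) = (a, b)"
  shows "(a, b) \<in> chart_plane x0 \<alpha> \<beta> \<gamma>" "qcnj x0 \<cdot>\<^sub>q a - b = 2 *\<^sub>R p"
proof -
  have ab: "a = x0 \<cdot>\<^sub>q (tfree \<alpha> \<beta> \<gamma> p + p)" "b = tfree \<alpha> \<beta> \<gamma> p - p"
    using assms(2) by (simp_all add: chart_vec_def)
  show p: "qcnj x0 \<cdot>\<^sub>q a - b = 2 *\<^sub>R p" using assms(1) by (simp add: ab qcnj_unit_cancel scaleR_2)
  have "qcnj x0 \<cdot>\<^sub>q a + b = 2 *\<^sub>R tfree \<alpha> \<beta> \<gamma> p" using assms(1) by (simp add: ab qcnj_unit_cancel scaleR_2)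
  then show "(a, b) \<in> chart_plane x0 \<alpha> \<beta> \<gamma>"
    by (simp add: chart_plane_def p) (simp add: tfree_def prod_eq_iff scaleR_conv_of_real algebra_simps)
qed

lemma span_pair: "vec.span {v, w} = {s *s v + t *s w | s t. True}"
proof -
  have "x - s *s v = t *s w \<longleftrightarrow> x = s *s v + t *s w" for x s t by (auto simp: algebra_simps)
  then show ?thesis by (auto simp: vec.span_insert vec.span_singleton image_iff)
qed

lemma span_chart:
  assumes "norm x0 = 1"
  shows "of_H2 a b \<in> vec.span {chart_vec x0 \<alpha> \<beta> \<gamma> (1, 0), chart_vec x0 \<alpha> \<beta> \<gamma> (0, 1)} \<longleftrightarrow> (a, b) \<in> chart_plane x0 \<alpha> \<beta> \<gamma>"
proof
  assume "of_H2 a b \<in> vec.span {chart_vec x0 \<alpha> \<beta> \<gamma> (1, 0), chart_vec x0 \<alpha> \<beta> \<gamma> (0, 1)}"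
  then obtain s t where "of_H2 a b = s *s chart_vec x0 \<alpha> \<beta> \<gamma> (1, 0) + t *s chart_vec x0 \<alpha> \<beta> \<gamma> (0, 1)"
    unfolding span_pair by blast
  then have "of_H2 a b = chart_vec x0 \<alpha> \<beta> \<gamma> (s, t)"
    using chart_vec_linear[of x0 \<alpha> \<beta> \<gamma> "(s, t)"] by (simp only: fst_conv snd_conv)
  then show "(a, b) \<in> chart_plane x0 \<alpha> \<beta> \<gamma>"
    using chart_vec_in_plane(1)[OF assms] to_H2_of_H2 by metis
next
  assume "(a, b) \<in> chart_plane x0 \<alpha> \<beta> \<gamma>"
  then have "2 *s of_H2 a b \<in> vec.span {chart_vec x0 \<alpha> \<beta> \<gamma> (1, 0), chart_vec x0 \<alpha> \<beta> \<gamma> (0, 1)}"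
    unfolding chart_vec_of_plane[OF assms \<open>(a, b) \<in> chart_plane x0 \<alpha> \<beta> \<gamma>\<close>] span_pair
      chart_vec_linear[of x0 \<alpha> \<beta> \<gamma> "qcnj x0 \<cdot>\<^sub>q a - b"] by blast
  then have "(1/2) *s (2 *s of_H2 a b) \<in> vec.span {chart_vec x0 \<alpha> \<beta> \<gamma> (1, 0), chart_vec x0 \<alpha> \<beta> \<gamma> (0, 1)}"
    by (rule vec.span_scale)
  then show "of_H2 a b \<in> vec.span {chart_vec x0 \<alpha> \<beta> \<gamma> (1, 0), chart_vec x0 \<alpha> \<beta> \<gamma> (0, 1)}" by simp
qed

section \<open>Bivectors of planes and the quadric\<close>

lemma bwedge_combination:
  "bwedge (s *s v + t *s w) (s' *s v + t' *s w) = (s * t' - t * s') *s bwedge v w"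
  by (simp add: bwedge_def vec_eq_iff algebra_simps)

lemma bwedge_eq_0:
  assumes "bwedge v w = 0" "v \<noteq> 0"
  shows "\<exists>s. w = s *s v"
proof -
  obtain i where i: "v $ i \<noteq> 0" using assms(2) by (auto simp: vec_eq_iff)
  have "v $ i * w $ j = v $ j * w $ i" for j
    using arg_cong[OF assms(1), of "\<lambda>\<omega>. \<omega> $ (i, j)"] by (simp add: bwedge_def)
  then have "w = (w $ i / v $ i) *s v" using i by (simp add: vec_eq_iff field_simps)
  then show ?thesis by blast
qed

lemma bwedge_plane:
  assumes "norm x0 = 1" "(a, b) \<in> chart_plane x0 \<alpha> \<beta> \<gamma>" "(a', b') \<in> chart_plane x0 \<alpha> \<beta> \<gamma>"
  shows "4 *s bwedge (of_H2 a b) (of_H2 a' b')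
    = qdet (qcnj x0 \<cdot>\<^sub>q a - b) (qcnj x0 \<cdot>\<^sub>q a' - b') *s chart_biv x0 \<alpha> \<beta> \<gamma>"
proof -
  have "4 *s bwedge (of_H2 a b) (of_H2 a' b') = bwedge (2 *s of_H2 a b) (2 *s of_H2 a' b')"
    by (simp add: bwedge_def vec_eq_iff algebra_simps)
  also have "\<dots> = qdet (qcnj x0 \<cdot>\<^sub>q a - b) (qcnj x0 \<cdot>\<^sub>q a' - b') *s chart_biv x0 \<alpha> \<beta> \<gamma>"
    unfolding chart_vec_of_plane[OF assms(1,2)] chart_vec_of_plane[OF assms(1,3)]
    unfolding chart_vec_linear[of x0 \<alpha> \<beta> \<gamma> "qcnj x0 \<cdot>\<^sub>q a - b"]
      chart_vec_linear[of x0 \<alpha> \<beta> \<gamma> "qcnj x0 \<cdot>\<^sub>q a' - b'"] bwedge_combination chart_biv_def qdet_def ..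
  finally show ?thesis .
qed

lemma chart_vec_eq_0:
  assumes "norm x0 = 1" "chart_vec x0 \<alpha> \<beta> \<gamma> p = 0"
  shows "p = 0"
proof -
  have "to_H2 (chart_vec x0 \<alpha> \<beta> \<gamma> p) = (0, 0)" using assms(2) by (simp add: to_H2_def zero_prod_def)
  then have "2 *\<^sub>R p = 0" using chart_vec_in_plane(2)[OF assms(1)] by fastforce
  then show ?thesis by simp
qed

lemma chart_biv_nonzero:
  assumes "norm x0 = 1"
  shows "chart_biv x0 \<alpha> \<beta> \<gamma> \<noteq> 0"
proof
  assume "chart_biv x0 \<alpha> \<beta> \<gamma> = 0"
  moreover have "chart_vec x0 \<alpha> \<beta> \<gamma> (1, 0) \<noteq> 0"
    using chart_vec_eq_0[OF assms] by (metis Pair_inject one_neq_zero zero_prod_def)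
  ultimately obtain s where "chart_vec x0 \<alpha> \<beta> \<gamma> (0, 1) = s *s chart_vec x0 \<alpha> \<beta> \<gamma> (1, 0)"
    using bwedge_eq_0 unfolding chart_biv_def by blast
  then have "chart_vec x0 \<alpha> \<beta> \<gamma> (- s, 1) = 0"
    unfolding chart_vec_linear[of x0 \<alpha> \<beta> \<gamma> "(- s, 1)"] by (simp add: vec_eq_iff)
  then show False using chart_vec_eq_0[OF assms] by (metis Pair_inject one_neq_zero zero_prod_def)
qed

lemma Omega_chart:
  assumes "norm x0 = 1"
  shows "Omega (chart_vec x0 \<alpha> \<beta> \<gamma> p) (chart_vec x0 \<alpha> \<beta> \<gamma> p') = 0"
proof -
  obtain a b a' b' where ab: "to_H2 (chart_vec x0 \<alpha> \<beta> \<gamma> p) = (a, b)" "to_H2 (chart_vec x0 \<alpha> \<beta> \<gamma> p') = (a', b')"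
    by (meson surj_pair)
  have q: "qcnj x0 \<cdot>\<^sub>q a + b = tfree \<alpha> \<beta> \<gamma> (2 *\<^sub>R p)" "qcnj x0 \<cdot>\<^sub>q a' + b' = tfree \<alpha> \<beta> \<gamma> (2 *\<^sub>R p')"
    using chart_vec_in_plane[OF assms ab(1)] chart_vec_in_plane[OF assms ab(2)] by (simp_all add: chart_plane_def)
  have "2 * snd (qcnj a \<cdot>\<^sub>q a' - qcnj b \<cdot>\<^sub>q b') = 0"
    unfolding qdet_cayley[OF assms, symmetric] q chart_vec_in_plane(2)[OF assms ab(1)] chart_vec_in_plane(2)[OF assms ab(2)]
    by (simp add: qdet_def tfree_def scaleR_conv_of_real algebra_simps)
  then show ?thesis unfolding Omega_def ab herm_def by simp
qed

lemma bwedge_in_Lambda2: "bwedge v w \<in> Lambda2"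
  by (simp add: Lambda2_def bwedge_def)

lemma axis_4 [simp]:
  "(axis 1 1 :: complex^4) $ 1 = 1" "(axis 1 1 :: complex^4) $ 2 = 0" "(axis 1 1 :: complex^4) $ 3 = 0" "(axis 1 1 :: complex^4) $ 4 = 0"
  "(axis 2 1 :: complex^4) $ 1 = 0" "(axis 2 1 :: complex^4) $ 2 = 1" "(axis 2 1 :: complex^4) $ 3 = 0" "(axis 2 1 :: complex^4) $ 4 = 0"
  "(axis 3 1 :: complex^4) $ 1 = 0" "(axis 3 1 :: complex^4) $ 2 = 0" "(axis 3 1 :: complex^4) $ 3 = 1" "(axis 3 1 :: complex^4) $ 4 = 0"
  "(axis 4 1 :: complex^4) $ 1 = 0" "(axis 4 1 :: complex^4) $ 2 = 0" "(axis 4 1 :: complex^4) $ 3 = 0" "(axis 4 1 :: complex^4) $ 4 = 1"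
  by (simp_all add: axis_def)

lemma Omega_biv_bwedge: "Omega_biv (bwedge v w) = Omega v w"
  by (simp add: Omega_biv_def sum_4 Omega_eq bwedge_def algebra_simps)

lemma Omega_axis:
  "Omega (axis 1 1) (axis 1 1) = 0" "Omega (axis 1 1) (axis 2 1) = 1" "Omega (axis 1 1) (axis 3 1) = 0" "Omega (axis 1 1) (axis 4 1) = 0"
  "Omega (axis 2 1) (axis 1 1) = - 1" "Omega (axis 2 1) (axis 2 1) = 0" "Omega (axis 2 1) (axis 3 1) = 0" "Omega (axis 2 1) (axis 4 1) = 0"
  "Omega (axis 3 1) (axis 1 1) = 0" "Omega (axis 3 1) (axis 2 1) = 0" "Omega (axis 3 1) (axis 3 1) = 0" "Omega (axis 3 1) (axis 4 1) = - 1"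
  "Omega (axis 4 1) (axis 1 1) = 0" "Omega (axis 4 1) (axis 2 1) = 0" "Omega (axis 4 1) (axis 3 1) = 1" "Omega (axis 4 1) (axis 4 1) = 0"
  by (simp_all add: Omega_eq)

lemma bform_bwedge: "bform (bwedge v w) (bwedge v w) = 0"
proof -
  \<comment> \<open>\<omega> stays opaque until the coefficients of the 4-form are evaluated; most
    of the 256 terms then disappear before the entries of the wedge product are inserted.\<close>
  have "bform \<omega> \<omega> = 0" if "\<omega> = bwedge v w" for \<omega>
    unfolding bform_def
    by (simp only: sum_4 form_wedge_def Omega_axis mult_zero_left mult_zero_right add_0_left add_0_right
        diff_0_right diff_0 minus_zero mult_1_left mult_1_right)
      (simp add: that bwedge_def, simp add: algebra_simps)
  then show ?thesis by simp
qed

lemma span_singleton_eq: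
  assumes "x \<noteq> 0" "x \<in> vec.span {y}"
  shows "vec.span {x} = vec.span {y :: complex^'n}"
proof -
  obtain k where k: "x = k *s y" using assms(2) by (auto simp: vec.span_singleton)
  then have "k \<noteq> 0" using assms(1) by auto
  then have y: "y = (1/k) *s x" by (simp add: k)
  have "y \<in> vec.span {x}" by (subst y) (intro vec.span_scale vec.span_base, simp)
  then show ?thesis using assms(2) by (intro equalityI vec.span_minimal) simp_all
qed

section \<open>Tangent lines as null lines\<close>

lemma tangent_line_iff:
  assumes "norm x = 1"
  shows "of_H2 a b \<in> tangent_line x T \<longleftrightarrow> a = x \<cdot>\<^sub>q b \<and> T \<cdot>\<^sub>q b = a \<cdot>\<^sub>q (\<i>, 0)"
proof
  assume "of_H2 a b \<in> tangent_line x T"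
  then show "a = x \<cdot>\<^sub>q b \<and> T \<cdot>\<^sub>q b = a \<cdot>\<^sub>q (\<i>, 0)"
    by (auto simp: tangent_line_def qmul_assoc)
next
  assume *: "a = x \<cdot>\<^sub>q b \<and> T \<cdot>\<^sub>q b = a \<cdot>\<^sub>q (\<i>, 0)"
  have "(qcnj x \<cdot>\<^sub>q T) \<cdot>\<^sub>q b = b \<cdot>\<^sub>q (\<i>, 0)" using * assms by (simp add: qmul_assoc qcnj_unit_cancel)
  moreover have "T = x \<cdot>\<^sub>q (qcnj x \<cdot>\<^sub>q T)" using assms by (simp add: qcnj_unit_cancel)
  moreover have "to_H2 (of_H2 a b) = (x \<cdot>\<^sub>q b, b)" using * by simp
  ultimately show "of_H2 a b \<in> tangent_line x T" unfolding tangent_line_def by blast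
qed

lemma tangent_line_span:
  assumes "norm x = 1" "x \<bullet> T = 0" "b \<noteq> 0" "of_H2 (x \<cdot>\<^sub>q b) b \<in> tangent_line x T"
  shows "tangent_line x T = vec.span {of_H2 (x \<cdot>\<^sub>q b) b}"
proof -
  have b: "T \<cdot>\<^sub>q b = x \<cdot>\<^sub>q b \<cdot>\<^sub>q (\<i>, 0)" using assms(4) by (simp add: tangent_line_iff[OF assms(1)])
  have \<mu>: "Re (fst (qcnj x \<cdot>\<^sub>q T)) = 0" using assms(2) by (simp add: inner_quat)
  have ev: "(qcnj x \<cdot>\<^sub>q T) \<cdot>\<^sub>q c = c \<cdot>\<^sub>q (\<i>, 0)" if "T \<cdot>\<^sub>q c = x \<cdot>\<^sub>q c \<cdot>\<^sub>q (\<i>, 0)" for c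
    using that assms(1) by (simp add: qmul_assoc qcnj_unit_cancel)
  have "z \<in> tangent_line x T \<longleftrightarrow> z \<in> vec.span {of_H2 (x \<cdot>\<^sub>q b) b}" for z
  proof -
    obtain a c where z: "z = of_H2 a c" by (metis of_H2_to_H2 surj_pair)
    show ?thesis
    proof
      assume "z \<in> tangent_line x T"
      then have *: "a = x \<cdot>\<^sub>q c" "T \<cdot>\<^sub>q c = x \<cdot>\<^sub>q c \<cdot>\<^sub>q (\<i>, 0)" by (simp_all add: z tangent_line_iff[OF assms(1)])
      obtain s where s: "c = b \<cdot>\<^sub>q (s, 0)" using eigenvector_multiple[OF \<mu> ev[OF b] ev[OF *(2)] assms(3)] by blast
      have "z = s *s of_H2 (x \<cdot>\<^sub>q b) b" unfolding z *(1) s of_H2_linear(2)[symmetric] by (simp add: qmul_assoc)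
      then show "z \<in> vec.span {of_H2 (x \<cdot>\<^sub>q b) b}" by (auto simp: vec.span_singleton)
    next
      assume "z \<in> vec.span {of_H2 (x \<cdot>\<^sub>q b) b}"
      then obtain s where "z = s *s of_H2 (x \<cdot>\<^sub>q b) b" by (auto simp: vec.span_singleton)
      then have z': "z = of_H2 (x \<cdot>\<^sub>q b \<cdot>\<^sub>q (s, 0)) (b \<cdot>\<^sub>q (s, 0))" by (simp add: of_H2_linear)
      have c: "(\<i>, 0) \<cdot>\<^sub>q (s, 0) = (s, 0) \<cdot>\<^sub>q (\<i>, 0)" by (simp add: qmul_def)
      have "T \<cdot>\<^sub>q (b \<cdot>\<^sub>q (s, 0)) = (T \<cdot>\<^sub>q b) \<cdot>\<^sub>q (s, 0)" by (simp add: qmul_assoc)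
      also have "\<dots> = x \<cdot>\<^sub>q b \<cdot>\<^sub>q (s, 0) \<cdot>\<^sub>q (\<i>, 0)" unfolding b by (simp only: qmul_assoc c)
      finally show "z \<in> tangent_line x T" unfolding z' tangent_line_iff[OF assms(1)] by (simp add: qmul_assoc)
    qed
  qed
  then show ?thesis by blast
qed

lemma tangent_line_nonzero:
  assumes "norm x = 1" "norm T = 1" "x \<bullet> T = 0"
  shows "\<exists>b. b \<noteq> 0 \<and> of_H2 (x \<cdot>\<^sub>q b) b \<in> tangent_line x T"
  using tangent_eigenvector[OF assms] tangent_line_iff[OF assms(1)] by blast

definition unit_tangents :: "(quat \<times> quat) set" where
  "unit_tangents = {(x, T). norm x = 1 \<and> norm T = 1 \<and> x \<bullet> T = 0}"

text \<open>A vector of the quaternionic plane is null iff both components have the same norm, so this says that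
  the null lines of \<open>L\<close> are the tangent lines in \<open>K\<close>.\<close>

definition plane_represents :: "(quat \<times> quat) set \<Rightarrow> (quat \<times> quat) set \<Rightarrow> bool" where
  "plane_represents L K \<longleftrightarrow> K \<subseteq> unit_tangents \<and>
     (\<forall>a b. b \<noteq> 0 \<longrightarrow> ((a, b) \<in> L \<and> norm a = norm b \<longleftrightarrow> (\<exists>x T. (x, T) \<in> K \<and> a = x \<cdot>\<^sub>q b \<and> T \<cdot>\<^sub>q b = a \<cdot>\<^sub>q (\<i>, 0))))"

lemma represents_chart:
  assumes x0: "norm x0 = 1" and K: "plane_represents (chart_plane x0 \<alpha> \<beta> \<gamma>) K"
  shows "represents (vec.span {chart_biv x0 \<alpha> \<beta> \<gamma>}) K"
proof -
  let ?v = "chart_vec x0 \<alpha> \<beta> \<gamma> (1, 0)" and ?w = "chart_vec x0 \<alpha> \<beta> \<gamma> (0, 1)"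
  have O: "Omega ?v ?w = 0" by (rule Omega_chart[OF x0])
  have W: "bwedge ?v ?w \<in> W" by (simp add: W_def bwedge_in_Lambda2 Omega_biv_bwedge O)
  have ne: "bwedge ?v ?w \<noteq> 0" using chart_biv_nonzero[OF x0] by (simp add: chart_biv_def)
  have Q3: "vec.span {bwedge ?v ?w} \<in> Q3" unfolding Q3_def using W ne bform_bwedge by blast
  have null: "(cmod (of_H2 a b $ 1))\<^sup>2 + (cmod (of_H2 a b $ 2))\<^sup>2 - (cmod (of_H2 a b $ 3))\<^sup>2 - (cmod (of_H2 a b $ 4))\<^sup>2 = 0
    \<longleftrightarrow> norm a = norm b" for a b
  proof -
    have "norm a = norm b \<longleftrightarrow> (norm a)\<^sup>2 = (norm b)\<^sup>2" by (simp add: power2_eq_iff_nonneg)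
    then show ?thesis unfolding norm_quat by (auto simp: algebra_simps)
  qed
  have "Q \<inter> projectivization (vec.span {?v, ?w}) = {tangent_line x T |x T. (x, T) \<in> K}"
  proof (intro equalityI subsetI)
    fix P assume "P \<in> Q \<inter> projectivization (vec.span {?v, ?w})"
    then obtain z z' :: "complex^4" where P: "P = vec.span {z}" "z \<noteq> 0" "P = vec.span {z'}" "z' \<in> vec.span {?v, ?w}"
      and n: "(cmod (z$1))\<^sup>2 + (cmod (z$2))\<^sup>2 - (cmod (z$3))\<^sup>2 - (cmod (z$4))\<^sup>2 = 0"
      unfolding Q_def projectivization_def by auto
    obtain a b where z: "z = of_H2 a b" by (metis of_H2_to_H2 surj_pair)
    have "z \<in> vec.span {z'}" using P(1,3) vec.span_base by (metis singletonI)
    also have "\<dots> \<subseteq> vec.span {?v, ?w}" using P(4) by (intro vec.span_minimal) simp_all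
    finally have "(a, b) \<in> chart_plane x0 \<alpha> \<beta> \<gamma>" unfolding z span_chart[OF x0] .
    moreover have ab: "norm a = norm b" using n unfolding z null .
    moreover have b: "b \<noteq> 0" using P(2) ab unfolding z of_H2_eq_0 by auto
    ultimately obtain x T where xT: "(x, T) \<in> K" "a = x \<cdot>\<^sub>q b" "T \<cdot>\<^sub>q b = a \<cdot>\<^sub>q (\<i>, 0)"
      using K unfolding plane_represents_def by blast
    then have "norm x = 1" "x \<bullet> T = 0" using K by (auto simp: plane_represents_def unit_tangents_def)
    then have "P = tangent_line x T"
      using tangent_line_span[of x T b] b xT tangent_line_iff[of x a b T] unfolding P(1) z by simp
    then show "P \<in> {tangent_line x T |x T. (x, T) \<in> K}" using xT(1) by blast
  next
    fix P assume "P \<in> {tangent_line x T |x T. (x, T) \<in> K}"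
    then obtain x T where xT: "(x, T) \<in> K" "P = tangent_line x T" by blast
    have u: "norm x = 1" "norm T = 1" "x \<bullet> T = 0" using K xT by (auto simp: plane_represents_def unit_tangents_def)
    obtain b where b: "b \<noteq> 0" "of_H2 (x \<cdot>\<^sub>q b) b \<in> tangent_line x T" using tangent_line_nonzero[OF u] by blast
    then have "T \<cdot>\<^sub>q b = x \<cdot>\<^sub>q b \<cdot>\<^sub>q (\<i>, 0)" using tangent_line_iff[OF u(1)] by blast
    then have "(x \<cdot>\<^sub>q b, b) \<in> chart_plane x0 \<alpha> \<beta> \<gamma> \<and> norm (x \<cdot>\<^sub>q b) = norm b"
      using K b(1) xT(1) unfolding plane_represents_def by blast
    then have s: "of_H2 (x \<cdot>\<^sub>q b) b \<in> vec.span {?v, ?w}" and n: "norm (x \<cdot>\<^sub>q b) = norm b"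
      using span_chart[OF x0] by blast+
    have ne: "of_H2 (x \<cdot>\<^sub>q b) b \<noteq> 0" using b(1) by (simp add: of_H2_eq_0)
    have "P = vec.span {of_H2 (x \<cdot>\<^sub>q b) b}" unfolding xT(2) by (rule tangent_line_span[OF u(1,3) b])
    moreover have "vec.span {of_H2 (x \<cdot>\<^sub>q b) b} \<in> Q" unfolding Q_def using ne null n by blast
    moreover have "vec.span {of_H2 (x \<cdot>\<^sub>q b) b} \<in> projectivization (vec.span {?v, ?w})"
      unfolding projectivization_def using s ne by blast
    ultimately show "P \<in> Q \<inter> projectivization (vec.span {?v, ?w})" by blast
  qed
  then show ?thesis unfolding represents_def chart_biv_def using O ne Q3 by blast
qed

text \<open>A representing plane contains the tangent lines at x1 and x2, and these are independent,
  so it is their span. This uniqueness gives the definite description in \<open>fiber_curve\<close>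
  its value.\<close>

lemma represents_span:
  assumes "represents P K" and u: "(x1, T1) \<in> unit_tangents" "(x2, T2) \<in> unit_tangents"
    and K: "(x1, T1) \<in> K" "(x2, T2) \<in> K" and x12: "x1 \<noteq> x2" and b: "b1 \<noteq> 0" "b2 \<noteq> 0"
    and z: "of_H2 (x1 \<cdot>\<^sub>q b1) b1 \<in> tangent_line x1 T1" "of_H2 (x2 \<cdot>\<^sub>q b2) b2 \<in> tangent_line x2 T2"
  shows "P = vec.span {bwedge (of_H2 (x1 \<cdot>\<^sub>q b1) b1) (of_H2 (x2 \<cdot>\<^sub>q b2) b2)}"
proof -
  obtain v w where P: "P = vec.span {bwedge v w}"
    and Q: "Q \<inter> projectivization (vec.span {v, w}) = {tangent_line x T |x T. (x, T) \<in> K}"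
    using assms(1) unfolding represents_def by blast
  have in_span: "of_H2 (x \<cdot>\<^sub>q b) b \<in> vec.span {v, w}"
    if "(x, T) \<in> K" "of_H2 (x \<cdot>\<^sub>q b) b \<in> tangent_line x T" for x T b
  proof -
    have "tangent_line x T \<in> projectivization (vec.span {v, w})" using Q that(1) by blast
    then obtain y where "tangent_line x T = vec.span {y}" "y \<in> vec.span {v, w}"
      unfolding projectivization_def by blast
    then have "tangent_line x T \<subseteq> vec.span {v, w}" by (simp add: vec.span_minimal)
    then show ?thesis using that(2) by blast
  qed
  let ?z1 = "of_H2 (x1 \<cdot>\<^sub>q b1) b1" and ?z2 = "of_H2 (x2 \<cdot>\<^sub>q b2) b2"
  have "?z1 \<in> vec.span {v, w}" "?z2 \<in> vec.span {v, w}" using in_span K z by blast+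
  then obtain s t s' t' where st: "?z1 = s *s v + t *s w" "?z2 = s' *s v + t' *s w"
    unfolding span_pair by blast
  have "bwedge ?z1 ?z2 \<in> vec.span {bwedge v w}"
    unfolding st bwedge_combination by (intro vec.span_scale vec.span_base) simp
  moreover have "bwedge ?z1 ?z2 \<noteq> 0"
  proof
    assume "bwedge ?z1 ?z2 = 0"
    moreover have "?z1 \<noteq> 0" using b by (simp add: of_H2_eq_0)
    ultimately obtain s where "?z2 = s *s ?z1" using bwedge_eq_0 by blast
    then have "to_H2 ?z2 = to_H2 (of_H2 (x1 \<cdot>\<^sub>q b1 \<cdot>\<^sub>q (s, 0)) (b1 \<cdot>\<^sub>q (s, 0)))" by (simp add: of_H2_linear)
    then have "x2 \<cdot>\<^sub>q b2 = x1 \<cdot>\<^sub>q b2" by (metis Pair_inject qmul_assoc to_H2_of_H2)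
    then have "(x2 - x1) \<cdot>\<^sub>q b2 = 0" by (simp add: qmul_distrib)
    then show False using b x12 by (simp only: qmul_eq_0) simp
  qed
  ultimately show ?thesis unfolding P by (rule span_singleton_eq[symmetric, rotated])
qed

lemma fiber_curve_chart:
  assumes x0: "norm x0 = 1" and K: "plane_represents (chart_plane x0 \<alpha> \<beta> \<gamma>) K"
    and "(x1, T1) \<in> K" "(x2, T2) \<in> K" "x1 \<noteq> x2"
  shows "(THE P. represents P K) = vec.span {chart_biv x0 \<alpha> \<beta> \<gamma>}"
proof (rule the_equality)
  show r: "represents (vec.span {chart_biv x0 \<alpha> \<beta> \<gamma>}) K" by (rule represents_chart[OF x0 K])
  have u: "(x1, T1) \<in> unit_tangents" "(x2, T2) \<in> unit_tangents"
    using K assms(3,4) by (auto simp: plane_represents_def)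
  obtain b1 b2 where b: "b1 \<noteq> 0" "b2 \<noteq> 0"
    "of_H2 (x1 \<cdot>\<^sub>q b1) b1 \<in> tangent_line x1 T1" "of_H2 (x2 \<cdot>\<^sub>q b2) b2 \<in> tangent_line x2 T2"
    using u tangent_line_nonzero unfolding unit_tangents_def by blast
  fix P assume "represents P K"
  then show "P = vec.span {chart_biv x0 \<alpha> \<beta> \<gamma>}"
    using represents_span[OF _ u assms(3-5) b] r by metis
qed

section \<open>Linear maps from space onto a plane\<close>

unbundle cross3_syntax

lemma linear_vec3: "linear g \<Longrightarrow> g t = (t$1) *\<^sub>R g (axis 1 1) + (t$2) *\<^sub>R g (axis 2 1) + (t$3) *\<^sub>R g (axis 3 1)"
  for g :: "real^3 \<Rightarrow> 'b::real_vector"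
proof -
  assume g: "linear g"
  have "t = (t$1) *\<^sub>R axis 1 1 + (t$2) *\<^sub>R axis 2 1 + (t$3) *\<^sub>R axis 3 1"
    by (simp add: vec_eq_iff forall_3 axis_def)
  then have "g t = g ((t$1) *\<^sub>R axis 1 1 + (t$2) *\<^sub>R axis 2 1 + (t$3) *\<^sub>R axis 3 1)" by simp
  then show ?thesis by (simp add: linear_add[OF g] linear_cmul[OF g])
qed

text \<open>The area form of the plane orthogonal to y pulls back to an alternating form on R^3,
  that is, to the inner product of a \<times> b with this vector. If g maps onto that plane, the
  vector spans the kernel and carries its orientation.\<close>

definition area_vector :: "(real^3 \<Rightarrow> real^3) \<Rightarrow> real^3 \<Rightarrow> real^3" where
  "area_vector g y = vector [y \<bullet> (g (axis 2 1) \<times> g (axis 3 1)), y \<bullet> (g (axis 3 1) \<times> g (axis 1 1)),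
     y \<bullet> (g (axis 1 1) \<times> g (axis 2 1))]"

lemma cross_combination:
  fixes u v w :: "real^3"
  shows "(a1 *\<^sub>R u + a2 *\<^sub>R v + a3 *\<^sub>R w) \<times> (b1 *\<^sub>R u + b2 *\<^sub>R v + b3 *\<^sub>R w)
    = (a2 * b3 - a3 * b2) *\<^sub>R (v \<times> w) + (a3 * b1 - a1 * b3) *\<^sub>R (w \<times> u) + (a1 * b2 - a2 * b1) *\<^sub>R (u \<times> v)"
proof -
  have "v \<times> u = - (u \<times> v)" "w \<times> v = - (v \<times> w)" "u \<times> w = - (w \<times> u)" by (rule cross_skew)+
  then show ?thesis
    by (simp add: cross_add_left cross_add_right cross_mult_left cross_mult_right cross_refl scaleR_left_diff_distrib
        scaleR_add_right scaleR_diff_right mult.commute)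
qed

lemma area_vector_cross:
  assumes "linear g"
  shows "y \<bullet> (g a \<times> g b) = area_vector g y \<bullet> (a \<times> b)"
proof -
  have "area_vector g y \<bullet> v = v$1 * (y \<bullet> (g (axis 2 1) \<times> g (axis 3 1))) + v$2 * (y \<bullet> (g (axis 3 1) \<times> g (axis 1 1)))
    + v$3 * (y \<bullet> (g (axis 1 1) \<times> g (axis 2 1)))" for v :: "real^3"
    by (simp add: area_vector_def inner_vec_def[of "vector _"] sum_3)
  moreover have "(a \<times> b)$1 = a$2 * b$3 - a$3 * b$2" "(a \<times> b)$2 = a$3 * b$1 - a$1 * b$3"
    "(a \<times> b)$3 = a$1 * b$2 - a$2 * b$1" by (simp_all add: cross3_def)
  ultimately show ?thesis
    unfolding linear_vec3[OF assms, of a] linear_vec3[OF assms, of b] cross_combination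
    by (simp add: inner_add_right)
qed

lemma triple_cross: "a \<times> (b \<times> c) = (a \<bullet> c) *\<^sub>R b - (a \<bullet> b) *\<^sub>R (c :: real^3)"
  by (rule Lagrange)

lemma cross_inner_self: "(u \<times> v) \<bullet> (u \<times> v) = (u \<bullet> u) * (v \<bullet> v) - (u \<bullet> v)\<^sup>2"
  by (simp add: cross3_def inner_vec_def sum_3 power2_eq_square algebra_simps)

lemma exists_orthogonal_vec3:
  fixes y :: "real^3"
  shows "\<exists>u. u \<noteq> 0 \<and> y \<bullet> u = 0"
proof (cases "y$1 = 0 \<and> y$2 = 0")
  case True
  then show ?thesis by (intro exI[of _ "axis 1 1"]) (simp add: inner_axis)
next
  case False
  then show ?thesis
    by (intro exI[of _ "vector [- y$2, y$1, 0]"]) (auto simp: inner_vec_def sum_3 vec_eq_iff forall_3)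
qed

text \<open>The differential of \<pi> at one point x, with the tangent space of S3 identified with
  R^3 by t \<mapsto> x t, and y the image point. Surjectivity becomes the condition on the
  range.\<close>

locale plane_map =
  fixes g :: "real^3 \<Rightarrow> real^3" and y :: "real^3"
  assumes lin: "linear g" and range: "range g = {u. y \<bullet> u = 0}" and unit: "norm y = 1"
begin

abbreviation c :: "real^3" where "c \<equiv> area_vector g y"

lemma perp: "y \<bullet> g t = 0" using range by blast

lemma yy: "y \<bullet> y = 1" using unit by (simp add: norm_eq_1)

lemma c_nonzero: "c \<noteq> 0"
proof
  assume 0: "c = 0"
  obtain u where u: "u \<noteq> 0" "y \<bullet> u = 0" using exists_orthogonal_vec3 by blast
  obtain a b where ab: "u = g a" "y \<times> u = g b"
    using range u(2) by (metis (mono_tags, lifting) dot_cross_self(1) mem_Collect_eq rangeE)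
  have "y \<bullet> (u \<times> (y \<times> u)) = 0" using area_vector_cross[OF lin, of y a b] by (simp add: 0 flip: ab)
  then have "u \<bullet> u = 0" by (simp add: triple_cross inner_diff_right yy u(2))
  then show False using u by simp
qed

lemma kernel: "g t = 0 \<longleftrightarrow> (\<exists>s. t = s *\<^sub>R c)"
proof
  assume "g t = 0"
  then have "c \<bullet> (t \<times> b) = 0" for b using area_vector_cross[OF lin, of y t b] by simp
  then have "(c \<times> t) \<bullet> b = 0" for b using cross_triple[of c t b] cross_triple[of t b c] by (metis inner_commute)
  then have "(c \<times> t) \<bullet> (c \<times> t) = 0" .
  then have "c \<times> t = 0" by simp
  then have "c \<times> (c \<times> t) = 0" by simp
  then have "(c \<bullet> c) *\<^sub>R t = (c \<bullet> t) *\<^sub>R c" by (simp add: triple_cross)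
  then have "inverse (c \<bullet> c) *\<^sub>R (c \<bullet> c) *\<^sub>R t = (inverse (c \<bullet> c) * (c \<bullet> t)) *\<^sub>R c" by simp
  then have "t = (inverse (c \<bullet> c) * (c \<bullet> t)) *\<^sub>R c" using c_nonzero by simp
  then show "\<exists>s. t = s *\<^sub>R c" by blast
next
  assume "\<exists>s. t = s *\<^sub>R c"
  then obtain s where s: "t = s *\<^sub>R c" by blast
  \<comment> \<open>For vectors v1, v2, v3 the cyclic sum of (y \<bullet> (v2 \<times> v3)) v1
    equals det (v1, v2, v3) y. As the image is orthogonal to y, this determinant vanishes.\<close>
  define D where "D = g (axis 1 1) \<bullet> (g (axis 2 1) \<times> g (axis 3 1))"
  have gc: "g c = D *\<^sub>R y"
    unfolding linear_vec3[OF lin, of c]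
    by (simp add: D_def area_vector_def cross3_def inner_vec_def sum_3 vec_eq_iff forall_3 algebra_simps)
  have "D = 0" using perp[of c] unfolding gc by (simp add: yy)
  then show "g t = 0" using gc by (simp add: s linear_cmul[OF lin])
qed

text \<open>The minus sign reflects that (x i, x j, x k) is a negative frame, so the positive kernel
  vector is opposite to the area vector.\<close>

definition \<tau> :: "real^3" where "\<tau> = - c /\<^sub>R norm c"

lemma norm_\<tau>: "norm \<tau> = 1" using c_nonzero by (simp add: \<tau>_def)

lemma c_\<tau>: "c = - norm c *\<^sub>R \<tau>" using c_nonzero by (simp add: \<tau>_def)

lemma g_\<tau>: "g \<tau> = 0" unfolding kernel by (rule exI[of _ "- inverse (norm c)"]) (simp add: \<tau>_def)

lemma unit_kernel: "g t = 0 \<Longrightarrow> norm t = 1 \<Longrightarrow> t = \<tau> \<or> t = - \<tau>"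
proof -
  assume "g t = 0" "norm t = 1"
  then obtain s where s: "t = s *\<^sub>R c" unfolding kernel by auto
  then have "\<bar>s\<bar> * norm c = 1" using \<open>norm t = 1\<close> by simp
  then have "\<bar>s\<bar> = inverse (norm c)" by (metis inverse_unique mult.commute)
  then have "s = inverse (norm c) \<or> s = - inverse (norm c)" by linarith
  then show ?thesis by (auto simp: s \<tau>_def)
qed

text \<open>The pairings of a \<times> b with t and with the area vector must have opposite signs,
  which selects one of the two unit kernel vectors. For t = - \<tau> the pair a, t \<times> a
  violates the condition.\<close>

lemma positive_iff:
  assumes "norm t = 1" "g t = 0"
  shows "(\<forall>a b. a \<bullet> t = 0 \<and> b \<bullet> t = 0 \<and> y \<bullet> (g a \<times> g b) > 0 \<longrightarrow> t \<bullet> (a \<times> b) < 0) \<longleftrightarrow> t = \<tau>"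
proof
  assume *: "\<forall>a b. a \<bullet> t = 0 \<and> b \<bullet> t = 0 \<and> y \<bullet> (g a \<times> g b) > 0 \<longrightarrow> t \<bullet> (a \<times> b) < 0"
  show "t = \<tau>"
  proof (rule ccontr)
    assume "t \<noteq> \<tau>"
    then have t: "t = - \<tau>" using unit_kernel assms by blast
    obtain a where a: "a \<noteq> 0" "t \<bullet> a = 0" using exists_orthogonal_vec3 by blast
    have tt: "t \<bullet> t = 1" using assms by (simp add: norm_eq_1)
    have c: "c = norm c *\<^sub>R t" using c_\<tau> t by simp
    have p: "t \<bullet> (a \<times> (t \<times> a)) = a \<bullet> a" by (simp add: triple_cross inner_diff_right tt a(2))
    have "y \<bullet> (g a \<times> g (t \<times> a)) = norm c * (a \<bullet> a)"
      unfolding area_vector_cross[OF lin] by (subst c) (simp add: p)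
    then have "y \<bullet> (g a \<times> g (t \<times> a)) > 0" using a c_nonzero by simp
    moreover have "a \<bullet> t = 0" by (metis a(2) inner_commute)
    moreover have "(t \<times> a) \<bullet> t = 0" by (simp add: dot_cross_self)
    ultimately have "t \<bullet> (a \<times> (t \<times> a)) < 0" using * by blast
    then show False unfolding p using inner_ge_zero[of a] by linarith
  qed
next
  assume t: "t = \<tau>"
  have "t \<bullet> v < 0" if "c \<bullet> v > 0" for v
  proof -
    have "c \<bullet> v = - (norm c * (t \<bullet> v))" unfolding t by (subst c_\<tau>) simp
    then show ?thesis using that c_nonzero by (simp add: mult_less_0_iff)
  qed
  then show "\<forall>a b. a \<bullet> t = 0 \<and> b \<bullet> t = 0 \<and> y \<bullet> (g a \<times> g b) > 0 \<longrightarrow> t \<bullet> (a \<times> b) < 0"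
    unfolding area_vector_cross[OF lin] by blast
qed

text \<open>A conformal map intertwines the rotations by a right angle; the sign comes from the
  orientation of the kernel.\<close>

lemma conformal_rotation:
  assumes k: "\<And>a b. a \<bullet> \<tau> = 0 \<Longrightarrow> b \<bullet> \<tau> = 0 \<Longrightarrow> g a \<bullet> g b = k * (a \<bullet> b)" and "k > 0" and a: "a \<bullet> \<tau> = 0"
  shows "g (a \<times> \<tau>) = y \<times> g a"
proof -
  define b where "b = a \<times> \<tau>"
  have \<tau>\<tau>: "\<tau> \<bullet> \<tau> = 1" using norm_\<tau> by (simp add: norm_eq_1)
  have b: "b \<bullet> \<tau> = 0" "a \<bullet> b = 0" by (simp_all add: b_def dot_cross_self)
  have bb: "b \<bullet> b = a \<bullet> a"
    by (simp add: b_def cross_inner_self \<tau>\<tau> a)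
  have "\<tau> \<bullet> (a \<times> b) = - (a \<bullet> a)"
    by (simp add: b_def triple_cross inner_diff_right \<tau>\<tau> a inner_commute)
  then have s: "y \<bullet> (g a \<times> g b) = norm c * (a \<bullet> a)"
    unfolding area_vector_cross[OF lin] by (subst c_\<tau>) simp
  have "y \<times> (g a \<times> g b) = 0" by (simp add: triple_cross perp)
  then have "(y \<bullet> (g a \<times> g b)) *\<^sub>R y - (y \<bullet> y) *\<^sub>R (g a \<times> g b) = 0"
    using triple_cross[of y y "g a \<times> g b"] by simp
  then have gab: "g a \<times> g b = (y \<bullet> (g a \<times> g b)) *\<^sub>R y" by (simp add: yy)
  have "(g a \<times> g b) \<bullet> (g a \<times> g b) = (y \<bullet> (g a \<times> g b))\<^sup>2"
    by (subst gab) (simp add: power2_eq_square)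
  \<comment> \<open>Lagrange's identity and conformality give the absolute value of the area; its
    sign is known from the area vector.\<close>
  then have "(y \<bullet> (g a \<times> g b))\<^sup>2 = (k * (a \<bullet> a))\<^sup>2"
    using cross_inner_self[of "g a" "g b"] k[OF a a] k[OF a b(1)] k[OF b(1) b(1)] b bb by (simp add: power2_eq_square)
  moreover have "k * (a \<bullet> a) \<ge> 0" "y \<bullet> (g a \<times> g b) \<ge> 0" using s \<open>k > 0\<close> by simp_all
  ultimately have s': "y \<bullet> (g a \<times> g b) = k * (a \<bullet> a)" by (simp add: power2_eq_iff_nonneg)
  \<comment> \<open>Both vectors have squared length k (a \<bullet> a), and so has their inner
    product; hence they coincide.\<close>
  let ?d = "g b - y \<times> g a"
  have "g b \<bullet> (y \<times> g a) = k * (a \<bullet> a)" using s' using cross_triple[of y "g a" "g b"] cross_triple[of "g a" "g b" y] by (metis inner_commute)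
  moreover have "(y \<times> g a) \<bullet> (y \<times> g a) = k * (a \<bullet> a)"
    by (simp add: cross_inner_self yy perp k a)
  ultimately have "?d \<bullet> ?d = 0" using k[OF b(1) b(1)] bb
    by (simp add: inner_diff_left inner_diff_right inner_commute)
  then show ?thesis by (simp add: b_def)
qed

end

section \<open>Oriented fibers\<close>

lemma tangent_eq:
  assumes "norm x = 1"
  shows "tangent x = range (\<lambda>t. x \<cdot>\<^sub>q qvec t)"
proof (intro equalityI subsetI)
  fix T assume "T \<in> tangent x"
  then have "Re (fst (qcnj x \<cdot>\<^sub>q T)) = 0" by (simp add: tangent_def inner_quat)
  then have "T = x \<cdot>\<^sub>q qvec (qim (qcnj x \<cdot>\<^sub>q T))" using assms by (simp add: qvec_qim qcnj_unit_cancel)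
  then show "T \<in> range (\<lambda>t. x \<cdot>\<^sub>q qvec t)" by blast
next
  fix T assume "T \<in> range (\<lambda>t. x \<cdot>\<^sub>q qvec t)"
  then show "T \<in> tangent x" using assms by (auto simp: tangent_def inner_quat qcnj_unit_cancel)
qed

lemma inner_qmul_qvec:
  assumes "norm x = 1"
  shows "(x \<cdot>\<^sub>q qvec s) \<bullet> (x \<cdot>\<^sub>q qvec t) = s \<bullet> t"
  using assms by (simp add: inner_quat qcnj_qmul qmul_assoc qcnj_unit_cancel qmul_distrib qmul_qvec)

lemma positive_S3_qvec:
  assumes "norm x = 1"
  shows "positive_S3 x (x \<cdot>\<^sub>q qvec t) (x \<cdot>\<^sub>q qvec a) (x \<cdot>\<^sub>q qvec b) \<longleftrightarrow> t \<bullet> (a \<times> b) < 0"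
  using assms by (simp add: positive_S3_def qcnj_unit_cancel dot_cross_det)

lemma circle_parametrization:
  assumes "is_circle k"
  obtains m e1 e2 r where "circle_data m e1 e2 r" "k = {m + r *\<^sub>R (cos t *\<^sub>R e1 + sin t *\<^sub>R e2) | t. True}"
proof -
  obtain E p q where E: "affine E" "aff_dim E = 2" "k = S3 \<inter> E" and pq: "p \<in> k" "q \<in> k" "p \<noteq> q"
    using assms unfolding is_circle_def by blast
  define S where "S = (\<lambda>x. - p + x) ` E"
  have S: "subspace S" using affine_diffs_subspace[OF E(1), of p] pq E by (simp add: S_def)
  have ES: "x \<in> E \<longleftrightarrow> x - p \<in> S" for x by (auto simp: S_def image_iff)
  have "dim S = 2"
    using aff_dim_subspace[OF S] E(2) aff_dim_translation_eq[of "- p" E] by (simp add: S_def)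
  then obtain B where B: "pairwise orthogonal B" "\<And>x. x \<in> B \<Longrightarrow> norm x = 1" "card B = 2" "span B = S"
    using orthonormal_basis_subspace[OF S] by metis
  obtain e1 e2 where e: "B = {e1, e2}" "e1 \<noteq> e2" using B(3) by (meson card_2_iff)
  have o: "e1 \<bullet> e2 = 0" using B(1) e by (simp add: pairwise_def orthogonal_def)
  have n: "norm e1 = 1" "norm e2 = 1" "e1 \<bullet> e1 = 1" "e2 \<bullet> e2 = 1" "e2 \<bullet> e1 = 0"
    using B(2) e o by (auto simp: norm_eq_1 inner_commute)
  have inS: "v \<in> S \<longleftrightarrow> (\<exists>s t. v = s *\<^sub>R e1 + t *\<^sub>R e2)" for v
    unfolding B(4)[symmetric] e(1) by (auto simp: span_insert span_singleton) (metis add.commute diff_add_cancel, metis add_diff_cancel_left')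
  \<comment> \<open>The foot of the perpendicular from the origin to E.\<close>
  define m where "m = p - ((p \<bullet> e1) *\<^sub>R e1 + (p \<bullet> e2) *\<^sub>R e2)"
  have m: "m \<bullet> e1 = 0" "m \<bullet> e2 = 0" "e1 \<bullet> m = 0" "e2 \<bullet> m = 0"
    by (simp_all add: m_def inner_diff_left inner_diff_right inner_add_left inner_add_right n o inner_commute[of _ p])
  have inE: "x \<in> E \<longleftrightarrow> (\<exists>s t. x = m + (s *\<^sub>R e1 + t *\<^sub>R e2))" for x
  proof -
    have "x - p = (s - p \<bullet> e1) *\<^sub>R e1 + (t - p \<bullet> e2) *\<^sub>R e2 \<longleftrightarrow> x = m + (s *\<^sub>R e1 + t *\<^sub>R e2)" for s t
      by (auto simp: m_def algebra_simps)
    then show ?thesis unfolding ES inS by (metis add_diff_cancel)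
  qed
  have nrm: "(norm (m + (s *\<^sub>R e1 + t *\<^sub>R e2)))\<^sup>2 = (norm m)\<^sup>2 + (s\<^sup>2 + t\<^sup>2)" for s t
    unfolding power2_norm_eq_inner by (simp add: inner_add_left inner_add_right m n o power2_eq_square)
  have ink: "x \<in> k \<longleftrightarrow> (\<exists>s t. x = m + (s *\<^sub>R e1 + t *\<^sub>R e2) \<and> s\<^sup>2 + t\<^sup>2 = 1 - (norm m)\<^sup>2)" for x
  proof -
    have "norm x = 1 \<longleftrightarrow> (norm x)\<^sup>2 = 1" by (simp add: power2_eq_1_iff) (smt (verit) norm_ge_zero)
    then show ?thesis unfolding E(3) Int_iff inE mem_sphere_0 using nrm by (smt (verit))
  qed
  define r where "r = sqrt (1 - (norm m)\<^sup>2)"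
  have pos: "1 - (norm m)\<^sup>2 > 0"
  proof (rule ccontr)
    assume *: "\<not> 1 - (norm m)\<^sup>2 > 0"
    have "x = m" if xk: "x \<in> k" for x
    proof -
      obtain s t where st: "x = m + (s *\<^sub>R e1 + t *\<^sub>R e2)" "s\<^sup>2 + t\<^sup>2 = 1 - (norm m)\<^sup>2" using xk ink by blast
      then have "s\<^sup>2 + t\<^sup>2 \<le> 0" using * by simp
      then show ?thesis using st(1) by (simp add: sum_power2_le_zero_iff)
    qed
    then show False using pq by metis
  qed
  then have r: "r > 0" "r\<^sup>2 = 1 - (norm m)\<^sup>2" by (simp_all add: r_def)
  have "circle_data m e1 e2 r" by unfold_locales (use o m n r in simp_all)
  moreover have "k = {m + r *\<^sub>R (cos t *\<^sub>R e1 + sin t *\<^sub>R e2) | t. True}"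
  proof (intro equalityI subsetI)
    fix x assume "x \<in> k"
    then obtain s t where st: "x = m + (s *\<^sub>R e1 + t *\<^sub>R e2)" "s\<^sup>2 + t\<^sup>2 = r\<^sup>2" using ink r by auto
    have "(s / r)\<^sup>2 + (t / r)\<^sup>2 = 1" using st(2) r(1) by (simp add: power_divide flip: add_divide_distrib)
    then obtain \<theta> where "s / r = cos \<theta>" "t / r = sin \<theta>" using sincos_total_2pi by metis
    then have "s = r * cos \<theta>" "t = r * sin \<theta>" using r(1) by (simp_all add: field_simps)
    then have "x = m + r *\<^sub>R (cos \<theta> *\<^sub>R e1 + sin \<theta> *\<^sub>R e2)" by (simp add: st(1) scaleR_add_right)
    then show "x \<in> {m + r *\<^sub>R (cos t *\<^sub>R e1 + sin t *\<^sub>R e2) | t. True}" by blast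
  next
    fix x assume "x \<in> {m + r *\<^sub>R (cos t *\<^sub>R e1 + sin t *\<^sub>R e2) | t. True}"
    then obtain \<theta> where "x = m + r *\<^sub>R (cos \<theta> *\<^sub>R e1 + sin \<theta> *\<^sub>R e2)" by blast
    then have "x = m + ((r * cos \<theta>) *\<^sub>R e1 + (r * sin \<theta>) *\<^sub>R e2)" by (simp add: scaleR_add_right)
    moreover have "(r * cos \<theta>)\<^sup>2 + (r * sin \<theta>)\<^sup>2 = 1 - (norm m)\<^sup>2"
      by (simp add: power_mult_distrib r(2)[symmetric] flip: distrib_left)
    ultimately show "x \<in> k" unfolding ink by blast
  qed
  ultimately show ?thesis by (rule that)
qed

section \<open>The positive unit tangent field of a conformal fibration\<close>

locale fibration =
  fixes f :: "quat \<Rightarrow> real^3"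
  assumes fib: "conformal_circle_fibration f"
begin

lemma f_sphere: "norm x = 1 \<Longrightarrow> norm (f x) = 1"
  using fib unfolding conformal_circle_fibration_def conformal_submersion_def by (auto simp: image_subset_iff)

lemma radial_C1: "Ck_on (Suc 0) (radial f) (- {0})"
  using fib unfolding conformal_circle_fibration_def conformal_submersion_def smooth_S3_def by blast

lemma radial_has_derivative: "x \<noteq> 0 \<Longrightarrow> (radial f has_derivative differential f x) (at x)"
  using radial_C1 unfolding differential_def by (auto simp: frechet_derivative_works)

lemma continuous_differential: "continuous_on (- {0}) (\<lambda>x. differential f x v)"
  using radial_C1 unfolding differential_def Ck_on.simps by blast

lemma linear_differential: "x \<noteq> 0 \<Longrightarrow> linear (differential f x)"
  using radial_has_derivative has_derivative_linear by blast

lemma radial_unit: "norm x = 1 \<Longrightarrow> radial f x = f x"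
  by (simp add: radial_def)

lemma continuous_on_f: "continuous_on (sphere 0 1) f"
proof -
  have "continuous_on (- {0}) (radial f)"
    using radial_has_derivative by (intro continuous_at_imp_continuous_on) (auto intro: has_derivative_continuous)
  then have "continuous_on (sphere 0 1) (radial f)" by (rule continuous_on_subset) auto
  then show ?thesis by (rule continuous_on_eq) (auto simp: radial_unit)
qed

definition G :: "quat \<Rightarrow> real^3 \<Rightarrow> real^3" where
  "G x t = differential f x (x \<cdot>\<^sub>q qvec t)"

lemma plane_map_G:
  assumes "norm x = 1"
  shows "plane_map (G x) (f x)"
proof (rule plane_map.intro)
  have x: "x \<noteq> 0" using assms by auto
  show "linear (G x)"
    by (rule linearI) (simp_all add: G_def qvec_linear qmul_distrib qmul_scaleR linear_add[OF linear_differential[OF x]]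
        linear_cmul[OF linear_differential[OF x]])
  have "range (G x) = differential f x ` tangent x" by (auto simp: tangent_eq[OF assms] G_def)
  also have "\<dots> = tangent (f x)"
    using fib assms unfolding conformal_circle_fibration_def conformal_submersion_def by auto
  finally show "range (G x) = {u. f x \<bullet> u = 0}" by (simp add: tangent_def)
  show "norm (f x) = 1" using f_sphere assms by blast
qed

text \<open>The vector \<open>plane_map.\<tau>\<close> of the differential, written as a function of
  x so that its continuity in x can be studied.\<close>

definition tvec :: "quat \<Rightarrow> real^3" where
  "tvec x = - area_vector (G x) (f x) /\<^sub>R norm (area_vector (G x) (f x))"

definition Tf :: "quat \<Rightarrow> quat" where
  "Tf x = x \<cdot>\<^sub>q qvec (tvec x)"

lemma tvec_eq: "norm x = 1 \<Longrightarrow> tvec x = plane_map.\<tau> (G x) (f x)"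
  using plane_map.\<tau>_def[OF plane_map_G] by (simp add: tvec_def)

lemma norm_tvec: "norm x = 1 \<Longrightarrow> norm (tvec x) = 1"
  using plane_map.norm_\<tau>[OF plane_map_G] by (simp add: tvec_eq)

lemma unit_tangent_Tf: "norm x = 1 \<Longrightarrow> (x, Tf x) \<in> unit_tangents"
  by (simp add: unit_tangents_def Tf_def norm_qmul norm_tvec inner_quat qcnj_unit_cancel)

lemma positive_vertical_iff:
  assumes "norm x = 1"
  shows "norm T = 1 \<and> positive_vertical f x T \<longleftrightarrow> T = Tf x"
proof -
  interpret plane_map "G x" "f x" by (rule plane_map_G[OF assms])
  have vert: "x \<cdot>\<^sub>q qvec t \<in> vertical f x \<longleftrightarrow> G x t = 0" for t
    by (simp add: vertical_def G_def tangent_eq[OF assms])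
  have pos: "positive_vertical f x (x \<cdot>\<^sub>q qvec t) \<longleftrightarrow> G x t = 0 \<and>
      (\<forall>a b. a \<bullet> t = 0 \<and> b \<bullet> t = 0 \<and> f x \<bullet> (G x a \<times> G x b) > 0 \<longrightarrow> t \<bullet> (a \<times> b) < 0)" for t
    unfolding positive_vertical_def vert
    by (simp add: tangent_eq[OF assms] inner_qmul_qvec[OF assms] positive_S3_qvec[OF assms] positive_S2_def
        G_def[symmetric])
  show ?thesis
  proof
    assume *: "norm T = 1 \<and> positive_vertical f x T"
    then have "T \<in> tangent x" by (simp add: positive_vertical_def vertical_def)
    then obtain t where t: "T = x \<cdot>\<^sub>q qvec t" by (auto simp: tangent_eq[OF assms])
    have "norm t = 1" using * assms by (simp add: t norm_qmul)
    then have "t = \<tau>" using * positive_iff[of t] unfolding t pos by blast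
    then show "T = Tf x" by (simp add: Tf_def t tvec_eq assms)
  next
    assume "T = Tf x"
    then have T: "T = x \<cdot>\<^sub>q qvec \<tau>" by (simp add: Tf_def tvec_eq assms)
    then show "norm T = 1 \<and> positive_vertical f x T"
      using positive_iff[OF norm_\<tau> g_\<tau>] g_\<tau> norm_\<tau> assms by (simp add: T pos norm_qmul)
  qed
qed

lemma oriented_fiber_eq: "oriented_fiber f y = {(x, Tf x) | x. x \<in> fiber f y}"
proof -
  have "norm x = 1" if "x \<in> fiber f y" for x using that by (simp add: fiber_def)
  then show ?thesis unfolding oriented_fiber_def using positive_vertical_iff by blast
qed

lemma kernel_Tf:
  assumes "norm x = 1" "norm T = 1" "x \<bullet> T = 0" "differential f x T = 0"
  shows "T = Tf x \<or> T = - Tf x"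
proof -
  interpret plane_map "G x" "f x" by (rule plane_map_G[OF assms(1)])
  obtain t where t: "T = x \<cdot>\<^sub>q qvec t" using tangent_eq[OF assms(1)] assms(3) by (auto simp: tangent_def)
  have "norm t = 1" "G x t = 0" using assms by (simp_all add: t norm_qmul G_def)
  then show ?thesis using unit_kernel[of t] by (auto simp: t Tf_def tvec_eq assms(1) qvec_linear qmul_distrib)
qed

lemma continuous_Tf: "continuous_on (sphere 0 1) Tf"
proof -
  \<comment> \<open>Smoothness gives continuity of the differential in a fixed direction. Here the
    direction moves with x, so it is expanded in the standard basis.\<close>
  have G: "continuous_on (sphere 0 1) (\<lambda>x. G x t)" for t
  proof -
    have "continuous_on (sphere 0 1) (\<lambda>x. \<Sum>b\<in>Basis. ((x \<cdot>\<^sub>q qvec t) \<bullet> b) *\<^sub>R differential f x b)"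
      by (intro continuous_intros continuous_on_subset[OF continuous_differential]) auto
    then show ?thesis
    proof (rule continuous_on_eq)
      fix x :: quat assume "x \<in> sphere 0 1"
      then have "x \<noteq> 0" by auto
      note l = linear_differential[OF this]
      have "G x t = differential f x (\<Sum>b\<in>Basis. ((x \<cdot>\<^sub>q qvec t) \<bullet> b) *\<^sub>R b)" by (simp add: G_def euclidean_representation)
      then show "(\<Sum>b\<in>Basis. ((x \<cdot>\<^sub>q qvec t) \<bullet> b) *\<^sub>R differential f x b) = G x t"
        by (simp add: linear_sum[OF l] linear_cmul[OF l])
    qed
  qed
  have "continuous_on (sphere 0 1) (\<lambda>x. area_vector (G x) (f x))"
  proof -
    have "continuous_on (sphere 0 1) (\<lambda>x. f x \<bullet> (G x s \<times> G x t))" for s t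
      by (intro continuous_intros continuous_on_f continuous_on_cross G)
    then have "continuous_on (sphere 0 1) (\<lambda>x. area_vector (G x) (f x) $ i)" for i
      using exhaust_3[of i] by (auto simp: area_vector_def)
    then show ?thesis using continuous_on_vec_lambda[of "sphere 0 1" "\<lambda>i x. area_vector (G x) (f x) $ i"] by simp
  qed
  moreover have "area_vector (G x) (f x) \<noteq> 0" if "x \<in> sphere 0 1" for x
    using that plane_map.c_nonzero[OF plane_map_G] by simp
  ultimately have "continuous_on (sphere 0 1) tvec"
    unfolding tvec_def by (intro continuous_intros) auto
  then show ?thesis unfolding Tf_def
    by (intro continuous_intros bounded_linear.continuous_on[OF bounded_linear_qvec])
qed

text \<open>The velocity of the parametrized fiber lies in the kernel of the differential, so its
  direction is \<open>Tf\<close> or the opposite. The sign depends continuously on the parameter,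
  hence is constant; if it is negative, - e2 reverses the circle.\<close>

lemma oriented_fiber_ocircle:
  assumes "y \<in> S2"
  shows "\<exists>m e1 e2 r. circle_data m e1 e2 r \<and> oriented_fiber f y = circle_data.ocircle m e1 e2 r"
proof -
  have "is_circle (fiber f y)" using fib assms unfolding conformal_circle_fibration_def by blast
  then obtain m e1 e2 r where cd: "circle_data m e1 e2 r"
    and k: "fiber f y = {m + r *\<^sub>R (cos t *\<^sub>R e1 + sin t *\<^sub>R e2) | t. True}"
    using circle_parametrization by blast
  interpret circle_data m e1 e2 r by (rule cd)
  define \<gamma> where "\<gamma> t = m + r *\<^sub>R dir t" for t
  have k: "fiber f y = range \<gamma>" unfolding k \<gamma>_def dir_def by auto
  have n: "norm (\<gamma> t) = 1" for t by (simp add: \<gamma>_def norm_point)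
  have d: "(\<gamma> has_vector_derivative r *\<^sub>R (u \<cdot>\<^sub>q dir t)) (at t)" for t
    unfolding \<gamma>_def[abs_def] u_dir(2) unfolding dir_def[abs_def]
    by (auto intro!: derivative_eq_intros simp: algebra_simps)
  have T: "u \<cdot>\<^sub>q dir t = Tf (\<gamma> t) \<or> u \<cdot>\<^sub>q dir t = - Tf (\<gamma> t)" for t
  proof (rule kernel_Tf[OF n])
    have u: "(\<gamma> t, u \<cdot>\<^sub>q dir t) \<in> ocircle" by (auto simp: ocircle_def \<gamma>_def)
    show "norm (u \<cdot>\<^sub>q dir t) = 1" "\<gamma> t \<bullet> (u \<cdot>\<^sub>q dir t) = 0" using ocircle_unit[OF u] by auto
    have ne: "\<gamma> t \<noteq> 0" using n[of t] by auto
    have "((\<lambda>s. radial f (\<gamma> s)) has_vector_derivative differential f (\<gamma> t) (r *\<^sub>R (u \<cdot>\<^sub>q dir t))) (at t)"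
      using has_derivative_compose[OF d[of t, unfolded has_vector_derivative_def] radial_has_derivative[OF ne]]
      unfolding has_vector_derivative_def by (simp add: linear_cmul[OF linear_differential[OF ne]])
    moreover have "radial f (\<gamma> s) = y" for s
    proof -
      have "\<gamma> s \<in> fiber f y" unfolding k by blast
      then show ?thesis using radial_unit[OF n] by (simp add: fiber_def)
    qed
    ultimately have "((\<lambda>s. y) has_vector_derivative differential f (\<gamma> t) (r *\<^sub>R (u \<cdot>\<^sub>q dir t))) (at t)" by simp
    then have "differential f (\<gamma> t) (r *\<^sub>R (u \<cdot>\<^sub>q dir t)) = 0"
      using vector_derivative_unique_at has_vector_derivative_const by blast
    then show "differential f (\<gamma> t) (u \<cdot>\<^sub>q dir t) = 0"
      using rpos by (simp add: linear_cmul[OF linear_differential[OF ne]])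
  qed
  define \<sigma> where "\<sigma> t = Tf (\<gamma> t) \<bullet> (u \<cdot>\<^sub>q dir t)" for t
  have nT: "Tf (\<gamma> t) \<bullet> Tf (\<gamma> t) = 1" for t
    using unit_tangent_Tf[OF n] by (simp add: unit_tangents_def norm_eq_1)
  have \<sigma>: "(\<sigma> t = 1 \<and> u \<cdot>\<^sub>q dir t = Tf (\<gamma> t)) \<or> (\<sigma> t = - 1 \<and> u \<cdot>\<^sub>q dir t = - Tf (\<gamma> t))" for t
    using T[of t] nT[of t] unfolding \<sigma>_def by auto
  have cdir: "continuous_on UNIV dir" unfolding dir_def[abs_def] by (intro continuous_intros)
  have c\<gamma>: "continuous_on UNIV \<gamma>" unfolding \<gamma>_def[abs_def] by (intro continuous_intros cdir)
  have "continuous_on UNIV \<sigma>" unfolding \<sigma>_def[abs_def]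
    by (intro continuous_intros cdir continuous_on_compose2[OF continuous_Tf c\<gamma>]) (auto simp: n)
  moreover have "finite (range \<sigma>)" by (rule finite_subset[of _ "{1, - 1}"]) (use \<sigma> in auto)
  ultimately have "\<sigma> constant_on UNIV" by (intro continuous_finite_range_constant) auto
  then obtain s where s: "\<And>t. \<sigma> t = s" by (auto simp: constant_on_def)
  have K: "oriented_fiber f y = {(\<gamma> t, Tf (\<gamma> t)) | t. True}" unfolding oriented_fiber_eq k by blast
  show ?thesis
  proof (cases "s = 1")
    case True
    then have "Tf (\<gamma> t) = u \<cdot>\<^sub>q dir t" for t using \<sigma>[of t] s by auto
    then have "oriented_fiber f y = ocircle" unfolding K ocircle_def \<gamma>_def by auto
    then show ?thesis using cd by blast
  next
    case False
    then have T': "Tf (\<gamma> t) = - (u \<cdot>\<^sub>q dir t)" for t using \<sigma>[of t] s by auto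
    interpret o: circle_data m e1 "- e2" r by unfold_locales (use ortho unit rpos radius in auto)
    have dir': "o.dir t = dir (- t)" for t by (simp add: o.dir_def dir_def)
    have u': "o.u = - u" by (simp add: o.u_def u_def qmul_distrib)
    have "oriented_fiber f y = o.ocircle"
    proof -
      have "o.ocircle = {(\<gamma> (- t), Tf (\<gamma> (- t))) | t. True}"
        unfolding o.ocircle_def T' dir' u' by (simp add: \<gamma>_def qmul_distrib)
      also have "\<dots> = {(\<gamma> t, Tf (\<gamma> t)) | t. True}" by (auto, metis minus_minus)
      finally show ?thesis by (simp add: K)
    qed
    then show ?thesis using o.circle_data_axioms by blast
  qed
qed

lemma fiber_chart:
  assumes "y \<in> S2" "norm x0 = 1" "f x0 \<noteq> y"
  shows "\<exists>\<alpha> \<beta> \<gamma>. plane_represents (chart_plane x0 \<alpha> \<beta> \<gamma>) (oriented_fiber f y)"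
proof -
  obtain m e1 e2 r where "circle_data m e1 e2 r" and K: "oriented_fiber f y = circle_data.ocircle m e1 e2 r"
    using oriented_fiber_ocircle[OF assms(1)] by blast
  interpret circle_data m e1 e2 r by fact
  have "(x0, T) \<notin> ocircle" for T
    unfolding K[symmetric] oriented_fiber_eq using assms(3) by (auto simp: fiber_def)
  then obtain \<alpha> \<beta> \<gamma> where L: "chart_plane x0 \<alpha> \<beta> \<gamma> = plane" using exists_chart assms(2) by blast
  have "plane_represents plane (oriented_fiber f y)"
    unfolding plane_represents_def K
  proof (intro conjI allI impI iffI)
    show "ocircle \<subseteq> unit_tangents" using ocircle_unit by (auto simp: unit_tangents_def)
    fix a b :: quat assume b: "b \<noteq> 0"
    show "\<exists>x T. (x, T) \<in> ocircle \<and> a = x \<cdot>\<^sub>q b \<and> T \<cdot>\<^sub>q b = a \<cdot>\<^sub>q (\<i>, 0)" if "(a, b) \<in> plane \<and> norm a = norm b"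
      using that ocircle_of_plane b by blast
    assume "\<exists>x T. (x, T) \<in> ocircle \<and> a = x \<cdot>\<^sub>q b \<and> T \<cdot>\<^sub>q b = a \<cdot>\<^sub>q (\<i>, 0)"
    then obtain x T where xT: "(x, T) \<in> ocircle" "a = x \<cdot>\<^sub>q b" "T \<cdot>\<^sub>q b = a \<cdot>\<^sub>q (\<i>, 0)" by blast
    then show "(a, b) \<in> plane" "norm a = norm b"
      using plane_of_ocircle ocircle_unit(1) by (auto simp: norm_qmul)
  qed
  then show ?thesis using L by metis
qed

text \<open>Two points suffice to fix the plane of a fiber; three are used to solve for the
  derivatives of the three entries of its matrix.\<close>

lemma three_fiber_points:
  assumes "y \<in> S2"
  shows "\<exists>x1 x2 x3. {x1, x2, x3} \<subseteq> fiber f y \<and> x1 \<noteq> x2 \<and> x1 \<noteq> x3 \<and> x2 \<noteq> x3"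
proof -
  have "is_circle (fiber f y)" using fib assms unfolding conformal_circle_fibration_def by blast
  then obtain m e1 e2 r where cd: "circle_data m e1 e2 r"
    and k: "fiber f y = {m + r *\<^sub>R (cos t *\<^sub>R e1 + sin t *\<^sub>R e2) | t. True}"
    using circle_parametrization by blast
  interpret circle_data m e1 e2 r by (rule cd)
  have *: "m + r *\<^sub>R (cos t *\<^sub>R e1 + sin t *\<^sub>R e2) \<in> fiber f y" for t unfolding k by blast
  have "e1 \<noteq> - e1"
  proof
    assume "e1 = - e1"
    then have "2 *\<^sub>R e1 = 0" by (metis add.right_inverse scaleR_2)
    then show False using unit(1) by simp
  qed
  moreover have "e1 \<noteq> e2" "e2 \<noteq> - e1" using ortho(1) unit by (auto simp: norm_eq_1)
  ultimately have "{m + r *\<^sub>R e1, m + r *\<^sub>R e2, m + r *\<^sub>R (- e1)} \<subseteq> fiber f y \<and>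
      m + r *\<^sub>R e1 \<noteq> m + r *\<^sub>R e2 \<and> m + r *\<^sub>R e1 \<noteq> m + r *\<^sub>R (- e1) \<and> m + r *\<^sub>R e2 \<noteq> m + r *\<^sub>R (- e1)"
    using *[of 0] *[of "pi/2"] *[of pi] rpos by (simp add: scaleR_left_imp_eq del: scaleR_minus_right)
  then show ?thesis by blast
qed

lemma conformal_G:
  assumes "norm x = 1"
  shows "\<exists>k>0. \<forall>a b. a \<bullet> tvec x = 0 \<longrightarrow> b \<bullet> tvec x = 0 \<longrightarrow> G x a \<bullet> G x b = k * (a \<bullet> b)"
proof -
  interpret plane_map "G x" "f x" by (rule plane_map_G[OF assms])
  obtain k where k: "k > 0" "\<And>A B. A \<in> horizontal f x \<Longrightarrow> B \<in> horizontal f x \<Longrightarrow>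
      differential f x A \<bullet> differential f x B = k * (A \<bullet> B)"
    using fib assms unfolding conformal_circle_fibration_def conformal_submersion_def by (metis mem_sphere_0)
  have h: "x \<cdot>\<^sub>q qvec a \<in> horizontal f x" if "a \<bullet> tvec x = 0" for a
  proof -
    have "(x \<cdot>\<^sub>q qvec a) \<bullet> T = 0" if "T \<in> vertical f x" for T
    proof -
      obtain t where t: "T = x \<cdot>\<^sub>q qvec t" "G x t = 0"
        using \<open>T \<in> vertical f x\<close> by (auto simp: vertical_def tangent_eq[OF assms] G_def)
      then obtain s where "t = s *\<^sub>R c" unfolding kernel by blast
      then show ?thesis using \<open>a \<bullet> tvec x = 0\<close> c_\<tau> unfolding t(1) inner_qmul_qvec[OF assms] tvec_eq[OF assms]
        by (metis inner_scaleR_right mult_zero_right)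
    qed
    then show ?thesis by (simp add: horizontal_def tangent_eq[OF assms])
  qed
  show ?thesis using k(1) k(2)[OF h h] by (auto simp: G_def inner_qmul_qvec[OF assms])
qed

lemma G_rotation:
  assumes "norm x = 1" "a \<bullet> tvec x = 0"
  shows "G x (a \<times> tvec x) = f x \<times> G x a"
proof -
  interpret plane_map "G x" "f x" by (rule plane_map_G[OF assms(1)])
  show ?thesis using conformal_G[OF assms(1)] conformal_rotation assms by (metis tvec_eq)
qed

lemma G_injective:
  assumes "norm x = 1" "a \<bullet> tvec x = 0" "G x a = 0"
  shows "a = 0"
  using conformal_G[OF assms(1)] assms(2,3) by (metis inner_eq_zero_iff inner_zero_left mult_eq_0_iff less_irrefl)

end

section \<open>Stereographic coordinates\<close>

text \<open>\<open>e = 1\<close> gives the coordinate \<open>[1 : \<zeta>]\<close> of the projective line, \<open>e = - 1\<close> the coordinate \<open>[\<zeta> : 1]\<close>.\<close>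

definition stereo :: "real \<Rightarrow> real^3 \<Rightarrow> complex" where
  "stereo e y = Complex (y$1) (e * y$2) / of_real (1 + e * y$3)"

definition stereo_inv :: "real \<Rightarrow> complex \<Rightarrow> real^3" where
  "stereo_inv e \<zeta> = vector [2 * Re \<zeta>, 2 * e * Im \<zeta>, e * (1 - (cmod \<zeta>)\<^sup>2)] /\<^sub>R (1 + (cmod \<zeta>)\<^sup>2)"

definition stereo_deriv :: "real \<Rightarrow> real^3 \<Rightarrow> real^3 \<Rightarrow> complex" where
  "stereo_deriv e y u = Complex ((1 + e * y$3) * u$1 - e * u$3 * y$1)
     ((1 + e * y$3) * (e * u$2) - e * u$3 * (e * y$2)) / (of_real (1 + e * y$3))\<^sup>2"

lemma norm3: "norm y = 1 \<longleftrightarrow> (y$1)\<^sup>2 + (y$2)\<^sup>2 + (y$3)\<^sup>2 = 1" for y :: "real^3"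
  by (simp add: norm_eq_1 inner_vec_def sum_3 power2_eq_square)

lemma one_plus_cmod_pos: "1 + (cmod z)\<^sup>2 > 0"
  by (smt (verit) zero_le_power2)

text \<open>The scalar content of \<open>stereo_deriv_rotation\<close> and
  \<open>stereo_deriv_injective\<close>, in real variables so that only ideal membership is left to
  decide.\<close>

lemma rotation_identities:
  fixes e y1 y2 y3 u1 u2 u3 :: real
  assumes "e * e = 1" "y1 * y1 + y2 * y2 + y3 * y3 = 1" "y1 * u1 + y2 * u2 + y3 * u3 = 0"
  shows "(1 + e * y3) * (y2 * u3 - y3 * u2) - e * (y1 * u2 - y2 * u1) * y1
      = - ((1 + e * y3) * (e * u2) - e * u3 * (e * y2))"
    and "(1 + e * y3) * (e * (y3 * u1 - y1 * u3)) - e * (y1 * u2 - y2 * u1) * (e * y2)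
      = (1 + e * y3) * u1 - e * u3 * y1"
    and "(1 + e * y3) * u1 - e * u3 * y1 = 0 \<Longrightarrow> (1 + e * y3) * (e * u2) - e * u3 * (e * y2) = 0
      \<Longrightarrow> (1 + e * y3) * u3 = 0"
  using assms by algebra+

context
  fixes e :: real
  assumes e: "e = 1 \<or> e = - 1"
begin

lemma stereo_inv_nth:
  "stereo_inv e \<zeta> $ 1 = 2 * Re \<zeta> / (1 + (cmod \<zeta>)\<^sup>2)" "stereo_inv e \<zeta> $ 2 = 2 * e * Im \<zeta> / (1 + (cmod \<zeta>)\<^sup>2)"
  "stereo_inv e \<zeta> $ 3 = e * (1 - (cmod \<zeta>)\<^sup>2) / (1 + (cmod \<zeta>)\<^sup>2)"
  by (simp_all add: stereo_inv_def divide_inverse mult.commute)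

lemma norm_stereo_inv: "norm (stereo_inv e \<zeta>) = 1"
proof -
  let ?N = "1 + (cmod \<zeta>)\<^sup>2"
  have "(2 * Re \<zeta>)\<^sup>2 + (2 * e * Im \<zeta>)\<^sup>2 + (e * (1 - (cmod \<zeta>)\<^sup>2))\<^sup>2 = ?N\<^sup>2"
    using e unfolding cmod_power2 by (auto simp: power2_eq_square algebra_simps)
  then show ?thesis
    using one_plus_cmod_pos[of \<zeta>] unfolding norm3 stereo_inv_nth
    by (simp add: power_divide flip: add_divide_distrib)
qed

lemma stereo_inv_pole: "1 + e * stereo_inv e \<zeta> $ 3 = 2 / (1 + (cmod \<zeta>)\<^sup>2)"
  using one_plus_cmod_pos[of \<zeta>] e unfolding stereo_inv_nth by (auto simp: field_simps)

lemma stereo_stereo_inv: "stereo e (stereo_inv e \<zeta>) = \<zeta>"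
  unfolding stereo_def stereo_inv_pole unfolding stereo_inv_nth
  using one_plus_cmod_pos[of \<zeta>] e by (auto simp: complex_eq_iff)

lemma stereo_inv_stereo:
  fixes y :: "real^3"
  assumes "norm y = 1" "1 + e * y$3 \<noteq> 0"
  shows "stereo_inv e (stereo e y) = y"
proof -
  define s where "s = 1 + e * y$3"
  have ee: "e * e = 1" using e by auto
  have s0: "s \<noteq> 0" using assms(2) by (simp add: s_def)
  have c: "(cmod (stereo e y))\<^sup>2 = ((y$1)\<^sup>2 + (y$2)\<^sup>2) / s\<^sup>2"
    unfolding stereo_def s_def[symmetric] norm_divide power_divide cmod_power2 using e by (auto simp: power2_eq_square)
  have s: "(y$1)\<^sup>2 + (y$2)\<^sup>2 = s * (2 - s)"
    using assms(1) e unfolding norm3 s_def by (auto simp: algebra_simps power2_eq_square)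
  have N: "1 + (cmod (stereo e y))\<^sup>2 = 2 / s" "1 - (cmod (stereo e y))\<^sup>2 = (2 * s - 2) / s"
    using s0 unfolding c s by (simp_all add: field_simps power2_eq_square)
  have "stereo_inv e (stereo e y) $ 1 = y$1" "stereo_inv e (stereo e y) $ 2 = e * e * y$2"
    "stereo_inv e (stereo e y) $ 3 = e * (s - 1)"
    unfolding stereo_inv_nth N using s0 by (simp_all add: stereo_def flip: s_def)
  then show ?thesis using ee by (simp add: vec_eq_iff forall_3 s_def flip: mult.assoc)
qed

lemma stereo_has_derivative:
  fixes y :: "real^3"
  assumes "1 + e * y$3 \<noteq> 0"
  shows "(stereo e has_derivative stereo_deriv e y) (at y)"
proof -
  let ?n = "\<lambda>y :: real^3. Complex (y$1) (e * y$2)" and ?d = "\<lambda>y :: real^3. complex_of_real (1 + e * y$3)"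
  have ne: "?d y \<noteq> 0" using assms by (simp only: of_real_eq_0_iff) simp
  have C: "?n = (\<lambda>y. of_real (y$1) + \<i> * of_real (e * y$2))"
    by (simp add: complex_eq_iff fun_eq_iff)
  have n: "(?n has_derivative ?n) (at y)"
    unfolding C by (auto intro!: derivative_eq_intros bounded_linear.has_derivative[OF bounded_linear_vec_nth])
  have d: "(?d has_derivative (\<lambda>h. complex_of_real (e * h$3))) (at y)"
    by (auto intro!: derivative_eq_intros bounded_linear.has_derivative[OF bounded_linear_vec_nth])
  have "((\<lambda>y. ?n y / ?d y) has_derivative (\<lambda>h. (?n h * ?d y - ?n y * of_real (e * h$3)) / (?d y * ?d y))) (at y)"
    using has_derivative_divide'[OF n d] ne by blast
  moreover have "?n h * ?d y - ?n y * of_real (e * h$3)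
    = Complex ((1 + e * y$3) * h$1 - e * h$3 * y$1) ((1 + e * y$3) * (e * h$2) - e * h$3 * (e * y$2))" for h :: "real^3"
    by (rule complex_eqI) (simp_all add: mult.commute)
  ultimately show ?thesis
    unfolding stereo_def[abs_def] stereo_deriv_def[abs_def] power2_eq_square by simp
qed

text \<open>The outer normal orientation of the sphere is the complex orientation of the line.\<close>

lemma stereo_deriv_rotation:
  fixes y :: "real^3"
  assumes "norm y = 1" "y \<bullet> u = 0"
  shows "stereo_deriv e y (y \<times> u) = \<i> * stereo_deriv e y u"
proof -
  have u: "y$1 * u$1 + y$2 * u$2 + y$3 * u$3 = 0" using assms(2) by (simp add: inner_vec_def sum_3)
  have y: "y$1 * y$1 + y$2 * y$2 + y$3 * y$3 = 1" using assms(1) unfolding norm3 by (simp add: power2_eq_square)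
  have ee: "e * e = 1" using e by auto
  have x: "(y \<times> u)$1 = y$2 * u$3 - y$3 * u$2" "(y \<times> u)$2 = y$3 * u$1 - y$1 * u$3"
    "(y \<times> u)$3 = y$1 * u$2 - y$2 * u$1" by (simp_all add: cross3_def)
  have "Complex (- B) A = \<i> * Complex A B" for A B by (rule complex_eqI) simp_all
  then show ?thesis
    unfolding stereo_deriv_def x rotation_identities(1,2)[OF ee y u] times_divide_eq_right by (simp only:)
qed

lemma stereo_deriv_injective:
  fixes y :: "real^3"
  assumes "norm y = 1" "y \<bullet> u = 0" "1 + e * y$3 \<noteq> 0" "stereo_deriv e y u = 0"
  shows "u = 0"
proof -
  have u: "y$1 * u$1 + y$2 * u$2 + y$3 * u$3 = 0" using assms(2) by (simp add: inner_vec_def sum_3)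
  have y: "y$1 * y$1 + y$2 * y$2 + y$3 * y$3 = 1" using assms(1) unfolding norm3 by (simp add: power2_eq_square)
  have ee: "e * e = 1" using e by auto
  have ne: "complex_of_real (1 + e * y$3) \<noteq> 0" using assms(3) by (simp only: of_real_eq_0_iff) simp
  have 1: "(1 + e * y$3) * u$1 - e * u$3 * y$1 = 0" "(1 + e * y$3) * (e * u$2) - e * u$3 * (e * y$2) = 0"
    using assms(4) ne unfolding stereo_deriv_def by (simp_all add: complex_eq_iff del: of_real_add)
  have u3: "u$3 = 0" using rotation_identities(3)[OF ee y u 1] assms(3) by simp
  then have "u$1 = 0" "e * u$2 = 0" using 1 assms(3) by auto
  then show ?thesis using u3 e by (auto simp: vec_eq_iff forall_3)
qed

end

section \<open>Lifting a neighbourhood of a base point\<close>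

text \<open>For \<zeta> near z there are solutions of small norm, but one choice for each \<zeta>
  has to tend to 0. A solution whose norm exceeds the infimum by less than the distance of \<zeta>
  to z achieves this.\<close>

lemma small_selection:
  fixes P :: "'a::metric_space \<Rightarrow> 'b::real_normed_vector \<Rightarrow> bool"
  assumes "\<And>\<epsilon>. \<epsilon> > 0 \<Longrightarrow> eventually (\<lambda>\<zeta>. \<exists>w. norm w < \<epsilon> \<and> P \<zeta> w) (at z)"
  shows "\<exists>W. (W \<longlongrightarrow> 0) (at z) \<and> eventually (\<lambda>\<zeta>. P \<zeta> (W \<zeta>)) (at z)"
proof -
  define I where "I \<zeta> = Inf {norm w | w. P \<zeta> w}" for \<zeta>
  define W where "W \<zeta> = (SOME w. P \<zeta> w \<and> norm w < I \<zeta> + dist \<zeta> z)" for \<zeta>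
  have W: "P \<zeta> (W \<zeta>) \<and> norm (W \<zeta>) < \<epsilon> + dist \<zeta> z" if "\<zeta> \<noteq> z" "norm w < \<epsilon>" "P \<zeta> w" for \<zeta> w \<epsilon>
  proof -
    have "I \<zeta> \<le> norm w" unfolding I_def
      by (rule cInf_lower) (use that(3) in \<open>auto intro!: bdd_belowI[of _ 0]\<close>)
    moreover have "\<exists>w. P \<zeta> w \<and> norm w < I \<zeta> + dist \<zeta> z"
      using cInf_lessD[of "{norm w | w. P \<zeta> w}" "I \<zeta> + dist \<zeta> z"] that(1,3) by (auto simp: I_def)
    then have "P \<zeta> (W \<zeta>) \<and> norm (W \<zeta>) < I \<zeta> + dist \<zeta> z" unfolding W_def by (rule someI_ex)
    ultimately show ?thesis using that(2) by linarith
  qed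
  have "(W \<longlongrightarrow> 0) (at z)"
  proof (rule tendstoI)
    fix \<epsilon> :: real assume \<epsilon>: "\<epsilon> > 0"
    have "eventually (\<lambda>\<zeta>. dist \<zeta> z < \<epsilon> / 2) (at z)" using \<epsilon> by (intro tendstoD tendsto_ident_at) simp
    moreover have "eventually (\<lambda>\<zeta>. \<exists>w. norm w < \<epsilon> / 2 \<and> P \<zeta> w) (at z)" by (rule assms) (use \<epsilon> in simp)
    moreover have "eventually (\<lambda>\<zeta>. \<zeta> \<noteq> z) (at z)" by (simp add: eventually_at_filter)
    ultimately show "eventually (\<lambda>\<zeta>. dist (W \<zeta>) 0 < \<epsilon>) (at z)"
    proof eventually_elim
      case (elim \<zeta>)
      then obtain w where "norm w < \<epsilon> / 2" "P \<zeta> w" by blast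
      then show ?case using W[of \<zeta> w "\<epsilon> / 2"] elim by simp
    qed
  qed
  moreover have "eventually (\<lambda>\<zeta>. P \<zeta> (W \<zeta>)) (at z)"
  proof -
    have "eventually (\<lambda>\<zeta>. \<zeta> \<noteq> z) (at z)" by (simp add: eventually_at_filter)
    then show ?thesis using assms[OF zero_less_one] by eventually_elim (use W in blast)
  qed
  ultimately show ?thesis by blast
qed

text \<open>S is differentiable at 0 with invertible derivative, which for a continuous map already
  yields small preimages W. The quotient of W is the reciprocal of the difference quotient of S
  along W, so its limit needs no continuity of W near z.\<close>

lemma local_right_inverse:
  fixes S :: "complex \<Rightarrow> complex"
  assumes "open U" "0 \<in> U" "continuous_on U S" "(S has_field_derivative c) (at 0)" "c \<noteq> 0" "S 0 = z"
  shows "\<exists>W. (W \<longlongrightarrow> 0) (at z) \<and> eventually (\<lambda>\<zeta>. W \<zeta> \<in> U \<and> S (W \<zeta>) = \<zeta>) (at z) \<and>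
    ((\<lambda>\<zeta>. W \<zeta> / (\<zeta> - z)) \<longlongrightarrow> 1 / c) (at z)"
proof -
  have "eventually (\<lambda>\<zeta>. \<exists>w. norm w < \<epsilon> \<and> w \<in> U \<and> S w = \<zeta>) (at z)" if "\<epsilon> > 0" for \<epsilon>
  proof -
    have "S 0 \<in> interior (S ` (U \<inter> ball 0 \<epsilon>))"
    proof (rule sussmann_open_mapping[OF assms(1,3,2)])
      show "(S has_derivative (*) c) (at 0)" using assms(4) by (simp add: has_field_derivative_def)
      show "bounded_linear ((*) (1 / c))" by (rule bounded_linear_mult_right)
      show "(*) c \<circ> (*) (1 / c) = id" using assms(5) by (simp add: fun_eq_iff)
      show "0 \<in> interior (U \<inter> ball 0 \<epsilon>)" using assms(1,2) that by (simp add: interior_open open_Int)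
    qed simp
    then have "eventually (\<lambda>\<zeta>. \<zeta> \<in> interior (S ` (U \<inter> ball 0 \<epsilon>))) (at z)"
      unfolding assms(6) by (intro eventually_at_in_open') auto
    then show ?thesis
    proof eventually_elim
      case (elim \<zeta>)
      then have "\<zeta> \<in> S ` (U \<inter> ball 0 \<epsilon>)" using interior_subset by blast
      then show ?case by auto
    qed
  qed
  then obtain W where W: "(W \<longlongrightarrow> 0) (at z)" "eventually (\<lambda>\<zeta>. W \<zeta> \<in> U \<and> S (W \<zeta>) = \<zeta>) (at z)"
    using small_selection[of "\<lambda>\<zeta> w. w \<in> U \<and> S w = \<zeta>" z] by auto
  have ne: "eventually (\<lambda>\<zeta>. \<zeta> \<noteq> z) (at z)" by (simp add: eventually_at_filter)
  have W0: "eventually (\<lambda>\<zeta>. W \<zeta> \<noteq> 0) (at z)"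
    using W(2) ne
  proof eventually_elim
    case (elim \<zeta>)
    then show ?case using assms(6) by metis
  qed
  then have "filterlim W (at 0) (at z)" using W(1) by (simp add: filterlim_at)
  moreover have "((\<lambda>w. (S w - z) / w) \<longlongrightarrow> c) (at 0)"
    using assms(4,6) unfolding has_field_derivative_iff by simp
  ultimately have "((\<lambda>\<zeta>. (S (W \<zeta>) - z) / W \<zeta>) \<longlongrightarrow> c) (at z)"
    by (rule filterlim_compose[rotated])
  then have "((\<lambda>\<zeta>. 1 / ((S (W \<zeta>) - z) / W \<zeta>)) \<longlongrightarrow> 1 / c) (at z)"
    using assms(5) by (intro tendsto_divide tendsto_const)
  moreover have "eventually (\<lambda>\<zeta>. 1 / ((S (W \<zeta>) - z) / W \<zeta>) = W \<zeta> / (\<zeta> - z)) (at z)"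
    using W(2) by eventually_elim simp
  ultimately have "((\<lambda>\<zeta>. W \<zeta> / (\<zeta> - z)) \<longlongrightarrow> 1 / c) (at z)"
    by (rule Lim_transform_eventually)
  then show ?thesis using W by (intro exI[of _ W] conjI)
qed

section \<open>Horizontal directions as a complex line\<close>

lemma qmul_right_cancel:
  assumes "p \<cdot>\<^sub>q l = q \<cdot>\<^sub>q l" "l \<noteq> 0"
  shows "p = q"
proof -
  have "(p - q) \<cdot>\<^sub>q l = 0" using assms(1) by (simp add: qmul_distrib)
  then show ?thesis using assms(2) by (simp only: qmul_eq_0) simp
qed

text \<open>\<open>conj_j l w = l (j w) l\<^sup>-\<^sup>1\<close>. If \<open>\<mu> l = l i\<close>, this parametrizes the complement of \<open>\<mu>\<close> in the imaginary
  quaternions, and right multiplication by \<open>\<mu>\<close> becomes multiplication of \<open>w\<close> by \<open>\<i>\<close>.\<close>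

definition conj_j :: "quat \<Rightarrow> complex \<Rightarrow> quat" where
  "conj_j l w = (l \<cdot>\<^sub>q (0, w) \<cdot>\<^sub>q qcnj l) /\<^sub>R (norm l)\<^sup>2"

lemma conj_j_imag: "Re (fst (conj_j l w)) = 0"
proof -
  have "qcnj (0, w) = - (0, w)" by (simp add: qcnj_def)
  then show ?thesis unfolding imaginary_iff conj_j_def qcnj_linear qcnj_qmul
    by (simp only: qmul_distrib qmul_assoc scaleR_minus_right)
qed

lemma conj_j_mult:
  assumes "l \<noteq> 0"
  shows "conj_j l w \<cdot>\<^sub>q l = l \<cdot>\<^sub>q (0, w)"
proof -
  have "l \<cdot>\<^sub>q (0, w) \<cdot>\<^sub>q qcnj l \<cdot>\<^sub>q l = (norm l)\<^sup>2 *\<^sub>R (l \<cdot>\<^sub>q (0, w))"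
    unfolding qmul_assoc[of _ "qcnj l" l] qcnj_mult_self
    by (simp add: qmul_complex prod_eq_iff scaleR_conv_of_real)
  then show ?thesis using assms by (simp add: conj_j_def qmul_scaleR)
qed

lemma norm_conj_j: "l \<noteq> 0 \<Longrightarrow> norm (conj_j l w) = norm w"
  using arg_cong[OF conj_j_mult[of l w], of norm] unfolding norm_qmul by (simp add: norm_Pair)

lemma linear_conj_j: "linear (conj_j l)"
proof (rule linearI)
  fix v w :: complex and r :: real
  have "(0, v + w) = (0, v) + ((0, w) :: quat)" "(0, r *\<^sub>R w) = r *\<^sub>R ((0, w) :: quat)" by simp_all
  then show "conj_j l (v + w) = conj_j l v + conj_j l w" "conj_j l (r *\<^sub>R w) = r *\<^sub>R conj_j l w"
    unfolding conj_j_def by (simp_all only: qmul_distrib qmul_scaleR scaleR_add_right scaleR_left_commute)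
qed

lemma norm_one_plus_imag:
  fixes a :: quat
  assumes "Re (fst a) = 0"
  shows "(norm ((1, 0) + a))\<^sup>2 = 1 + (norm a)\<^sup>2"
  using assms unfolding norm_quat cmod_power2 by (simp add: power2_eq_square)

context fibration
begin

text \<open>As \<mu> l = l i, the product of \<open>conj_j l w\<close> with \<mu> is
  \<open>conj_j l (\<i> * w)\<close>, again imaginary. The real part of this product yields the
  orthogonality, the imaginary part the cross product.\<close>

lemma conj_j_rotation:
  assumes "norm x = 1" "l \<noteq> 0" "Tf x \<cdot>\<^sub>q l = x \<cdot>\<^sub>q l \<cdot>\<^sub>q (\<i>, 0)"
  shows "qim (conj_j l w) \<bullet> tvec x = 0" "qim (conj_j l (\<i> * w)) = qim (conj_j l w) \<times> tvec x"
proof -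
  have "x \<cdot>\<^sub>q (qvec (tvec x) \<cdot>\<^sub>q l) = x \<cdot>\<^sub>q (l \<cdot>\<^sub>q (\<i>, 0))" using assms(3) by (simp add: Tf_def qmul_assoc)
  then have \<mu>: "qvec (tvec x) \<cdot>\<^sub>q l = l \<cdot>\<^sub>q (\<i>, 0)" using qcnj_unit_cancel(1)[OF assms(1)] by metis
  have "(conj_j l w \<cdot>\<^sub>q qvec (tvec x)) \<cdot>\<^sub>q l = l \<cdot>\<^sub>q ((0, w) \<cdot>\<^sub>q (\<i>, 0))"
    unfolding qmul_assoc \<mu> unfolding qmul_assoc[symmetric] conj_j_mult[OF assms(2)] ..
  also have "\<dots> = conj_j l (\<i> * w) \<cdot>\<^sub>q l" unfolding conj_j_mult[OF assms(2)] by (simp add: qmul_complex mult.commute)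
  finally have *: "conj_j l w \<cdot>\<^sub>q qvec (tvec x) = conj_j l (\<i> * w)" using assms(2) qmul_right_cancel by blast
  have a: "conj_j l w = qvec (qim (conj_j l w))" using qvec_qim[OF conj_j_imag] by simp
  have "conj_j l (\<i> * w) = qvec (qim (conj_j l w) \<times> tvec x) - (of_real (qim (conj_j l w) \<bullet> tvec x), 0)"
    unfolding *[symmetric] by (subst a) (rule qmul_qvec)
  note ** = this
  show 0: "qim (conj_j l w) \<bullet> tvec x = 0"
    using conj_j_imag[of l "\<i> * w"] unfolding ** by simp
  show "qim (conj_j l (\<i> * w)) = qim (conj_j l w) \<times> tvec x"
    unfolding ** 0 by (simp add: qim_def qvec_def vec_eq_iff forall_3)
qed

end

text \<open>x0 lies over the point at infinity of the coordinate \<zeta>. So every fiber with finite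
  coordinate avoids x0 and has a matrix with respect to x0.\<close>

locale chart = fibration +
  fixes e :: real and x0 :: quat
  assumes e: "e = 1 \<or> e = - 1" and x0: "norm x0 = 1" and pole: "1 + e * f x0 $ 3 = 0"
begin

abbreviation \<beta> :: "complex \<Rightarrow> real^3" where "\<beta> \<equiv> stereo_inv e"

lemma norm_\<beta>: "norm (\<beta> \<zeta>) = 1" by (rule norm_stereo_inv[OF e])

lemma \<beta>_pole: "1 + e * \<beta> \<zeta> $ 3 \<noteq> 0"
  unfolding stereo_inv_pole[OF e] using one_plus_cmod_pos[of \<zeta>] by simp

lemma \<beta>_eq: "norm y = 1 \<Longrightarrow> 1 + e * y $ 3 \<noteq> 0 \<Longrightarrow> stereo e y = \<zeta> \<Longrightarrow> y = \<beta> \<zeta>"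
  using stereo_inv_stereo[OF e] by metis

text \<open>Multiplication of w by i is the rotation about the fiber direction; conformality carries
  it to the rotation by a right angle in the tangent plane of S2, and stereographic projection back
  to multiplication by i. So the real derivative is complex linear, and it is nonzero because
  horizontal vectors are mapped injectively.\<close>

lemma slice_derivative:
  assumes x: "norm x = 1" "f x = \<beta> z" and l: "l \<noteq> 0" "Tf x \<cdot>\<^sub>q l = x \<cdot>\<^sub>q l \<cdot>\<^sub>q (\<i>, 0)"
  defines "S \<equiv> \<lambda>w. stereo e (radial f (x \<cdot>\<^sub>q ((1, 0) + conj_j l w)))"
  shows "\<exists>c. c \<noteq> 0 \<and> (S has_field_derivative c) (at 0)"
proof -
  let ?a = "\<lambda>w. qim (conj_j l w)"
  let ?h = "\<lambda>w. stereo_deriv e (f x) (G x (?a w))"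
  have xne: "x \<noteq> 0" using x(1) by auto
  have fx: "norm (f x) = 1" "1 + e * f x $ 3 \<noteq> 0" using \<beta>_pole f_sphere[OF x(1)] by (simp_all add: x(2))
  have a: "conj_j l w = qvec (?a w)" for w using qvec_qim[OF conj_j_imag] by simp
  have a0: "conj_j l 0 = 0" by (rule linear_0[OF linear_conj_j])
  have "bounded_linear (conj_j l)" using linear_conj_j by (rule linear_conv_bounded_linear[THEN iffD1])
  then have "bounded_linear (\<lambda>w. x \<cdot>\<^sub>q conj_j l w)"
    by (rule bounded_linear_compose[OF bounded_bilinear.bounded_linear_right[OF bounded_bilinear_qmul]])
  then have "((\<lambda>w. x + x \<cdot>\<^sub>q conj_j l w) has_derivative (\<lambda>w. 0 + x \<cdot>\<^sub>q conj_j l w)) (at 0)"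
    by (intro has_derivative_add has_derivative_const bounded_linear_imp_has_derivative)
  then have "((\<lambda>w. x \<cdot>\<^sub>q ((1, 0) + conj_j l w)) has_derivative (\<lambda>w. x \<cdot>\<^sub>q conj_j l w)) (at 0)"
    by (simp only: qmul_distrib qmul_1 add_0_left)
  then have "((\<lambda>w. radial f (x \<cdot>\<^sub>q ((1, 0) + conj_j l w))) has_derivative (\<lambda>w. differential f x (x \<cdot>\<^sub>q conj_j l w))) (at 0)"
    by (rule has_derivative_compose) (use radial_has_derivative[OF xne] a0 in simp)
  then have "(S has_derivative (\<lambda>w. stereo_deriv e (f x) (differential f x (x \<cdot>\<^sub>q conj_j l w)))) (at 0)"
    unfolding S_def by (rule has_derivative_compose) (use stereo_has_derivative[OF e fx(2)] a0 radial_unit[OF x(1)] in simp)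
  moreover have "differential f x (x \<cdot>\<^sub>q conj_j l w) = G x (?a w)" for w
    unfolding G_def a[symmetric] ..
  ultimately have S: "(S has_derivative ?h) (at 0)" by simp
  have lh: "linear ?h" using has_derivative_linear[OF S] .
  have perp: "f x \<bullet> G x t = 0" for t using plane_map.perp[OF plane_map_G[OF x(1)]] .
  have rot: "?h (\<i> * w) = \<i> * ?h w" for w
    unfolding conj_j_rotation(2)[OF x(1) l] G_rotation[OF x(1) conj_j_rotation(1)[OF x(1) l]]
    by (rule stereo_deriv_rotation[OF e fx(1) perp])
  have h: "?h w = ?h 1 * w" for w
  proof -
    have "w = Re w *\<^sub>R 1 + Im w *\<^sub>R (\<i> * 1)" by (simp add: complex_eq_iff)
    then have "?h w = Re w *\<^sub>R ?h 1 + Im w *\<^sub>R ?h (\<i> * 1)"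
      unfolding linear_add[OF lh, symmetric] linear_cmul[OF lh, symmetric] by simp
    also have "\<dots> = ?h 1 * (Re w *\<^sub>R 1 + Im w *\<^sub>R (\<i> * 1))" unfolding rot by (simp add: algebra_simps scaleR_conv_of_real)
    finally show ?thesis unfolding \<open>w = Re w *\<^sub>R 1 + Im w *\<^sub>R (\<i> * 1)\<close>[symmetric] .
  qed
  have "?h 1 \<noteq> 0"
  proof
    assume "?h 1 = 0"
    then have "G x (?a 1) = 0" using stereo_deriv_injective[OF e fx(1) perp fx(2)] by blast
    then have "?a 1 = 0" using G_injective[OF x(1) conj_j_rotation(1)[OF x(1) l]] by blast
    then have "conj_j l 1 = 0" using a[of 1] qvec_linear(5) by simp
    then show False using norm_conj_j[OF l(1), of 1] by simp
  qed
  moreover have "(S has_field_derivative ?h 1) (at 0)"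
  proof -
    have "?h = (*) (?h 1)" using h by (intro ext)
    then show ?thesis unfolding has_field_derivative_def using S by simp
  qed
  ultimately show ?thesis by blast
qed

text \<open>X \<zeta> is the point of the fiber of \<zeta> reached from x in a horizontal direction,
  and L \<zeta> spans its tangent line. To first order
  \<open>qcnj x \<cdot>\<^sub>q X \<zeta>\<close> is 1 + \<open>conj_j l w\<close>, which maps l to
  l + l j w; \<kappa> is the reciprocal of the derivative of \<zeta> with respect to w.\<close>

lemma slice:
  assumes x: "norm x = 1" "f x = \<beta> z" and l: "l \<noteq> 0" "Tf x \<cdot>\<^sub>q l = x \<cdot>\<^sub>q l \<cdot>\<^sub>q (\<i>, 0)"
  shows "\<exists>X L \<kappa>. \<kappa> \<noteq> 0 \<and> (X \<longlongrightarrow> x) (at z) \<and> (L \<longlongrightarrow> l) (at z) \<and>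
    eventually (\<lambda>\<zeta>. norm (X \<zeta>) = 1 \<and> f (X \<zeta>) = \<beta> \<zeta> \<and> Tf (X \<zeta>) \<cdot>\<^sub>q L \<zeta> = X \<zeta> \<cdot>\<^sub>q L \<zeta> \<cdot>\<^sub>q (\<i>, 0)) (at z) \<and>
    ((\<lambda>\<zeta>. (qcnj x \<cdot>\<^sub>q X \<zeta> - (1, 0)) \<cdot>\<^sub>q L \<zeta> \<cdot>\<^sub>q (1 / (\<zeta> - z), 0)) \<longlongrightarrow> l \<cdot>\<^sub>q (0, \<kappa>)) (at z)"
proof -
  let ?p = "\<lambda>w. (1, 0) + conj_j l w"
  define S where "S w = stereo e (radial f (x \<cdot>\<^sub>q ?p w))" for w
  define U where "U = {w. 1 + e * radial f (x \<cdot>\<^sub>q ?p w) $ 3 \<noteq> 0}"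
  have np2: "(norm (?p w))\<^sup>2 = 1 + (norm w)\<^sup>2" for w
    using norm_one_plus_imag[OF conj_j_imag, of l w] norm_conj_j[OF l(1), of w] by simp
  have np: "norm (?p w) \<ge> 1" for w
    using np2[of w] by (metis le_add_same_cancel1 norm_ge_zero one_power2 power2_le_imp_le zero_le_power2)
  have nx: "norm (x \<cdot>\<^sub>q ?p w) = norm (?p w)" for w by (simp add: norm_qmul x(1))
  have xne: "x \<cdot>\<^sub>q ?p w \<noteq> 0" for w using np[of w] nx[of w] by auto
  have a0: "conj_j l 0 = 0" by (rule linear_0[OF linear_conj_j])
  have bl: "bounded_linear (conj_j l)" using linear_conj_j by (rule linear_conv_bounded_linear[THEN iffD1])
  have cr: "continuous_on (- {0}) (radial f)"
    using radial_has_derivative by (intro continuous_at_imp_continuous_on) (auto intro: has_derivative_continuous)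
  have cp: "continuous_on UNIV ?p"
    by (intro continuous_intros linear_continuous_on bl)
  have c: "continuous_on UNIV (\<lambda>w. radial f (x \<cdot>\<^sub>q ?p w))"
  proof (rule continuous_on_compose2[OF cr continuous_on_qmul[OF continuous_on_const cp]])
    show "range (\<lambda>w. x \<cdot>\<^sub>q ?p w) \<subseteq> - {0}"
      by (rule image_subsetI) (simp only: Compl_iff singleton_iff xne not_False_eq_True)
  qed
  have "open U" unfolding U_def by (intro open_Collect_neq continuous_intros c)
  moreover have "0 \<in> U" using \<beta>_pole[of z] by (simp add: U_def a0 radial_unit[OF x(1)] x(2))
  moreover have "continuous_on U S"
  proof -
    have C: "Complex (y$1) (e * y$2) = of_real (y$1) + \<i> * of_real (e * y$2)" for y :: "real^3"
      by (simp add: complex_eq_iff)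
    have "complex_of_real (1 + e * radial f (x \<cdot>\<^sub>q ?p w) $ 3) \<noteq> 0" if "w \<in> U" for w
      using that unfolding U_def by (simp only: of_real_eq_0_iff) simp
    then show ?thesis unfolding S_def[abs_def] stereo_def C
      by (intro continuous_intros continuous_on_subset[OF c]) auto
  qed
  moreover obtain cc where "(S has_field_derivative cc) (at 0)" and cc: "cc \<noteq> 0"
    using slice_derivative[OF x l] unfolding S_def[abs_def] by blast
  moreover have "S 0 = z" by (simp add: S_def a0 radial_unit[OF x(1)] x(2) stereo_stereo_inv[OF e])
  ultimately obtain W where W: "(W \<longlongrightarrow> 0) (at z)" "eventually (\<lambda>\<zeta>. W \<zeta> \<in> U \<and> S (W \<zeta>) = \<zeta>) (at z)"
    "((\<lambda>\<zeta>. W \<zeta> / (\<zeta> - z)) \<longlongrightarrow> 1 / cc) (at z)"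
    using local_right_inverse[of U S cc z] by blast
  define n where "n \<zeta> = norm (?p (W \<zeta>))" for \<zeta>
  define X where "X \<zeta> = (x \<cdot>\<^sub>q ?p (W \<zeta>)) /\<^sub>R n \<zeta>" for \<zeta>
  have n1: "n \<zeta> \<ge> 1" for \<zeta> by (simp add: n_def np)
  have nX: "norm (X \<zeta>) = 1" for \<zeta>
  proof -
    have "norm (X \<zeta>) = inverse (n \<zeta>) * n \<zeta>" using n1[of \<zeta>] unfolding X_def norm_scaleR nx n_def[symmetric] by simp
    then show ?thesis using n1[of \<zeta>] by simp
  qed
  have fX: "f (X \<zeta>) = radial f (x \<cdot>\<^sub>q ?p (W \<zeta>))" for \<zeta>
    by (simp only: X_def n_def radial_def nx)
  have ev: "eventually (\<lambda>\<zeta>. f (X \<zeta>) = \<beta> \<zeta>) (at z)"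
    using W(2)
  proof eventually_elim
    case (elim \<zeta>)
    then show ?case using \<beta>_eq[of "f (X \<zeta>)" \<zeta>] f_sphere[OF nX, of \<zeta>] by (simp add: fX U_def S_def)
  qed
  have pW: "((\<lambda>\<zeta>. ?p (W \<zeta>)) \<longlongrightarrow> (1, 0)) (at z)"
    using tendsto_add[OF tendsto_const bounded_linear.tendsto[OF bl W(1)]] by (simp add: a0)
  have nl: "(n \<longlongrightarrow> 1) (at z)" unfolding n_def[abs_def] using tendsto_norm[OF pW] by (simp add: norm_Pair)
  have Xl: "(X \<longlongrightarrow> x) (at z)"
    using tendsto_scaleR[OF tendsto_inverse[OF nl] tendsto_qmul[OF tendsto_const pW]] unfolding X_def[abs_def] by simp
  \<comment> \<open>The projection of l onto the eigenvectors at X \<zeta>, as in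
    \<open>exists_eigenvector\<close> but with the factor 1/2, so that its limit is l
    itself.\<close>
  define L where "L \<zeta> = (1/2) *\<^sub>R (l - qcnj (X \<zeta>) \<cdot>\<^sub>q Tf (X \<zeta>) \<cdot>\<^sub>q l \<cdot>\<^sub>q (\<i>, 0))" for \<zeta>
  have "((\<lambda>\<zeta>. Tf (X \<zeta>)) \<longlongrightarrow> Tf x) (at z)"
    by (rule continuous_on_tendsto_compose[OF continuous_Tf Xl]) (auto simp: x(1) nX)
  then have "(L \<longlongrightarrow> (1/2) *\<^sub>R (l - qcnj x \<cdot>\<^sub>q Tf x \<cdot>\<^sub>q l \<cdot>\<^sub>q (\<i>, 0))) (at z)"
    unfolding L_def[abs_def] by (intro tendsto_intros tendsto_qmul tendsto_qcnj Xl)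
  moreover have "(1/2) *\<^sub>R (l - qcnj x \<cdot>\<^sub>q Tf x \<cdot>\<^sub>q l \<cdot>\<^sub>q (\<i>, 0)) = l"
  proof -
    have "qcnj x \<cdot>\<^sub>q Tf x \<cdot>\<^sub>q l = l \<cdot>\<^sub>q (\<i>, 0)" unfolding qmul_assoc l(2) qcnj_unit_cancel(1)[OF x(1)] ..
    then show ?thesis by (simp add: qmul_ii flip: scaleR_2)
  qed
  ultimately have Ll: "(L \<longlongrightarrow> l) (at z)" by simp
  have TL: "Tf (X \<zeta>) \<cdot>\<^sub>q L \<zeta> = X \<zeta> \<cdot>\<^sub>q L \<zeta> \<cdot>\<^sub>q (\<i>, 0)" for \<zeta>
  proof -
    define \<mu> where "\<mu> = qcnj (X \<zeta>) \<cdot>\<^sub>q Tf (X \<zeta>)"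
    have \<mu>: "\<mu> = qvec (tvec (X \<zeta>))" unfolding \<mu>_def Tf_def by (rule qcnj_unit_cancel(1)[OF nX])
    have "\<mu> \<cdot>\<^sub>q \<mu> = - (1, 0)" by (rule unit_imaginary_square) (simp_all add: \<mu> norm_tvec[OF nX])
    then have \<mu>\<mu>: "\<mu> \<cdot>\<^sub>q (\<mu> \<cdot>\<^sub>q l) = - l" by (metis qmul_1(2) qmul_assoc qmul_distrib(6))
    have "\<mu> \<cdot>\<^sub>q (\<mu> \<cdot>\<^sub>q l \<cdot>\<^sub>q (\<i>, 0)) = - (l \<cdot>\<^sub>q (\<i>, 0))" by (metis \<mu>\<mu> qmul_assoc qmul_distrib(6))
    then have "\<mu> \<cdot>\<^sub>q L \<zeta> = L \<zeta> \<cdot>\<^sub>q (\<i>, 0)"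
      unfolding L_def \<mu>_def[symmetric] by (simp add: qmul_scaleR qmul_distrib qmul_ii)
    then have "X \<zeta> \<cdot>\<^sub>q (\<mu> \<cdot>\<^sub>q L \<zeta>) = X \<zeta> \<cdot>\<^sub>q L \<zeta> \<cdot>\<^sub>q (\<i>, 0)" by (simp add: qmul_assoc)
    then show ?thesis unfolding \<mu>_def by (simp add: qmul_assoc qcnj_unit_cancel(2)[OF nX])
  qed
  define \<kappa> where "\<kappa> = 1 / cc"
  define D where "D \<zeta> = qcnj x \<cdot>\<^sub>q X \<zeta> - (1, 0)" for \<zeta>
  have D: "D \<zeta> = inverse (n \<zeta>) *\<^sub>R conj_j l (W \<zeta>) + (inverse (n \<zeta>) - 1) *\<^sub>R (1, 0)" for \<zeta>
    unfolding D_def X_def qmul_scaleR qcnj_unit_cancel(1)[OF x(1)] by (simp only: scaleR_add_right scaleR_diff_left scaleR_one) simp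
  \<comment> \<open>Normalization to the unit sphere costs a term of second order in W, negligible
    against \<zeta> - z.\<close>
  have small: "((\<lambda>\<zeta>. (inverse (n \<zeta>) - 1) *\<^sub>R (1 / (\<zeta> - z))) \<longlongrightarrow> 0) (at z)"
  proof (rule Lim_null_comparison)
    show "((\<lambda>\<zeta>. norm (W \<zeta>) * norm (W \<zeta> / (\<zeta> - z))) \<longlongrightarrow> 0) (at z)"
      using tendsto_mult[OF tendsto_norm[OF W(1)] tendsto_norm[OF W(3)]] by simp
    have "norm ((inverse (n \<zeta>) - 1) *\<^sub>R (1 / (\<zeta> - z))) \<le> norm (W \<zeta>) * norm (W \<zeta> / (\<zeta> - z))" for \<zeta>
    proof -
      have "\<bar>inverse (n \<zeta>) - 1\<bar> \<le> n \<zeta> - 1"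
      proof -
        have i: "inverse (n \<zeta>) \<le> 1" using n1[of \<zeta>] by (simp add: inverse_le_1_iff)
        have "1 - inverse (n \<zeta>) = inverse (n \<zeta>) * (n \<zeta> - 1)"
          using n1[of \<zeta>] by (simp add: right_diff_distrib)
        also have "\<dots> \<le> 1 * (n \<zeta> - 1)"
          using n1[of \<zeta>] i by (intro mult_right_mono) simp_all
        finally have "1 - inverse (n \<zeta>) \<le> n \<zeta> - 1" by simp
        then show ?thesis using i by linarith
      qed
      also have "\<dots> \<le> (n \<zeta>)\<^sup>2 - 1" using n1[of \<zeta>] by (simp add: self_le_power)
      also have "\<dots> = (norm (W \<zeta>))\<^sup>2" using np2[of "W \<zeta>"] by (simp add: n_def)
      finally have "\<bar>inverse (n \<zeta>) - 1\<bar> * norm (1 / (\<zeta> - z)) \<le> (norm (W \<zeta>))\<^sup>2 * norm (1 / (\<zeta> - z))"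
        by (rule mult_right_mono) simp
      then show ?thesis by (simp add: norm_divide power2_eq_square)
    qed
    then show "eventually (\<lambda>\<zeta>. norm ((inverse (n \<zeta>) - 1) *\<^sub>R (1 / (\<zeta> - z))) \<le> norm (W \<zeta>) * norm (W \<zeta> / (\<zeta> - z))) (at z)"
      by simp
  qed
  have Dl: "((\<lambda>\<zeta>. D \<zeta> \<cdot>\<^sub>q l \<cdot>\<^sub>q (1 / (\<zeta> - z), 0)) \<longlongrightarrow> l \<cdot>\<^sub>q (0, \<kappa>)) (at z)"
  proof -
    have eq: "D \<zeta> \<cdot>\<^sub>q l \<cdot>\<^sub>q (1 / (\<zeta> - z), 0) = inverse (n \<zeta>) *\<^sub>R (l \<cdot>\<^sub>q (0, W \<zeta> / (\<zeta> - z)))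
      + l \<cdot>\<^sub>q ((inverse (n \<zeta>) - 1) *\<^sub>R (1 / (\<zeta> - z)), 0)" for \<zeta>
    proof -
      have "D \<zeta> \<cdot>\<^sub>q l = inverse (n \<zeta>) *\<^sub>R (l \<cdot>\<^sub>q (0, W \<zeta>)) + (inverse (n \<zeta>) - 1) *\<^sub>R l"
        unfolding D by (simp only: qmul_distrib qmul_scaleR conj_j_mult[OF l(1)] qmul_1)
      then have "D \<zeta> \<cdot>\<^sub>q l \<cdot>\<^sub>q (1 / (\<zeta> - z), 0) = inverse (n \<zeta>) *\<^sub>R (l \<cdot>\<^sub>q ((0, W \<zeta>) \<cdot>\<^sub>q (1 / (\<zeta> - z), 0)))
        + l \<cdot>\<^sub>q ((inverse (n \<zeta>) - 1) *\<^sub>R (1 / (\<zeta> - z), 0))"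
        by (simp only: qmul_distrib qmul_scaleR qmul_assoc)
      then show ?thesis by (simp add: qmul_complex)
    qed
    have "((\<lambda>\<zeta>. inverse (n \<zeta>) *\<^sub>R (l \<cdot>\<^sub>q (0, W \<zeta> / (\<zeta> - z)))
      + l \<cdot>\<^sub>q ((inverse (n \<zeta>) - 1) *\<^sub>R (1 / (\<zeta> - z)), 0)) \<longlongrightarrow> inverse 1 *\<^sub>R (l \<cdot>\<^sub>q (0, 1 / cc)) + l \<cdot>\<^sub>q (0, 0)) (at z)"
      by (intro tendsto_add tendsto_scaleR tendsto_inverse nl tendsto_qmul tendsto_const tendsto_Pair W(3) small) simp
    then show ?thesis unfolding eq \<kappa>_def by (simp add: zero_prod_def[symmetric])
  qed
  \<comment> \<open>Replacing l by L \<zeta> is harmless: D divided by \<zeta> - z stays bounded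
    while L tends to l.\<close>
  have "((\<lambda>\<zeta>. D \<zeta> \<cdot>\<^sub>q (L \<zeta> - l) \<cdot>\<^sub>q (1 / (\<zeta> - z), 0)) \<longlongrightarrow> 0) (at z)"
  proof (rule tendsto_norm_zero_cancel)
    have "((\<lambda>\<zeta>. norm (D \<zeta> \<cdot>\<^sub>q l \<cdot>\<^sub>q (1 / (\<zeta> - z), 0)) * norm (L \<zeta> - l) / norm l) \<longlongrightarrow> norm (l \<cdot>\<^sub>q (0, \<kappa>)) * norm (l - l) / norm l) (at z)"
      using l(1) by (intro tendsto_intros Dl Ll) simp
    moreover have "norm (D \<zeta> \<cdot>\<^sub>q l \<cdot>\<^sub>q (1 / (\<zeta> - z), 0)) * norm (L \<zeta> - l) / norm l
      = norm (D \<zeta> \<cdot>\<^sub>q (L \<zeta> - l) \<cdot>\<^sub>q (1 / (\<zeta> - z), 0))" for \<zeta>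
      using l(1) by (simp only: norm_qmul) (simp add: field_simps)
    ultimately show "((\<lambda>\<zeta>. norm (D \<zeta> \<cdot>\<^sub>q (L \<zeta> - l) \<cdot>\<^sub>q (1 / (\<zeta> - z), 0))) \<longlongrightarrow> 0) (at z)" by simp
  qed
  from tendsto_add[OF Dl this]
  have "((\<lambda>\<zeta>. D \<zeta> \<cdot>\<^sub>q L \<zeta> \<cdot>\<^sub>q (1 / (\<zeta> - z), 0)) \<longlongrightarrow> l \<cdot>\<^sub>q (0, \<kappa>)) (at z)"
    by (simp add: qmul_distrib)
  moreover have "\<kappa> \<noteq> 0" using cc by (simp add: \<kappa>_def)
  moreover have "eventually (\<lambda>\<zeta>. norm (X \<zeta>) = 1 \<and> f (X \<zeta>) = \<beta> \<zeta> \<and> Tf (X \<zeta>) \<cdot>\<^sub>q L \<zeta> = X \<zeta> \<cdot>\<^sub>q L \<zeta> \<cdot>\<^sub>q (\<i>, 0)) (at z)"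
    using ev by eventually_elim (simp add: nX TL)
  ultimately show ?thesis using Xl Ll unfolding D_def by blast
qed

end

section \<open>Holomorphic dependence of the plane on the fiber\<close>

definition det3 :: "complex \<Rightarrow> complex \<Rightarrow> complex \<Rightarrow> complex \<Rightarrow> complex \<Rightarrow> complex \<Rightarrow> complex \<Rightarrow> complex \<Rightarrow> complex \<Rightarrow> complex" where
  "det3 a1 b1 c1 a2 b2 c2 a3 b3 c3 =
     a1 * (b2 * c3 - b3 * c2) - a2 * (b1 * c3 - b3 * c1) + a3 * (b1 * c2 - b2 * c1)"

lemma cramer_identity:
  fixes u v w :: complex
  assumes "a1 * u + b1 * v + c1 * w = r1" "a2 * u + b2 * v + c2 * w = r2" "a3 * u + b3 * v + c3 * w = r3"
  shows "u * det3 a1 b1 c1 a2 b2 c2 a3 b3 c3 = det3 r1 b1 c1 r2 b2 c2 r3 b3 c3"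
  unfolding det3_def assms[symmetric] by (simp add: algebra_simps)

text \<open>The determinants converge, and the one in the denominator stays away from 0. Only the
  first unknown is treated; the others follow by cyclic permutation of the columns.\<close>

lemma cramer_limit:
  fixes u v w a1 b1 c1 a2 b2 c2 a3 b3 c3 :: "'a \<Rightarrow> complex"
  assumes eqs: "eventually (\<lambda>x. a1 x * u x + b1 x * v x + c1 x * w x = r1 x) F"
      "eventually (\<lambda>x. a2 x * u x + b2 x * v x + c2 x * w x = r2 x) F"
      "eventually (\<lambda>x. a3 x * u x + b3 x * v x + c3 x * w x = r3 x) F"
    and lim: "(a1 \<longlongrightarrow> A1) F" "(b1 \<longlongrightarrow> B1) F" "(c1 \<longlongrightarrow> C1) F" "(r1 \<longlongrightarrow> R1) F"
      "(a2 \<longlongrightarrow> A2) F" "(b2 \<longlongrightarrow> B2) F" "(c2 \<longlongrightarrow> C2) F" "(r2 \<longlongrightarrow> R2) F"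
      "(a3 \<longlongrightarrow> A3) F" "(b3 \<longlongrightarrow> B3) F" "(c3 \<longlongrightarrow> C3) F" "(r3 \<longlongrightarrow> R3) F"
    and det: "det3 A1 B1 C1 A2 B2 C2 A3 B3 C3 \<noteq> 0"
  shows "\<exists>l. (u \<longlongrightarrow> l) F"
proof -
  define D where "D x = det3 (a1 x) (b1 x) (c1 x) (a2 x) (b2 x) (c2 x) (a3 x) (b3 x) (c3 x)" for x
  define N where "N x = det3 (r1 x) (b1 x) (c1 x) (r2 x) (b2 x) (c2 x) (r3 x) (b3 x) (c3 x)" for x
  have D: "(D \<longlongrightarrow> det3 A1 B1 C1 A2 B2 C2 A3 B3 C3) F" and N: "(N \<longlongrightarrow> det3 R1 B1 C1 R2 B2 C2 R3 B3 C3) F"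
    unfolding D_def[abs_def] N_def[abs_def] det3_def by (intro tendsto_add tendsto_diff tendsto_mult lim)+
  have "eventually (\<lambda>x. D x \<noteq> 0) F" using tendsto_imp_eventually_ne[OF D det] .
  then have "eventually (\<lambda>x. N x / D x = u x) F"
    using eqs
  proof eventually_elim
    case (elim x)
    have "u x * D x = N x" unfolding D_def N_def using elim(2-4) by (rule cramer_identity)
    then show ?case using elim(1) by (simp add: field_simps)
  qed
  with tendsto_divide[OF N D det] show ?thesis using Lim_transform_eventually by blast
qed

text \<open>The determinant of p and \<open>tfree \<alpha> \<beta> \<gamma> q\<close> is linear in
  the matrix; \<open>sq1\<close>, \<open>sq2\<close>, \<open>sq3\<close> are its coefficients at
  \<gamma>, \<alpha>, \<beta>.\<close>

definition sq1 :: "quat \<Rightarrow> quat \<Rightarrow> complex" where "sq1 p q = fst p * fst q"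
definition sq2 :: "quat \<Rightarrow> quat \<Rightarrow> complex" where "sq2 p q = - (fst p * snd q + snd p * fst q)"
definition sq3 :: "quat \<Rightarrow> quat \<Rightarrow> complex" where "sq3 p q = - (snd p * snd q)"

lemma tendsto_sq:
  assumes "(P \<longlongrightarrow> q) F"
  shows "((\<lambda>x. sq1 p (P x)) \<longlongrightarrow> sq1 p q) F" "((\<lambda>x. sq2 p (P x)) \<longlongrightarrow> sq2 p q) F" "((\<lambda>x. sq3 p (P x)) \<longlongrightarrow> sq3 p q) F"
  unfolding sq1_def sq2_def sq3_def by (intro tendsto_intros assms)+

text \<open>The homogeneous Vandermonde determinant, equal to twice the product of the pairwise
  \<open>qdet\<close>. The three versions differ by cyclic permutations of the columns.\<close>

lemma sq_det:
  assumes "qdet p1 p2 \<noteq> 0" "qdet p1 p3 \<noteq> 0" "qdet p2 p3 \<noteq> 0"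
  shows "det3 (sq1 p1 p1) (sq2 p1 p1) (sq3 p1 p1) (sq1 p2 p2) (sq2 p2 p2) (sq3 p2 p2) (sq1 p3 p3) (sq2 p3 p3) (sq3 p3 p3) \<noteq> 0"
    and "det3 (sq2 p1 p1) (sq3 p1 p1) (sq1 p1 p1) (sq2 p2 p2) (sq3 p2 p2) (sq1 p2 p2) (sq2 p3 p3) (sq3 p3 p3) (sq1 p3 p3) \<noteq> 0"
    and "det3 (sq3 p1 p1) (sq1 p1 p1) (sq2 p1 p1) (sq3 p2 p2) (sq1 p2 p2) (sq2 p2 p2) (sq3 p3 p3) (sq1 p3 p3) (sq2 p3 p3) \<noteq> 0"
proof -
  have rot: "det3 b1 c1 a1 b2 c2 a2 b3 c3 a3 = det3 a1 b1 c1 a2 b2 c2 a3 b3 c3" for a1 b1 c1 a2 b2 c2 a3 b3 c3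
    unfolding det3_def by (simp add: algebra_simps)
  have "det3 (sq1 p1 p1) (sq2 p1 p1) (sq3 p1 p1) (sq1 p2 p2) (sq2 p2 p2) (sq3 p2 p2) (sq1 p3 p3) (sq2 p3 p3) (sq3 p3 p3)
      = 2 * qdet p1 p2 * qdet p1 p3 * qdet p2 p3"
    unfolding det3_def sq1_def sq2_def sq3_def qdet_def by algebra
  then show 1: "det3 (sq1 p1 p1) (sq2 p1 p1) (sq3 p1 p1) (sq1 p2 p2) (sq2 p2 p2) (sq3 p2 p2) (sq1 p3 p3) (sq2 p3 p3) (sq3 p3 p3) \<noteq> 0"
    using assms by simp
  then show 2: "det3 (sq2 p1 p1) (sq3 p1 p1) (sq1 p1 p1) (sq2 p2 p2) (sq3 p2 p2) (sq1 p2 p2) (sq2 p3 p3) (sq3 p3 p3) (sq1 p3 p3) \<noteq> 0"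
    by (subst rot)
  then show "det3 (sq3 p1 p1) (sq1 p1 p1) (sq2 p1 p1) (sq3 p2 p2) (sq1 p2 p2) (sq2 p2 p2) (sq3 p3 p3) (sq1 p3 p3) (sq2 p3 p3) \<noteq> 0"
    by (subst rot)
qed

context fibration
begin

lemma Tf_eigenvector:
  assumes "norm x = 1"
  shows "\<exists>l. l \<noteq> 0 \<and> Tf x \<cdot>\<^sub>q l = x \<cdot>\<^sub>q l \<cdot>\<^sub>q (\<i>, 0)"
  using tangent_eigenvector unit_tangent_Tf[OF assms] unfolding unit_tangents_def by blast

lemma in_chart_plane:
  assumes "plane_represents L (oriented_fiber f y)" "norm x = 1" "f x = y" "l \<noteq> 0"
    "Tf x \<cdot>\<^sub>q l = x \<cdot>\<^sub>q l \<cdot>\<^sub>q (\<i>, 0)"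
  shows "(x \<cdot>\<^sub>q l, l) \<in> L"
proof -
  have "x \<in> fiber f y" using assms(2,3) by (simp add: fiber_def)
  then have "(x, Tf x) \<in> oriented_fiber f y" unfolding oriented_fiber_eq by blast
  then show ?thesis using assms(1,4,5) unfolding plane_represents_def by blast
qed

end

context chart
begin

text \<open>No regularity in \<zeta> is demanded: the matrices come from a choice for each fiber,
  and holomorphy is derived from this property.\<close>

definition represents_fibers :: "(complex \<Rightarrow> complex) \<Rightarrow> (complex \<Rightarrow> complex) \<Rightarrow> (complex \<Rightarrow> complex) \<Rightarrow> bool" where
  "represents_fibers A B C \<longleftrightarrow>
     (\<forall>\<zeta>. plane_represents (chart_plane x0 (A \<zeta>) (B \<zeta>) (C \<zeta>)) (oriented_fiber f (\<beta> \<zeta>)))"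

lemma exists_represents_fibers: "\<exists>A B C. represents_fibers A B C"
proof -
  have "\<exists>\<alpha> \<beta>' \<gamma>. plane_represents (chart_plane x0 \<alpha> \<beta>' \<gamma>) (oriented_fiber f (\<beta> \<zeta>))" for \<zeta>
  proof (rule fiber_chart[OF _ x0])
    show "\<beta> \<zeta> \<in> S2" by (simp add: norm_\<beta>)
    show "f x0 \<noteq> \<beta> \<zeta>" using pole \<beta>_pole by metis
  qed
  then show ?thesis unfolding represents_fibers_def by metis
qed

text \<open>\<open>chart_plane_difference\<close> between the fixed tangent line at x and the moving
  ones of \<open>slice\<close>, divided by \<zeta> - z; the limit in \<open>slice\<close> makes the
  right-hand side converge.\<close>

lemma point_relation:
  assumes M: "represents_fibers A B C" and x: "norm x = 1" "f x = \<beta> z"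
    and l: "l \<noteq> 0" "Tf x \<cdot>\<^sub>q l = x \<cdot>\<^sub>q l \<cdot>\<^sub>q (\<i>, 0)"
  defines "p \<equiv> qcnj x0 \<cdot>\<^sub>q (x \<cdot>\<^sub>q l) - l"
  shows "\<exists>P R \<rho>. (P \<longlongrightarrow> p) (at z) \<and> (R \<longlongrightarrow> \<rho>) (at z) \<and>
    eventually (\<lambda>\<zeta>. sq1 p (P \<zeta>) * ((C \<zeta> - C z) / (\<zeta> - z))
      + sq2 p (P \<zeta>) * ((A \<zeta> - A z) / (\<zeta> - z))
      + sq3 p (P \<zeta>) * ((B \<zeta> - B z) / (\<zeta> - z)) = R \<zeta>) (at z)"
proof -
  obtain X L \<kappa> where XL: "(X \<longlongrightarrow> x) (at z)" "(L \<longlongrightarrow> l) (at z)"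
    and ev: "eventually (\<lambda>\<zeta>. norm (X \<zeta>) = 1 \<and> f (X \<zeta>) = \<beta> \<zeta> \<and> Tf (X \<zeta>) \<cdot>\<^sub>q L \<zeta> = X \<zeta> \<cdot>\<^sub>q L \<zeta> \<cdot>\<^sub>q (\<i>, 0)) (at z)"
    and lim: "((\<lambda>\<zeta>. (qcnj x \<cdot>\<^sub>q X \<zeta> - (1, 0)) \<cdot>\<^sub>q L \<zeta> \<cdot>\<^sub>q (1 / (\<zeta> - z), 0)) \<longlongrightarrow> l \<cdot>\<^sub>q (0, \<kappa>)) (at z)"
    using slice[OF x l] by blast
  define P where "P \<zeta> = qcnj x0 \<cdot>\<^sub>q (X \<zeta> \<cdot>\<^sub>q L \<zeta>) - L \<zeta>" for \<zeta>
  define R where "R \<zeta> = 2 * snd (qcnj l \<cdot>\<^sub>q ((qcnj x \<cdot>\<^sub>q X \<zeta> - (1, 0)) \<cdot>\<^sub>q L \<zeta> \<cdot>\<^sub>q (1 / (\<zeta> - z), 0)))" for \<zeta>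
  have "(P \<longlongrightarrow> p) (at z)" unfolding P_def[abs_def] p_def
    by (intro tendsto_diff tendsto_qmul tendsto_const XL)
  moreover have "(R \<longlongrightarrow> 2 * snd (qcnj l \<cdot>\<^sub>q (l \<cdot>\<^sub>q (0, \<kappa>)))) (at z)" unfolding R_def[abs_def]
    by (intro tendsto_mult tendsto_snd tendsto_qmul tendsto_const lim)
  moreover have "eventually (\<lambda>\<zeta>. sq1 p (P \<zeta>) * ((C \<zeta> - C z) / (\<zeta> - z))
      + sq2 p (P \<zeta>) * ((A \<zeta> - A z) / (\<zeta> - z))
      + sq3 p (P \<zeta>) * ((B \<zeta> - B z) / (\<zeta> - z)) = R \<zeta>) (at z)"
  proof -
    have "eventually (\<lambda>\<zeta>. L \<zeta> \<noteq> 0) (at z)" using tendsto_imp_eventually_ne[OF XL(2) l(1)] .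
    with ev show ?thesis
    proof eventually_elim
      case (elim \<zeta>)
      have m: "(x \<cdot>\<^sub>q l, l) \<in> chart_plane x0 (A z) (B z) (C z)"
        using in_chart_plane[OF _ x l] M unfolding represents_fibers_def by blast
      have "(X \<zeta> \<cdot>\<^sub>q L \<zeta>, L \<zeta>) \<in> chart_plane x0 (A \<zeta>) (B \<zeta>) (C \<zeta>)"
        using in_chart_plane elim M unfolding represents_fibers_def by blast
      from chart_plane_difference[OF m this p_def[THEN meta_eq_to_obj_eq] P_def x0]
      have *: "(C \<zeta> - C z) * (fst p * fst (P \<zeta>)) - (A \<zeta> - A z) * (fst p * snd (P \<zeta>) + snd p * fst (P \<zeta>))
        - (B \<zeta> - B z) * (snd p * snd (P \<zeta>)) = 2 * snd (qcnj l \<cdot>\<^sub>q (qcnj x \<cdot>\<^sub>q X \<zeta> - (1, 0)) \<cdot>\<^sub>q L \<zeta>)" .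
      have "R \<zeta> = 2 * snd (qcnj l \<cdot>\<^sub>q (qcnj x \<cdot>\<^sub>q X \<zeta> - (1, 0)) \<cdot>\<^sub>q L \<zeta> \<cdot>\<^sub>q (1 / (\<zeta> - z), 0))"
        unfolding R_def by (simp only: qmul_assoc)
      also have "\<dots> = (2 * snd (qcnj l \<cdot>\<^sub>q (qcnj x \<cdot>\<^sub>q X \<zeta> - (1, 0)) \<cdot>\<^sub>q L \<zeta>)) / (\<zeta> - z)"
        by (simp only: qmul_complex[of _ "1 / (\<zeta> - z)"] snd_conv) simp
      finally show ?case unfolding *[symmetric]
        by (simp add: sq1_def sq2_def sq3_def diff_divide_distrib add_divide_distrib algebra_simps)
    qed
  qed
  ultimately show ?thesis by blast
qed

text \<open>At three points of a fiber the relations form a linear system for the difference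
  quotients of C, A and B with nonzero limiting determinant, so the quotients converge.\<close>

lemma represents_fibers_holomorphic:
  assumes M: "represents_fibers A B C"
  shows "A holomorphic_on UNIV" "B holomorphic_on UNIV" "C holomorphic_on UNIV"
proof -
  have "\<exists>a b c. (A has_field_derivative a) (at z) \<and> (B has_field_derivative b) (at z) \<and> (C has_field_derivative c) (at z)" for z
  proof -
    obtain x1 x2 x3 where "{x1, x2, x3} \<subseteq> fiber f (\<beta> z)" and ne: "x1 \<noteq> x2" "x1 \<noteq> x3" "x2 \<noteq> x3"
      using three_fiber_points[of "\<beta> z"] norm_\<beta> by auto
    then have x: "norm x1 = 1" "f x1 = \<beta> z" "norm x2 = 1" "f x2 = \<beta> z" "norm x3 = 1" "f x3 = \<beta> z"
      by (simp_all add: fiber_def)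
    obtain l1 where l1: "l1 \<noteq> 0" "Tf x1 \<cdot>\<^sub>q l1 = x1 \<cdot>\<^sub>q l1 \<cdot>\<^sub>q (\<i>, 0)" using Tf_eigenvector x by blast
    obtain l2 where l2: "l2 \<noteq> 0" "Tf x2 \<cdot>\<^sub>q l2 = x2 \<cdot>\<^sub>q l2 \<cdot>\<^sub>q (\<i>, 0)" using Tf_eigenvector x by blast
    obtain l3 where l3: "l3 \<noteq> 0" "Tf x3 \<cdot>\<^sub>q l3 = x3 \<cdot>\<^sub>q l3 \<cdot>\<^sub>q (\<i>, 0)" using Tf_eigenvector x by blast
    define p1 where "p1 = qcnj x0 \<cdot>\<^sub>q (x1 \<cdot>\<^sub>q l1) - l1"
    define p2 where "p2 = qcnj x0 \<cdot>\<^sub>q (x2 \<cdot>\<^sub>q l2) - l2"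
    define p3 where "p3 = qcnj x0 \<cdot>\<^sub>q (x3 \<cdot>\<^sub>q l3) - l3"
    have Mz: "plane_represents (chart_plane x0 (A z) (B z) (C z)) (oriented_fiber f (\<beta> z))"
      using M unfolding represents_fibers_def by blast
    note m = in_chart_plane[OF Mz x(1,2) l1] in_chart_plane[OF Mz x(3,4) l2] in_chart_plane[OF Mz x(5,6) l3]
    have q: "qdet p1 p2 \<noteq> 0" "qdet p1 p3 \<noteq> 0" "qdet p2 p3 \<noteq> 0"
      using chart_plane_independent[OF m(1,2) l1(1) l2(1) ne(1) p1_def p2_def x0]
        chart_plane_independent[OF m(1,3) l1(1) l3(1) ne(2) p1_def p3_def x0]
        chart_plane_independent[OF m(2,3) l2(1) l3(1) ne(3) p2_def p3_def x0] by blast+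
    obtain P1 R1 \<rho>1 where 1: "(P1 \<longlongrightarrow> p1) (at z)" "(R1 \<longlongrightarrow> \<rho>1) (at z)"
      "eventually (\<lambda>\<zeta>. sq1 p1 (P1 \<zeta>) * ((C \<zeta> - C z) / (\<zeta> - z))
      + sq2 p1 (P1 \<zeta>) * ((A \<zeta> - A z) / (\<zeta> - z))
      + sq3 p1 (P1 \<zeta>) * ((B \<zeta> - B z) / (\<zeta> - z)) = R1 \<zeta>) (at z)"
      using point_relation[OF M x(1,2) l1] unfolding p1_def by blast
    obtain P2 R2 \<rho>2 where 2: "(P2 \<longlongrightarrow> p2) (at z)" "(R2 \<longlongrightarrow> \<rho>2) (at z)"
      "eventually (\<lambda>\<zeta>. sq1 p2 (P2 \<zeta>) * ((C \<zeta> - C z) / (\<zeta> - z))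
      + sq2 p2 (P2 \<zeta>) * ((A \<zeta> - A z) / (\<zeta> - z))
      + sq3 p2 (P2 \<zeta>) * ((B \<zeta> - B z) / (\<zeta> - z)) = R2 \<zeta>) (at z)"
      using point_relation[OF M x(3,4) l2] unfolding p2_def by blast
    obtain P3 R3 \<rho>3 where 3: "(P3 \<longlongrightarrow> p3) (at z)" "(R3 \<longlongrightarrow> \<rho>3) (at z)"
      "eventually (\<lambda>\<zeta>. sq1 p3 (P3 \<zeta>) * ((C \<zeta> - C z) / (\<zeta> - z))
      + sq2 p3 (P3 \<zeta>) * ((A \<zeta> - A z) / (\<zeta> - z))
      + sq3 p3 (P3 \<zeta>) * ((B \<zeta> - B z) / (\<zeta> - z)) = R3 \<zeta>) (at z)"
      using point_relation[OF M x(5,6) l3] unfolding p3_def by blast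
    note t1 = tendsto_sq[OF 1(1), of p1] and t2 = tendsto_sq[OF 2(1), of p2] and t3 = tendsto_sq[OF 3(1), of p3]
    obtain c where c: "((\<lambda>\<zeta>. (C \<zeta> - C z) / (\<zeta> - z)) \<longlongrightarrow> c) (at z)"
      using cramer_limit[OF 1(3) 2(3) 3(3) t1 1(2) t2 2(2) t3 3(2) sq_det(1)[OF q]] by blast
    \<comment> \<open>Moves A, and then B, to the place of the first unknown of
      \<open>cramer_limit\<close>.\<close>
    have rot: "eventually (\<lambda>x. a x * u x + b x * v x + c x * w x = (r x :: complex)) F
      \<Longrightarrow> eventually (\<lambda>x. b x * v x + c x * w x + a x * u x = r x) F" for a u b v c w r and F :: "complex filter"
      by (erule eventually_mono) (simp add: ac_simps)
    note ea1 = rot[OF 1(3)] and ea2 = rot[OF 2(3)] and ea3 = rot[OF 3(3)]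
    obtain a where a: "((\<lambda>\<zeta>. (A \<zeta> - A z) / (\<zeta> - z)) \<longlongrightarrow> a) (at z)"
      using cramer_limit[OF ea1 ea2 ea3 t1(2,3,1) 1(2) t2(2,3,1) 2(2) t3(2,3,1) 3(2) sq_det(2)[OF q]] by blast
    note eb1 = rot[OF ea1] and eb2 = rot[OF ea2] and eb3 = rot[OF ea3]
    obtain b where b: "((\<lambda>\<zeta>. (B \<zeta> - B z) / (\<zeta> - z)) \<longlongrightarrow> b) (at z)"
      using cramer_limit[OF eb1 eb2 eb3 t1(3,1,2) 1(2) t2(3,1,2) 2(2) t3(3,1,2) 3(2) sq_det(3)[OF q]] by blast
    show ?thesis unfolding has_field_derivative_iff using a b c by blast
  qed
  then show "A holomorphic_on UNIV" "B holomorphic_on UNIV" "C holomorphic_on UNIV"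
    unfolding holomorphic_on_def field_differentiable_def by auto
qed

end

section \<open>Change of base point\<close>

text \<open>The coordinate of \<open>chart_vec\<close> with respect to the new base point x0', as a
  linear function of p.\<close>

definition chart_comp :: "quat \<Rightarrow> quat \<Rightarrow> complex \<Rightarrow> complex \<Rightarrow> complex \<Rightarrow> quat \<Rightarrow> quat" where
  "chart_comp x0 x0' \<alpha> \<beta> \<gamma> p = qcnj x0' \<cdot>\<^sub>q (x0 \<cdot>\<^sub>q (tfree \<alpha> \<beta> \<gamma> p + p)) - (tfree \<alpha> \<beta> \<gamma> p - p)"

text \<open>The determinant of this linear map. It vanishes iff the plane meets the twistor line of
  x0', so it is the linear equation of the corresponding hyperplane, evaluated on
  \<open>chart_biv\<close>.\<close>

definition chart_trans :: "quat \<Rightarrow> quat \<Rightarrow> complex \<Rightarrow> complex \<Rightarrow> complex \<Rightarrow> complex" where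
  "chart_trans x0 x0' \<alpha> \<beta> \<gamma> = qdet (chart_comp x0 x0' \<alpha> \<beta> \<gamma> (1, 0)) (chart_comp x0 x0' \<alpha> \<beta> \<gamma> (0, 1))"

lemma qdet_chart_comp:
  "qdet (chart_comp x0 x0' \<alpha> \<beta> \<gamma> p) (chart_comp x0 x0' \<alpha> \<beta> \<gamma> q) = qdet p q * chart_trans x0 x0' \<alpha> \<beta> \<gamma>"
proof -
  have *: "chart_comp x0 x0' \<alpha> \<beta> \<gamma> p = chart_comp x0 x0' \<alpha> \<beta> \<gamma> (1, 0) \<cdot>\<^sub>q (fst p, 0) + chart_comp x0 x0' \<alpha> \<beta> \<gamma> (0, 1) \<cdot>\<^sub>q (snd p, 0)" for p
    by (simp add: chart_comp_def prod_eq_iff qmul_def tfree_def algebra_simps)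
  show ?thesis
    by (subst (1) *, subst (3) *) (simp add: qdet_def chart_trans_def qmul_complex algebra_simps)
qed

lemma chart_comp_plane:
  assumes "norm x0 = 1" "(a, b) \<in> chart_plane x0 \<alpha> \<beta> \<gamma>"
  shows "chart_comp x0 x0' \<alpha> \<beta> \<gamma> (qcnj x0 \<cdot>\<^sub>q a - b) = 2 *\<^sub>R (qcnj x0' \<cdot>\<^sub>q a - b)"
proof -
  have q: "tfree \<alpha> \<beta> \<gamma> (qcnj x0 \<cdot>\<^sub>q a - b) = qcnj x0 \<cdot>\<^sub>q a + b" using assms(2) by (simp add: chart_plane_def)
  have *: "x0 \<cdot>\<^sub>q (qcnj x0 \<cdot>\<^sub>q a + b + (qcnj x0 \<cdot>\<^sub>q a - b)) = 2 *\<^sub>R a"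
    using assms(1) by (simp add: qmul_distrib qcnj_unit_cancel scaleR_2)
  show ?thesis unfolding chart_comp_def q * qmul_scaleR by (simp add: scaleR_2)
qed

lemma qdet_scaleR: "qdet (r *\<^sub>R p) q = of_real r * qdet p q" "qdet p (r *\<^sub>R q) = of_real r * qdet p q"
  by (simp_all add: qdet_def scaleR_conv_of_real algebra_simps)

context fibration
begin

text \<open>Both bivectors are compared with the wedge product of the same two tangent vectors. The
  4 arises because \<open>chart_comp\<close> produces twice the new coordinate of each of
  them.\<close>

lemma chart_biv_transition:
  assumes "norm x0 = 1" "norm x0' = 1" and y: "y \<in> S2"
    and M: "plane_represents (chart_plane x0 \<alpha> \<beta> \<gamma>) (oriented_fiber f y)"
    and M': "plane_represents (chart_plane x0' \<alpha>' \<beta>' \<gamma>') (oriented_fiber f y)"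
  shows "4 *s chart_biv x0 \<alpha> \<beta> \<gamma> = chart_trans x0 x0' \<alpha> \<beta> \<gamma> *s chart_biv x0' \<alpha>' \<beta>' \<gamma>'"
proof -
  obtain x1 x2 where "{x1, x2} \<subseteq> fiber f y" and ne: "x1 \<noteq> x2" using three_fiber_points[OF y] by blast
  then have x: "norm x1 = 1" "f x1 = y" "norm x2 = 1" "f x2 = y" by (simp_all add: fiber_def)
  obtain l1 where l1: "l1 \<noteq> 0" "Tf x1 \<cdot>\<^sub>q l1 = x1 \<cdot>\<^sub>q l1 \<cdot>\<^sub>q (\<i>, 0)" using Tf_eigenvector x by blast
  obtain l2 where l2: "l2 \<noteq> 0" "Tf x2 \<cdot>\<^sub>q l2 = x2 \<cdot>\<^sub>q l2 \<cdot>\<^sub>q (\<i>, 0)" using Tf_eigenvector x by blast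
  note m = in_chart_plane[OF M x(1,2) l1] in_chart_plane[OF M x(3,4) l2]
  note m' = in_chart_plane[OF M' x(1,2) l1] in_chart_plane[OF M' x(3,4) l2]
  define p1 where "p1 = qcnj x0 \<cdot>\<^sub>q (x1 \<cdot>\<^sub>q l1) - l1"
  define p2 where "p2 = qcnj x0 \<cdot>\<^sub>q (x2 \<cdot>\<^sub>q l2) - l2"
  define p1' where "p1' = qcnj x0' \<cdot>\<^sub>q (x1 \<cdot>\<^sub>q l1) - l1"
  define p2' where "p2' = qcnj x0' \<cdot>\<^sub>q (x2 \<cdot>\<^sub>q l2) - l2"
  have q: "qdet p1 p2 \<noteq> 0" by (rule chart_plane_independent[OF m l1(1) l2(1) ne p1_def p2_def assms(1)])
  have "chart_comp x0 x0' \<alpha> \<beta> \<gamma> p1 = 2 *\<^sub>R p1'" "chart_comp x0 x0' \<alpha> \<beta> \<gamma> p2 = 2 *\<^sub>R p2'"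
    using chart_comp_plane[OF assms(1)] m unfolding p1_def p2_def p1'_def p2'_def by blast+
  then have D: "4 * qdet p1' p2' = qdet p1 p2 * chart_trans x0 x0' \<alpha> \<beta> \<gamma>"
    using qdet_chart_comp[of x0 x0' \<alpha> \<beta> \<gamma> p1 p2] by (simp add: qdet_scaleR)
  have "qdet p1 p2 *s chart_biv x0 \<alpha> \<beta> \<gamma> = qdet p1' p2' *s chart_biv x0' \<alpha>' \<beta>' \<gamma>'"
    using bwedge_plane[OF assms(1) m] bwedge_plane[OF assms(2) m']
    unfolding p1_def p2_def p1'_def p2'_def by simp
  then have "qdet p1 p2 * chart_biv x0 \<alpha> \<beta> \<gamma> $ i = qdet p1' p2' * chart_biv x0' \<alpha>' \<beta>' \<gamma>' $ i" for i
    by (metis vector_smult_component)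
  then have "qdet p1 p2 * (4 * chart_biv x0 \<alpha> \<beta> \<gamma> $ i) = 4 * qdet p1' p2' * chart_biv x0' \<alpha>' \<beta>' \<gamma>' $ i" for i
    by (metis mult.assoc mult.left_commute)
  then have "4 * chart_biv x0 \<alpha> \<beta> \<gamma> $ i = chart_trans x0 x0' \<alpha> \<beta> \<gamma> * chart_biv x0' \<alpha>' \<beta>' \<gamma>' $ i" for i
    using q unfolding D by (metis mult.assoc mult_left_cancel)
  then show ?thesis by (simp add: vec_eq_iff)
qed

end

context chart
begin

lemma fiber_curve_eq:
  assumes M: "represents_fibers A B C" and p: "CP1_to_S2 p = \<beta> \<zeta>"
  shows "fiber_curve f p = vec.span {chart_biv x0 (A \<zeta>) (B \<zeta>) (C \<zeta>)}" "fiber_curve f p \<in> Q3"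
proof -
  have r: "plane_represents (chart_plane x0 (A \<zeta>) (B \<zeta>) (C \<zeta>)) (oriented_fiber f (\<beta> \<zeta>))"
    using M unfolding represents_fibers_def by blast
  obtain x1 x2 where x: "{x1, x2} \<subseteq> fiber f (\<beta> \<zeta>)" "x1 \<noteq> x2"
    using three_fiber_points[of "\<beta> \<zeta>"] norm_\<beta> by auto
  then have "(x1, Tf x1) \<in> oriented_fiber f (\<beta> \<zeta>)" "(x2, Tf x2) \<in> oriented_fiber f (\<beta> \<zeta>)"
    unfolding oriented_fiber_eq by blast+
  from fiber_curve_chart[OF x0 r this x(2)]
  show *: "fiber_curve f p = vec.span {chart_biv x0 (A \<zeta>) (B \<zeta>) (C \<zeta>)}"
    unfolding fiber_curve_def p .
  show "fiber_curve f p \<in> Q3" unfolding * using represents_chart[OF x0 r] by (simp add: represents_def)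
qed

lemma chart_biv_holomorphic:
  assumes "represents_fibers A B C"
  shows "(\<lambda>\<zeta>. chart_biv x0 (A \<zeta>) (B \<zeta>) (C \<zeta>) $ i) holomorphic_on UNIV"
proof -
  note h = represents_fibers_holomorphic[OF assms]
  have v: "(\<lambda>\<zeta>. chart_vec x0 (A \<zeta>) (B \<zeta>) (C \<zeta>) p $ j) holomorphic_on UNIV" for p and j :: 4
    using exhaust_4[of j]
    by (auto simp: chart_vec_def tfree_def qmul_def intro!: holomorphic_intros h)
  show ?thesis unfolding chart_biv_def bwedge_def by (simp, intro holomorphic_intros v)
qed

text \<open>The base point \<open>x0'\<close> of the other chart lies on the fiber with coordinate \<open>0\<close>. Its twistor line defines
  a hyperplane, which the curve of fibers meets transversally there.\<close>

lemma chart_trans_simple_zero: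
  assumes M: "represents_fibers A B C" and x0': "norm x0' = 1" "f x0' = \<beta> 0"
  defines "\<phi> \<equiv> \<lambda>s. chart_trans x0 x0' (A s) (B s) (C s)"
  shows "\<exists>d. d \<noteq> 0 \<and> ((\<lambda>s. \<phi> s / s) \<longlongrightarrow> d) (at 0)"
proof -
  note h = represents_fibers_holomorphic[OF M]
  have cont: "isCont A 0" "isCont B 0" "isCont C 0"
    using h[THEN holomorphic_on_imp_continuous_on] by (auto simp: continuous_on_eq_continuous_at)
  have "\<phi> holomorphic_on UNIV"
    unfolding \<phi>_def chart_trans_def qdet_def chart_comp_def tfree_def qmul_def qcnj_def
    by (simp, intro holomorphic_intros h)
  then obtain d where d: "(\<phi> has_field_derivative d) (at 0)"
    by (auto simp: holomorphic_on_def field_differentiable_def)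
  have M0: "plane_represents (chart_plane x0 (A 0) (B 0) (C 0)) (oriented_fiber f (\<beta> 0))"
    using M unfolding represents_fibers_def by blast
  obtain l where l: "l \<noteq> 0" "Tf x0' \<cdot>\<^sub>q l = x0' \<cdot>\<^sub>q l \<cdot>\<^sub>q (\<i>, 0)" using Tf_eigenvector x0' by blast
  obtain x2 where x2: "norm x2 = 1" "f x2 = \<beta> 0" "x0' \<noteq> x2"
  proof -
    obtain x1 x2 where "{x1, x2} \<subseteq> fiber f (\<beta> 0)" "x1 \<noteq> x2" using three_fiber_points[of "\<beta> 0"] norm_\<beta> by auto
    then have "norm x1 = 1" "f x1 = \<beta> 0" "norm x2 = 1" "f x2 = \<beta> 0" "x0' \<noteq> x1 \<or> x0' \<noteq> x2"
      by (auto simp: fiber_def)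
    then show ?thesis using that by blast
  qed
  obtain l2 where l2: "l2 \<noteq> 0" "Tf x2 \<cdot>\<^sub>q l2 = x2 \<cdot>\<^sub>q l2 \<cdot>\<^sub>q (\<i>, 0)" using Tf_eigenvector x2 by blast
  note m = in_chart_plane[OF M0 x0' l] and m2 = in_chart_plane[OF M0 x2(1,2) l2]
  define p where "p = qcnj x0 \<cdot>\<^sub>q (x0' \<cdot>\<^sub>q l) - l"
  define p2 where "p2 = qcnj x0 \<cdot>\<^sub>q (x2 \<cdot>\<^sub>q l2) - l2"
  define V where "V = (qcnj x0' \<cdot>\<^sub>q x2 - (1, 0)) \<cdot>\<^sub>q l2"
  have q: "qdet p p2 \<noteq> 0" by (rule chart_plane_independent[OF m m2 l(1) l2(1) x2(3) p_def p2_def x0])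
  \<comment> \<open>The tangent line at x0' lies in the twistor line of x0', so it is annihilated;
    hence \<phi> vanishes at 0.\<close>
  have c0: "chart_comp x0 x0' (A 0) (B 0) (C 0) p = 0"
    unfolding p_def chart_comp_plane[OF x0 m] by (simp add: qcnj_unit_cancel[OF x0'(1)])
  have c2: "chart_comp x0 x0' (A 0) (B 0) (C 0) p2 = 2 *\<^sub>R V"
    unfolding p2_def chart_comp_plane[OF x0 m2] V_def by (simp add: qmul_distrib qmul_assoc)
  have \<phi>0: "\<phi> 0 = 0"
    using qdet_chart_comp[of x0 x0' "A 0" "B 0" "C 0" p p2] q unfolding c0 \<phi>_def by (simp add: qdet_def)
  have d': "((\<lambda>s. \<phi> s / s) \<longlongrightarrow> d) (at 0)" using d \<phi>0 by (simp add: has_field_derivative_iff)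
  obtain X L \<kappa> where \<kappa>: "\<kappa> \<noteq> 0" and XL: "(X \<longlongrightarrow> x0') (at 0)" "(L \<longlongrightarrow> l) (at 0)"
    and ev: "eventually (\<lambda>\<zeta>. norm (X \<zeta>) = 1 \<and> f (X \<zeta>) = \<beta> \<zeta> \<and> Tf (X \<zeta>) \<cdot>\<^sub>q L \<zeta> = X \<zeta> \<cdot>\<^sub>q L \<zeta> \<cdot>\<^sub>q (\<i>, 0)) (at 0)"
    and lim: "((\<lambda>\<zeta>. (qcnj x0' \<cdot>\<^sub>q X \<zeta> - (1, 0)) \<cdot>\<^sub>q L \<zeta> \<cdot>\<^sub>q (1 / (\<zeta> - 0), 0)) \<longlongrightarrow> l \<cdot>\<^sub>q (0, \<kappa>)) (at 0)"
    using slice[OF x0' l] by blast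
  define P where "P s = qcnj x0 \<cdot>\<^sub>q (X s \<cdot>\<^sub>q L s) - L s" for s
  define R where "R s = (qcnj x0' \<cdot>\<^sub>q X s - (1, 0)) \<cdot>\<^sub>q L s \<cdot>\<^sub>q (1 / s, 0)" for s
  define N where "N s = chart_comp x0 x0' (A s) (B s) (C s) p2" for s
  have Pl: "(P \<longlongrightarrow> p) (at 0)" unfolding P_def[abs_def] p_def
    by (intro tendsto_diff tendsto_qmul tendsto_const XL)
  have "isCont N 0" unfolding N_def[abs_def] chart_comp_def tfree_def qmul_def
    by (simp, intro continuous_intros cont)
  then have Nl: "(N \<longlongrightarrow> 2 *\<^sub>R V) (at 0)" using c2 by (simp add: isCont_def N_def)
  have qlim: "((\<lambda>s. qdet (u s) (v s)) \<longlongrightarrow> qdet a b) (at 0)" if "(u \<longlongrightarrow> a) (at 0)" "(v \<longlongrightarrow> b) (at 0)"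
    for u v :: "complex \<Rightarrow> quat" and a b
    unfolding qdet_def by (intro tendsto_intros that)
  have "eventually (\<lambda>s. L s \<noteq> 0) (at 0)" using tendsto_imp_eventually_ne[OF XL(2) l(1)] .
  \<comment> \<open>Evaluating the determinant on the moving tangent line at X s and the fixed p2
    isolates \<phi> s / s, while the first argument has a limit known from
    \<open>slice\<close>.\<close>
  with ev have eq: "eventually (\<lambda>s. 2 * qdet (R s) (N s) = qdet (P s) p2 * (\<phi> s / s)) (at 0)"
  proof eventually_elim
    case (elim s)
    have "plane_represents (chart_plane x0 (A s) (B s) (C s)) (oriented_fiber f (\<beta> s))"
      using M unfolding represents_fibers_def by blast
    then have ms: "(X s \<cdot>\<^sub>q L s, L s) \<in> chart_plane x0 (A s) (B s) (C s)"
      using in_chart_plane elim by blast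
    have "chart_comp x0 x0' (A s) (B s) (C s) (P s) = 2 *\<^sub>R ((qcnj x0' \<cdot>\<^sub>q X s - (1, 0)) \<cdot>\<^sub>q L s)"
      unfolding P_def chart_comp_plane[OF x0 ms] by (simp add: qmul_distrib qmul_assoc)
    then have "2 * qdet ((qcnj x0' \<cdot>\<^sub>q X s - (1, 0)) \<cdot>\<^sub>q L s) (N s) = qdet (P s) p2 * \<phi> s"
      using qdet_chart_comp[of x0 x0' "A s" "B s" "C s" "P s" p2] unfolding N_def \<phi>_def by (simp add: qdet_scaleR)
    moreover have "qdet (R s) (N s) = qdet ((qcnj x0' \<cdot>\<^sub>q X s - (1, 0)) \<cdot>\<^sub>q L s) (N s) / s"
      unfolding R_def qmul_complex[of _ "1 / s"] by (simp add: qdet_def diff_divide_distrib)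
    ultimately show ?case by simp
  qed
  have "((\<lambda>s. 2 * qdet (R s) (N s)) \<longlongrightarrow> 2 * qdet (l \<cdot>\<^sub>q (0, \<kappa>)) (2 *\<^sub>R V)) (at 0)"
    by (intro tendsto_mult tendsto_const qlim Nl) (use lim in \<open>simp add: R_def[abs_def]\<close>)
  then have "((\<lambda>s. qdet (P s) p2 * (\<phi> s / s)) \<longlongrightarrow> 2 * qdet (l \<cdot>\<^sub>q (0, \<kappa>)) (2 *\<^sub>R V)) (at 0)"
    using eq by (rule Lim_transform_eventually)
  moreover have "((\<lambda>s. qdet (P s) p2 * (\<phi> s / s)) \<longlongrightarrow> qdet p p2 * d) (at 0)"
    by (intro tendsto_mult qlim Pl tendsto_const d')
  ultimately have dd: "qdet p p2 * d = 2 * qdet (l \<cdot>\<^sub>q (0, \<kappa>)) (2 *\<^sub>R V)"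
    using tendsto_unique[OF at_neq_bot] by blast
  \<comment> \<open>x0' and x2 lie on the same fiber, so the matrix difference in
    \<open>chart_plane_difference\<close> is 0. Thus the conjugate of l times V is a complex number,
    nonzero as the points differ, and V is independent of the limit l j \<kappa>.\<close>
  have "snd (qcnj l \<cdot>\<^sub>q V) = 0"
    using chart_plane_difference[OF m m2 p_def p2_def x0] unfolding V_def by (simp add: qmul_assoc)
  then obtain c where c: "qcnj l \<cdot>\<^sub>q V = (c, 0)" by (metis prod.collapse)
  have "c \<noteq> 0"
  proof
    assume "c = 0"
    then have "qcnj l \<cdot>\<^sub>q V = 0" using c by (simp add: zero_prod_def)
    moreover have "qcnj l \<noteq> 0" using l(1) norm_qcnj[of l] by (metis norm_eq_zero)
    ultimately have "V = 0" by (simp only: qmul_eq_0) simp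
    then have "qcnj x0' \<cdot>\<^sub>q x2 - (1, 0) = 0" unfolding V_def using l2(1) by (simp only: qmul_eq_0) simp
    then have "x0' \<cdot>\<^sub>q (qcnj x0' \<cdot>\<^sub>q x2) = x0' \<cdot>\<^sub>q (1, 0)" by simp
    then show False using x2(3) by (simp add: qcnj_unit_cancel[OF x0'(1)])
  qed
  moreover have "qdet (l \<cdot>\<^sub>q (0, \<kappa>)) V = - \<kappa> * c"
    unfolding qdet_qmul qcnj_qmul qmul_assoc c by (simp add: qcnj_def qmul_def)
  ultimately have "d \<noteq> 0" using dd q \<kappa> by (auto simp: qdet_scaleR)
  then show ?thesis using d' by blast
qed

end

section \<open>Curves of degree one\<close>

text \<open>Boundedness of s h (1 / s) near 0 is linear growth of h at infinity, so h is a
  polynomial of degree at most one; the limit is its slope.\<close>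

lemma entire_linear:
  assumes "h holomorphic_on UNIV" "((\<lambda>s. s * h (1 / s)) \<longlongrightarrow> b) (at (0 :: complex))"
  shows "h \<zeta> = h 0 + \<zeta> * b"
proof -
  have "eventually (\<lambda>s. dist (s * h (1 / s)) b < 1) (at 0)" using assms(2) by (rule tendstoD) simp
  then obtain r where r: "r > 0" "\<And>s. s \<noteq> 0 \<Longrightarrow> norm s < r \<Longrightarrow> dist (s * h (1 / s)) b < 1"
    unfolding eventually_at by auto
  \<comment> \<open>The bound 2 / r instead of 1 / r makes norm (1 / \<zeta>) strictly smaller than
    r.\<close>
  have bound: "norm (h \<zeta>) \<le> (norm b + 1) * norm \<zeta> ^ 1" if "2 / r \<le> norm \<zeta>" for \<zeta>
  proof -
    have z: "\<zeta> \<noteq> 0" using that r(1) by auto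
    have "norm (1 / \<zeta>) < r" using that r(1) z by (simp add: norm_divide field_simps)
    then have "dist (1 / \<zeta> * h \<zeta>) b < 1" using r(2)[of "1 / \<zeta>"] z by simp
    then have "norm (1 / \<zeta> * h \<zeta>) < norm b + 1" unfolding dist_norm by norm
    then show ?thesis using z by (simp add: norm_mult norm_divide field_simps)
  qed
  have lin: "h \<zeta> = h 0 + \<zeta> * deriv h 0" for \<zeta>
    using Liouville_polynomial[OF assms(1) bound, where \<xi> = \<zeta>] by (simp add: mult.commute)
  have "((\<lambda>s. s * h 0 + deriv h 0) \<longlongrightarrow> 0 * h 0 + deriv h 0) (at 0)" by (intro tendsto_intros)
  moreover have "eventually (\<lambda>s. s * h 0 + deriv h 0 = s * h (1 / s)) (at 0)"
  proof -
    have "s * h 0 + deriv h 0 = s * h (1 / s)" if "s \<noteq> 0" for s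
      unfolding lin[of "1 / s"] using that by (simp add: distrib_left)
    then show ?thesis unfolding eventually_at_filter by (intro always_eventually) blast
  qed
  ultimately have "((\<lambda>s. s * h (1 / s)) \<longlongrightarrow> 0 * h 0 + deriv h 0) (at 0)"
    by (rule Lim_transform_eventually)
  then have "((\<lambda>s. s * h (1 / s)) \<longlongrightarrow> deriv h 0) (at 0)" by simp
  then have "deriv h 0 = b" using tendsto_unique[OF at_neq_bot] assms(2) by blast
  then show ?thesis using lin[of \<zeta>] by simp
qed

text \<open>A parametrized projective line; the second assumption is the linear independence of A
  and B.\<close>

locale linear_curve =
  fixes g :: "(complex^2) set \<Rightarrow> (complex^'n) set" and A B :: "complex^'n"
  assumes g: "\<And>z :: complex^2. z \<noteq> 0 \<Longrightarrow> g (vec.span {z}) = vec.span {z$1 *s A + z$2 *s B}"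
    and indep: "\<And>z :: complex^2. z \<noteq> 0 \<Longrightarrow> z$1 *s A + z$2 *s B \<noteq> 0"
begin

abbreviation gl :: "complex^2 \<Rightarrow> complex^'n" where "gl z \<equiv> z$1 *s A + z$2 *s B"

lemma line_nonzero:
  fixes a b :: "complex^2"
  assumes "a$1 * b$2 - a$2 * b$1 \<noteq> 0"
  shows "a + \<zeta> *s b \<noteq> 0"
proof
  assume "a + \<zeta> *s b = 0"
  then have "a$1 = - \<zeta> * b$1" "a$2 = - \<zeta> * b$2" by (simp_all add: vec_eq_iff forall_2 add_eq_0_iff2)
  then show False using assms by simp
qed

lemma local_lift_gl:
  fixes a b :: "complex^2"
  assumes "a$1 * b$2 - a$2 * b$1 \<noteq> 0"
  shows "local_lift g a b (\<lambda>\<zeta>. gl (a + \<zeta> *s b))"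
  unfolding local_lift_def
proof (intro conjI assms exI[of _ "1 :: real"] ballI allI)
  fix i show "(\<lambda>\<zeta>. gl (a + \<zeta> *s b) $ i) holomorphic_on ball 0 1"
    by (simp, intro holomorphic_intros)
next
  fix \<zeta> show "gl (a + \<zeta> *s b) \<noteq> 0" "g (vec.span {a + \<zeta> *s b}) = vec.span {gl (a + \<zeta> *s b)}"
    using line_nonzero[OF assms] indep g by blast+
qed simp

lemma holomorphic: "g ` CP1 \<subseteq> X \<Longrightarrow> holomorphic_curve g X"
  unfolding holomorphic_curve_def using local_lift_gl by blast

lemma lin_form_combination: "lin_form c (s *s v + t *s w) = s * lin_form c v + t * lin_form c w"
  by (simp add: lin_form_def sum.distrib sum_distrib_left algebra_simps)

lemma lin_form_scale: "lin_form c (s *s v) = s * lin_form c v"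
  by (simp add: lin_form_def sum_distrib_left algebra_simps)

lemma span_subset_hyperplane: "vec.span {v} \<subseteq> {v. lin_form c v = 0} \<longleftrightarrow> lin_form c v = 0"
proof
  assume "vec.span {v} \<subseteq> {v. lin_form c v = 0}"
  moreover have "v \<in> vec.span {v}" by (rule vec.span_base) simp
  ultimately show "lin_form c v = 0" by blast
next
  assume "lin_form c v = 0"
  then show "vec.span {v} \<subseteq> {v. lin_form c v = 0}" by (auto simp: vec.span_singleton lin_form_scale)
qed

text \<open>Near 0 every holomorphic lift is the linear lift times a nonvanishing holomorphic
  factor, a quotient of coordinates, so the order is that of \<zeta> k with k nonzero. An arbitrary
  lift is treated because \<open>intersection_mult\<close> admits all of them.\<close>

lemma zorder_lift:
  assumes F: "local_lift g a b F" and a: "lin_form c (gl a) = 0" and c: "lin_form c A \<noteq> 0 \<or> lin_form c B \<noteq> 0"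
  shows "zorder (\<lambda>\<zeta>. lin_form c (F \<zeta>)) 0 = 1"
proof -
  have det: "a$1 * b$2 - a$2 * b$1 \<noteq> 0" using F by (simp add: local_lift_def)
  obtain r where r: "r > 0" "\<And>i. (\<lambda>\<zeta>. F \<zeta> $ i) holomorphic_on ball 0 r"
    and Fg: "\<And>\<zeta>. \<zeta> \<in> ball 0 r \<Longrightarrow> F \<zeta> \<noteq> 0 \<and> g (vec.span {a + \<zeta> *s b}) = vec.span {F \<zeta>}"
    using F unfolding local_lift_def by blast
  let ?G = "\<lambda>\<zeta>. gl (a + \<zeta> *s b)"
  have "?G 0 \<noteq> 0" using indep[OF line_nonzero[OF det, of 0]] .
  then obtain i where i: "?G 0 $ i \<noteq> 0" by (auto simp: vec_eq_iff)
  have hG: "(\<lambda>\<zeta>. ?G \<zeta> $ i) holomorphic_on UNIV" by (simp, intro holomorphic_intros)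
  define S where "S = ball 0 r \<inter> {\<zeta>. ?G \<zeta> $ i \<noteq> 0}"
  have "open S" unfolding S_def
    by (intro open_Int open_ball open_Collect_neq continuous_on_const holomorphic_on_imp_continuous_on[OF hG])
  moreover have "0 \<in> S" using i r(1) by (simp add: S_def)
  moreover define k where "k = b$1 * lin_form c A + b$2 * lin_form c B"
  define \<psi> where "\<psi> \<zeta> = F \<zeta> $ i / ?G \<zeta> $ i * k" for \<zeta>
  \<comment> \<open>If the form vanished along b as well as along a, it would vanish on A and B,
    since a and b are a basis.\<close>
  have k: "k \<noteq> 0"
  proof
    assume "k = 0"
    then have "b$1 * lin_form c A + b$2 * lin_form c B = 0" "a$1 * lin_form c A + a$2 * lin_form c B = 0"
      using a by (simp_all add: k_def lin_form_combination)
    then have "(a$1 * b$2 - a$2 * b$1) * lin_form c A = 0" "(a$1 * b$2 - a$2 * b$1) * lin_form c B = 0" by algebra+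
    then show False using det c by simp
  qed
  have lift: "F \<zeta> = (F \<zeta> $ i / ?G \<zeta> $ i) *s ?G \<zeta> \<and> F \<zeta> $ i \<noteq> 0" if "\<zeta> \<in> S" for \<zeta>
  proof -
    have z: "\<zeta> \<in> ball 0 r" "?G \<zeta> $ i \<noteq> 0" using that by (auto simp: S_def)
    have "F \<zeta> \<in> vec.span {F \<zeta>}" by (rule vec.span_base) simp
    then have "F \<zeta> \<in> vec.span {?G \<zeta>}" using Fg[OF z(1)] g[OF line_nonzero[OF det, of \<zeta>]] by simp
    then obtain s where s: "F \<zeta> = s *s ?G \<zeta>" by (auto simp: vec.span_singleton)
    have "F \<zeta> $ i = s * ?G \<zeta> $ i" unfolding s by (rule vector_smult_component)
    moreover have "s \<noteq> 0"
    proof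
      assume "s = 0"
      then show False using s Fg[OF z(1)] by simp
    qed
    ultimately have "F \<zeta> $ i / ?G \<zeta> $ i = s" "F \<zeta> $ i \<noteq> 0" using z(2) by (simp_all only: nonzero_mult_div_cancel_right mult_eq_0_iff simp_thms)
    then show ?thesis using s by metis
  qed
  moreover have "\<psi> holomorphic_on S" unfolding \<psi>_def
    by (intro holomorphic_intros holomorphic_on_subset[OF r(2)] holomorphic_on_subset[OF hG]) (auto simp: S_def)
  moreover have "\<psi> 0 \<noteq> 0" using lift[OF \<open>0 \<in> S\<close>] i k by (simp add: \<psi>_def)
  moreover have "lin_form c (F \<zeta>) = \<psi> \<zeta> * (\<zeta> - 0) powi 1" if "\<zeta> \<in> S" for \<zeta>
  proof -
    have "lin_form c (?G \<zeta>) = \<zeta> * k"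
    proof -
      have "lin_form c (?G \<zeta>) = lin_form c (gl a) + \<zeta> * k"
        unfolding lin_form_combination k_def by (simp add: distrib_right distrib_left mult.assoc)
      then show ?thesis using a by simp
    qed
    then have "lin_form c ((F \<zeta> $ i / ?G \<zeta> $ i) *s ?G \<zeta>) = (F \<zeta> $ i / ?G \<zeta> $ i) * (\<zeta> * k)"
      by (simp only: lin_form_scale)
    then show ?thesis using lift[OF that] by (simp add: \<psi>_def)
  qed
  ultimately show ?thesis by (intro zorder_eqI[of S 0 \<psi>]) auto
qed

lemma degree_one: "has_degree g 1"
  unfolding has_degree_def
proof (intro allI impI)
  fix c assume nc: "hyperplane_points g c \<noteq> CP1"
  have inH: "vec.span {z} \<in> hyperplane_points g c \<longleftrightarrow> z$1 * lin_form c A + z$2 * lin_form c B = 0" if "z \<noteq> 0" for z :: "complex^2"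
  proof -
    have "vec.span {z} \<in> CP1" using that unfolding projectivization_def by blast
    then show ?thesis
      unfolding hyperplane_points_def mem_Collect_eq g[OF that] span_subset_hyperplane lin_form_combination by blast
  qed
  have c: "lin_form c A \<noteq> 0 \<or> lin_form c B \<noteq> 0"
  proof (rule ccontr)
    assume "\<not> ?thesis"
    then have "vec.span {z} \<in> hyperplane_points g c" if "z \<noteq> 0" for z using inH[OF that] by simp
    then have "CP1 \<subseteq> hyperplane_points g c" by (auto simp: projectivization_def)
    moreover have "hyperplane_points g c \<subseteq> CP1" by (auto simp: hyperplane_points_def)
    ultimately show False using nc by blast
  qed
  \<comment> \<open>Up to scaling the only zero of the pulled back linear form in z.\<close>
  define a :: "complex^2" where "a = vector [- lin_form c B, lin_form c A]"
  have a: "a$1 = - lin_form c B" "a$2 = lin_form c A" by (simp_all add: a_def)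
  have a0: "a \<noteq> 0" using c a by (auto simp: vec_eq_iff forall_2)
  have H: "hyperplane_points g c = {vec.span {a}}"
  proof (intro equalityI subsetI)
    fix p assume p: "p \<in> hyperplane_points g c"
    then obtain z where z: "p = vec.span {z}" "z \<noteq> 0" by (auto simp: hyperplane_points_def projectivization_def)
    have eq: "z$1 * lin_form c A + z$2 * lin_form c B = 0" using p z inH by blast
    have "z \<in> vec.span {a}"
    proof (cases "lin_form c A = 0")
      case True
      then have "z = (- z$1 / lin_form c B) *s a" using eq c a by (simp add: vec_eq_iff forall_2)
      then show ?thesis unfolding vec.span_singleton by blast
    next
      case False
      then have "z = (z$2 / lin_form c A) *s a" using eq a
        by (simp add: vec_eq_iff forall_2 field_simps add_eq_0_iff)
      then show ?thesis unfolding vec.span_singleton by blast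
    qed
    then show "p \<in> {vec.span {a}}" using span_singleton_eq[OF z(2)] z(1) by simp
  next
    fix p assume "p \<in> {vec.span {a}}"
    then show "p \<in> hyperplane_points g c" using inH[OF a0] a by simp
  qed
  have "intersection_mult g c (vec.span {a}) = 1"
    unfolding intersection_mult_def
  proof (rule the_equality)
    have "\<exists>b :: complex^2. a$1 * b$2 - a$2 * b$1 \<noteq> 0"
    proof (cases "lin_form c A = 0")
      case True
      then show ?thesis using c a by (intro exI[of _ "axis 2 1"]) (simp add: axis_def)
    next
      case False
      then show ?thesis using a by (intro exI[of _ "axis 1 1"]) (simp add: axis_def)
    qed
    then obtain b :: "complex^2" where "a$1 * b$2 - a$2 * b$1 \<noteq> 0" by blast
    note lift = local_lift_gl[OF this]
    have "lin_form c (gl a) = 0" unfolding lin_form_combination a by simp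
    from zorder_lift[OF lift this c] lift
    show "\<exists>a' b F. vec.span {a} = vec.span {a'} \<and> local_lift g a' b F \<and> zorder (\<lambda>\<zeta>. lin_form c (F \<zeta>)) 0 = int 1"
      unfolding of_nat_1 by blast
  next
    fix m assume "\<exists>a' b F. vec.span {a} = vec.span {a'} \<and> local_lift g a' b F \<and> zorder (\<lambda>\<zeta>. lin_form c (F \<zeta>)) 0 = int m"
    then obtain a' b F where *: "vec.span {a} = vec.span {a'}" "local_lift g a' b F" "zorder (\<lambda>\<zeta>. lin_form c (F \<zeta>)) 0 = int m"
      by blast
    have "a'$1 * b$2 - a'$2 * b$1 \<noteq> 0" using *(2) by (simp add: local_lift_def)
    then have "a' \<noteq> 0" by auto
    then have "a'$1 * lin_form c A + a'$2 * lin_form c B = 0" using inH[of a'] H *(1) by blast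
    then have "lin_form c (gl a') = 0" unfolding lin_form_combination .
    then show "m = 1" using zorder_lift[OF *(2) _ c] *(3) by simp
  qed
  then show "finite (hyperplane_points g c) \<and> (\<Sum>p\<in>hyperplane_points g c. intersection_mult g c p) = 1"
    unfolding H by simp
qed

end

section \<open>The curve of fibers\<close>

lemma bloch_scale:
  assumes "s \<noteq> 0"
  shows "bloch (s *s z) = bloch z"
proof -
  have c: "cnj (s * a) * (s * b) = of_real ((cmod s)\<^sup>2) * (cnj a * b)" for a b
    using complex_norm_square[of s] by (simp add: algebra_simps)
  have s: "(cmod s)\<^sup>2 \<noteq> 0" using assms by simp
  have N: "(cmod (s * a))\<^sup>2 = (cmod s)\<^sup>2 * (cmod a)\<^sup>2" for a by (simp add: norm_mult power_mult_distrib)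
  have v: "(vector [2 * Re (cnj (s * a) * (s * b)), 2 * Im (cnj (s * a) * (s * b)),
      (cmod (s * a))\<^sup>2 - (cmod (s * b))\<^sup>2] :: real^3)
    = (cmod s)\<^sup>2 *\<^sub>R vector [2 * Re (cnj a * b), 2 * Im (cnj a * b), (cmod a)\<^sup>2 - (cmod b)\<^sup>2]" for a b
    unfolding c N by (simp add: vec_eq_iff forall_3 algebra_simps)
  have "(cmod (s * a))\<^sup>2 + (cmod (s * b))\<^sup>2 = (cmod s)\<^sup>2 * ((cmod a)\<^sup>2 + (cmod b)\<^sup>2)" for a b
    unfolding N by (simp add: distrib_left)
  then show ?thesis unfolding bloch_def vector_smult_component v using s by simp
qed

lemma CP1_to_S2_span:
  assumes "z \<noteq> 0"
  shows "CP1_to_S2 (vec.span {z}) = bloch z"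
  unfolding CP1_to_S2_def
proof (rule the_equality)
  show "\<exists>z'\<in>vec.span {z}. z' \<noteq> 0 \<and> bloch z = bloch z'"
    using assms vec.span_base[of z "{z}"] by blast
next
  fix y assume "\<exists>z'\<in>vec.span {z}. z' \<noteq> 0 \<and> y = bloch z'"
  then obtain k where k: "k *s z \<noteq> 0" "y = bloch (k *s z)" by (auto simp: vec.span_singleton)
  then have "k \<noteq> 0" by auto
  then show "y = bloch z" using k(2) bloch_scale by simp
qed

lemma bloch_stereo_inv:
  fixes z :: "complex^2"
  shows "z$1 \<noteq> 0 \<Longrightarrow> bloch z = stereo_inv 1 (z$2 / z$1)"
    and "z$2 \<noteq> 0 \<Longrightarrow> bloch z = stereo_inv (- 1) (z$1 / z$2)"
proof -
  assume z: "z$1 \<noteq> 0"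
  have "bloch z = bloch ((1 / z$1) *s z)" using z by (simp add: bloch_scale)
  also have "\<dots> = stereo_inv 1 (z$2 / z$1)"
    using z unfolding bloch_def stereo_inv_def vector_smult_component by simp
  finally show "bloch z = stereo_inv 1 (z$2 / z$1)" .
next
  assume z: "z$2 \<noteq> 0"
  have "bloch z = bloch ((1 / z$2) *s z)" using z by (simp add: bloch_scale)
  also have "\<dots> = stereo_inv (- 1) (z$1 / z$2)"
    using z unfolding bloch_def stereo_inv_def vector_smult_component
    by (simp add: add.commute complex_cnj_divide[symmetric] del: complex_cnj_divide)
  finally show "bloch z = stereo_inv (- 1) (z$1 / z$2)" .
qed

lemma stereo_inv_inverse: "s \<noteq> 0 \<Longrightarrow> stereo_inv 1 (1 / s) = stereo_inv (- 1) s"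
  using bloch_stereo_inv[of "vector [s, 1]"] by simp

lemma span_scaled:
  fixes v :: "complex^'n"
  assumes "k \<noteq> 0" "v \<noteq> 0"
  shows "vec.span {k *s v} = vec.span {v}"
  by (rule span_singleton_eq) (use assms in \<open>auto intro: vec.span_scale vec.span_base\<close>)

text \<open>With x1 over [0 : 1] the bivector F1 is an entire lift in \<zeta> = z2 / z1, and with x2
  over [1 : 0] the bivector F2 covers \<zeta> = \<infinity>. On the overlap F1 (1 / s) is F2 s times
  4 / \<phi> s, and \<phi> has a simple zero at 0, so s F1 (1 / s) converges.\<close>

lemma (in fibration) fiber_curve_linear: "\<exists>A B. linear_curve (fiber_curve f) A B"
  and fiber_curve_in_Q3: "fiber_curve f ` CP1 \<subseteq> Q3"
proof -
  have "\<exists>x. norm x = 1 \<and> f x = stereo_inv e 0" if "e = 1 \<or> e = - 1" for e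
    using three_fiber_points[of "stereo_inv e 0"] norm_stereo_inv[OF that] by (auto simp: fiber_def)
  then obtain x1 x2 where x1: "norm x1 = 1" "f x1 = stereo_inv (- 1) 0" and x2: "norm x2 = 1" "f x2 = stereo_inv 1 0"
    by blast
  interpret c1: chart f 1 x1
    by unfold_locales (use x1 stereo_inv_pole[of "- 1" 0] in simp_all)
  interpret c2: chart f "- 1" x2
    by unfold_locales (use x2 stereo_inv_pole[of 1 0] in simp_all)
  obtain A1 B1 C1 where M1: "c1.represents_fibers A1 B1 C1" using c1.exists_represents_fibers by blast
  obtain A2 B2 C2 where M2: "c2.represents_fibers A2 B2 C2" using c2.exists_represents_fibers by blast
  define F1 where "F1 \<zeta> = chart_biv x1 (A1 \<zeta>) (B1 \<zeta>) (C1 \<zeta>)" for \<zeta>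
  define F2 where "F2 \<zeta> = chart_biv x2 (A2 \<zeta>) (B2 \<zeta>) (C2 \<zeta>)" for \<zeta>
  define \<phi> where "\<phi> s = chart_trans x2 x1 (A2 s) (B2 s) (C2 s)" for s
  have F1: "F1 \<zeta> \<noteq> 0" and F2: "F2 \<zeta> \<noteq> 0" for \<zeta>
    unfolding F1_def F2_def using chart_biv_nonzero x1(1) x2(1) by blast+
  obtain d where d: "d \<noteq> 0" "((\<lambda>s. \<phi> s / s) \<longlongrightarrow> d) (at 0)"
    using c2.chart_trans_simple_zero[OF M2 x1] unfolding \<phi>_def by blast
  \<comment> \<open>The limit of s F1 (1 / s) at 0, hence the slope of F1; as a nonzero multiple of
    F2 0 it represents the fiber over [0 : 1].\<close>
  define B where "B = (4 / d) *s F2 0"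
  have trans: "4 *s F2 s = \<phi> s *s F1 (1 / s)" if "s \<noteq> 0" for s
  proof -
    have y: "stereo_inv (- 1) s \<in> S2" using c2.norm_\<beta> by simp
    have r2: "plane_represents (chart_plane x2 (A2 s) (B2 s) (C2 s)) (oriented_fiber f (stereo_inv (- 1) s))"
      using M2 unfolding c2.represents_fibers_def by blast
    have "plane_represents (chart_plane x1 (A1 (1/s)) (B1 (1/s)) (C1 (1/s))) (oriented_fiber f (stereo_inv 1 (1/s)))"
      using M1 unfolding c1.represents_fibers_def by blast
    then have r1: "plane_represents (chart_plane x1 (A1 (1/s)) (B1 (1/s)) (C1 (1/s))) (oriented_fiber f (stereo_inv (- 1) s))"
      unfolding stereo_inv_inverse[OF that] .
    show ?thesis unfolding F1_def F2_def \<phi>_def by (rule chart_biv_transition[OF x2(1) x1(1) y r2 r1])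
  qed
  have lin: "F1 \<zeta> = F1 0 + \<zeta> *s B" for \<zeta>
  proof -
    have "F1 \<zeta> $ i = F1 0 $ i + \<zeta> * B $ i" for i
    proof (rule entire_linear)
      show "(\<lambda>\<zeta>. F1 \<zeta> $ i) holomorphic_on UNIV" unfolding F1_def by (rule c1.chart_biv_holomorphic[OF M1])
      have "(\<lambda>s. F2 s $ i) holomorphic_on UNIV" unfolding F2_def by (rule c2.chart_biv_holomorphic[OF M2])
      then have "((\<lambda>s. F2 s $ i) \<longlongrightarrow> F2 0 $ i) (at 0)"
        using holomorphic_on_imp_continuous_on by (auto simp: continuous_on_def)
      then have "((\<lambda>s. 4 * F2 s $ i / (\<phi> s / s)) \<longlongrightarrow> 4 * F2 0 $ i / d) (at 0)"
        using d by (intro tendsto_divide tendsto_mult tendsto_const)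
      moreover have "eventually (\<lambda>s. 4 * F2 s $ i / (\<phi> s / s) = s * F1 (1 / s) $ i) (at 0)"
      proof -
        have "eventually (\<lambda>s. s \<noteq> 0) (at (0 :: complex))" by (simp add: eventually_at_filter)
        moreover have "eventually (\<lambda>s. \<phi> s / s \<noteq> 0) (at 0)" using tendsto_imp_eventually_ne[OF d(2,1)] .
        ultimately show ?thesis
        proof eventually_elim
          case (elim s)
          have "4 * F2 s $ i = \<phi> s * F1 (1 / s) $ i"
            using arg_cong[OF trans[OF elim(1)], of "\<lambda>v. v $ i"] by simp
          then show ?case using elim by simp
        qed
      qed
      ultimately have "((\<lambda>s. s * F1 (1 / s) $ i) \<longlongrightarrow> 4 * F2 0 $ i / d) (at 0)"
        by (rule Lim_transform_eventually)
      then show "((\<lambda>s. s * F1 (1 / s) $ i) \<longlongrightarrow> B $ i) (at 0)" by (simp add: B_def)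
    qed
    then show ?thesis by (simp add: vec_eq_iff)
  qed
  have g1: "fiber_curve f (vec.span {z}) = vec.span {F1 (z$2 / z$1)}" "fiber_curve f (vec.span {z}) \<in> Q3"
    if "z$1 \<noteq> 0" for z :: "complex^2"
  proof -
    have "z \<noteq> 0" using that by auto
    then have "CP1_to_S2 (vec.span {z}) = stereo_inv 1 (z$2 / z$1)"
      using CP1_to_S2_span bloch_stereo_inv(1)[OF that] by simp
    from c1.fiber_curve_eq[OF M1 this]
    show "fiber_curve f (vec.span {z}) = vec.span {F1 (z$2 / z$1)}" "fiber_curve f (vec.span {z}) \<in> Q3"
      unfolding F1_def .
  qed
  have g2: "fiber_curve f (vec.span {z}) = vec.span {F2 0}" "fiber_curve f (vec.span {z}) \<in> Q3"
    if "z$1 = 0" "z$2 \<noteq> 0" for z :: "complex^2"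
  proof -
    have "z \<noteq> 0" using that by auto
    then have "CP1_to_S2 (vec.span {z}) = stereo_inv (- 1) 0"
      using CP1_to_S2_span bloch_stereo_inv(2)[OF that(2)] that(1) by simp
    from c2.fiber_curve_eq[OF M2 this]
    show "fiber_curve f (vec.span {z}) = vec.span {F2 0}" "fiber_curve f (vec.span {z}) \<in> Q3"
      unfolding F2_def .
  qed
  have z2: "z$2 \<noteq> 0" if "z \<noteq> 0" "z$1 = 0" for z :: "complex^2"
    using that by (auto simp: vec_eq_iff forall_2)
  \<comment> \<open>Every nontrivial combination of F1 0 and B is a nonzero multiple of a value of
    F1 or of F2 0. This gives both the parametrization and the independence.\<close>
  have comb: "(z$1 \<noteq> 0 \<and> z$1 *s F1 0 + z$2 *s B = z$1 *s F1 (z$2 / z$1)) \<or>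
      (z$1 = 0 \<and> z$2 \<noteq> 0 \<and> z$1 *s F1 0 + z$2 *s B = (z$2 * 4 / d) *s F2 0)" if "z \<noteq> 0" for z :: "complex^2"
  proof (cases "z$1 = 0")
    case True
    then show ?thesis using z2[OF that] by (simp add: B_def vec_eq_iff)
  next
    case False
    then show ?thesis unfolding lin[of "z$2 / z$1"] by (simp add: vec_eq_iff distrib_left)
  qed
  have "linear_curve (fiber_curve f) (F1 0) B"
  proof
    fix z :: "complex^2" assume z: "z \<noteq> 0"
    show "fiber_curve f (vec.span {z}) = vec.span {z$1 *s F1 0 + z$2 *s B}"
      using comb[OF z] g1(1)[of z] g2(1)[of z] span_scaled[OF _ F1] span_scaled[OF _ F2] d(1) by auto
    show "z$1 *s F1 0 + z$2 *s B \<noteq> 0"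
      using comb[OF z] F1[of "z$2 / z$1"] F2[of 0] d(1) by auto
  qed
  then show "\<exists>A B. linear_curve (fiber_curve f) A B" by blast
  show "fiber_curve f ` CP1 \<subseteq> Q3"
  proof
    fix P assume "P \<in> fiber_curve f ` CP1"
    then obtain z :: "complex^2" where z: "z \<noteq> 0" "P = fiber_curve f (vec.span {z})"
      unfolding projectivization_def by blast
    then show "P \<in> Q3" using g1(2)[of z] g2(2)[of z] z2[of z] by blast
  qed
qed

theorem proposition4p6:
  fixes \<pi> :: "quat \<Rightarrow> real^3"
  assumes "conformal_circle_fibration \<pi>"
  shows "holomorphic_curve (fiber_curve \<pi>) Q3 \<and> has_degree (fiber_curve \<pi>) 1"
proof -
  interpret fibration \<pi> by unfold_locales (rule assms)
  obtain A B where "linear_curve (fiber_curve \<pi>) A B" using fiber_curve_linear by blast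
  then interpret linear_curve "fiber_curve \<pi>" A B .
  show ?thesis using holomorphic[OF fiber_curve_in_Q3] degree_one by blast
qed

end
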